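(* Let $(u_h(t),\boldsymbol q_h(t),\widehat u_h(t))\in W_h\times\boldsymbol V_h\times M_h$, $t\in[0,T]$, be a solution of the semidiscrete HDG scheme described in the context. Then $$\mathcal E(t)=\mathcal E(0)\qquad\text{for all } t\in[0,T],$$ where $$\mathcal E(t)=\tfrac12\Big(\|u_{ht}(t)\|^2+\|\boldsymbol q_h(t)\|^2+\|u_h(t)-\widehat u_h(t)\|_+^2+2\,(F(u_h(t)),1)\Big).$$
   Context: $\Omega\subset\mathbb R^2$ is a convex polygonal domain, $T>0$, $f(s)=s^3-s$ and $F(s)=\frac14(1-s^2)^2$ (so $F\ge 0$, $F'=f$). $\mathscr T_h$ is a shape regular triangulation of $\overline\Omega$, $\mathcal E_h$ the set of faces (edges) $E$ of the elements $K\in\mathscr T_h$, $\Gamma_\partial=\mathcal E_h\cap\partial\Omega$ the boundary faces, $\boldsymbol n$ the unit outward normal of the element $K$ considered, $k\ge0$ an integer, $\mathcal P_k$ polynomials of degree $\le k$, and $W_h=\{w\in L^2(\Omega): w|_K\in\mathcal P_k(K)\ \forall K\}$, $\boldsymbol V_h=\{\boldsymbol v\in[L^2(\Omega)]^2:\boldsymbol v|_K\in[\mathcal P_k(K)]^2\ \forall K\}$, $M_h=\{\mu\in L^2(\mathcal E_h):\mu|_E\in\mathcal P_k(E)\ \forall E\in\mathcal E_h\}$. Notation: $(\cdot,\cdot)=\sum_K\int_K$, $\langle\phi,\psi\rangle=\sum_K\int_{\partial K}\phi\psi$, $\|\cdot\|$ is the $L^2(\Omega)$ norm, $\tau:\mathcal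 E_h\to\mathbb R^+$ is constant on each face, and $\|\psi-\widehat\psi\|_+^2=\sum_{K\in\mathscr T_h}\|\tau^{1/2}(\psi-\widehat\psi)\|_{L^2(\partial K)}^2$. Subscript $t$ denotes time derivative. Semidiscrete HDG scheme: for $t\in(0,T]$, for all $\boldsymbol v_h\in\boldsymbol V_h$, $w_h\in W_h$, $\mu_1,\mu_2\in M_h$, $(\boldsymbol q_h,\boldsymbol v_h)+(u_h,\nabla\cdot\boldsymbol v_h)-\langle\widehat u_h,\boldsymbol v_h\cdot\boldsymbol n\rangle=0$; $(u_{htt},w_h)+(\boldsymbol q_h,\nabla w_h)-\langle\widehat{\boldsymbol q}_h\cdot\boldsymbol n,w_h\rangle+(f(u_h),w_h)=0$; $\sum_K\langle\widehat{\boldsymbol q}_h\cdot\boldsymbol n,\mu_1\rangle_{\partial K\setminus\partial\Omega}=0$; $\langle\widehat u_h,\mu_2\rangle_{\Gamma_\partial}=0$; with numerical flux $\widehat{\boldsymbol q}_h\cdot\boldsymbol n=\boldsymbol q_h\cdot\boldsymbol n-\tau(u_h-\widehat u_h)$ on each $\partial K$, and initial conditions $u_h(0)=u_{h0}\in W_h$, $u_{ht}(0)=u_{h1}\in W_h$. *)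

theory Defs
  imports "HOL-Analysis.Analysis"
begin

section \<open>Domain, mesh, faces\<close>

definition convex_polygonal_domain :: "(real^2) set \<Rightarrow> bool" where
  "convex_polygonal_domain \<Omega> \<longleftrightarrow>
     open \<Omega> \<and> convex \<Omega> \<and> \<Omega> \<noteq> {} \<and> polytope (closure \<Omega>)"

definition inradius :: "(real^2) set \<Rightarrow> real" where
  "inradius K = Sup {r. 0 \<le> r \<and> (\<exists>x. cball x r \<subseteq> K)}"

text \<open>Shape regularity bounds \<^term>\<open>diameter K / inradius K\<close> by a constant \<open>\<sigma>\<close>, which for a
  family of meshes does not depend on the mesh.\<close>

definition shape_regular_triangulation ::
    "real \<Rightarrow> (real^2) set \<Rightarrow> (real^2) set set \<Rightarrow> bool" where
  "shape_regular_triangulation \<sigma> \<Omega> \<T> \<longleftrightarrow>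
     triangulation \<T> \<and> (\<forall>K\<in>\<T>. 2 simplex K) \<and> \<Union>\<T> = closure \<Omega> \<and>
     (\<forall>K\<in>\<T>. diameter K \<le> \<sigma> * inradius K)"

definition edges :: "(real^2) set \<Rightarrow> (real^2) set set" where
  "edges K = {E. E edge_of K}"

definition faces :: "(real^2) set set \<Rightarrow> (real^2) set set" where
  "faces \<T> = (\<Union>K\<in>\<T>. edges K)"

definition boundary_faces :: "(real^2) set \<Rightarrow> (real^2) set set \<Rightarrow> (real^2) set set" where
  "boundary_faces \<Omega> \<T> = {E\<in>faces \<T>. E \<subseteq> frontier \<Omega>}"

text \<open>The inequality says that \<open>n\<close> supports \<open>K\<close> along the edge \<open>E\<close>; applied to two points of \<open>E\<close>
  it gives orthogonality to \<open>E\<close>.\<close>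

definition outward_normal :: "(real^2) set \<Rightarrow> (real^2) set \<Rightarrow> real^2" where
  "outward_normal K E = (THE n. norm n = 1 \<and> (\<forall>x\<in>E. \<forall>y\<in>K. n \<bullet> (y - x) \<le> 0))"


section \<open>Integration over elements and faces\<close>

text \<open>The end points of a segment are determined up to order. The line integral and the notion of
  ``almost everywhere'' below do not depend on the order.\<close>

definition edge_ends :: "(real^2) set \<Rightarrow> (real^2) \<times> (real^2)" where
  "edge_ends E = (SOME e. E = closed_segment (fst e) (snd e))"

definition edge_path :: "(real^2) set \<Rightarrow> real \<Rightarrow> real^2" where
  "edge_path E = linepath (fst (edge_ends E)) (snd (edge_ends E))"

definition edge_integral :: "(real^2) set \<Rightarrow> (real^2 \<Rightarrow> real) \<Rightarrow> real" where
  "edge_integral E g =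
     dist (fst (edge_ends E)) (snd (edge_ends E)) * (LINT s|lebesgue_on {0..1}. g (edge_path E s))"

definition mesh_integral :: "(real^2) set set \<Rightarrow> (real^2 \<Rightarrow> real) \<Rightarrow> real" where
  "mesh_integral \<T> g = (\<Sum>K\<in>\<T>. LINT x|lebesgue_on K. g x)"

text \<open>The integrand of a sum of integrals over element boundaries depends on the element (through
  traces and normals) and on the edge (through \<open>\<tau>\<close> and the normal).\<close>

definition bdry_integral ::
    "(real^2) set set \<Rightarrow> ((real^2) set \<Rightarrow> (real^2) set \<Rightarrow> real^2 \<Rightarrow> real) \<Rightarrow> real" where
  "bdry_integral \<T> g = (\<Sum>K\<in>\<T>. \<Sum>E\<in>edges K. edge_integral E (g K E))"

definition interior_bdry_integral ::
    "(real^2) set \<Rightarrow> (real^2) set set \<Rightarrow> ((real^2) set \<Rightarrow> (real^2) set \<Rightarrow> real^2 \<Rightarrow> real) \<Rightarrow> real" where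
  "interior_bdry_integral \<Omega> \<T> g =
     (\<Sum>K\<in>\<T>. \<Sum>E\<in>edges K - boundary_faces \<Omega> \<T>. edge_integral E (g K E))"

definition L2_norm :: "(real^2) set \<Rightarrow> (real^2 \<Rightarrow> 'b::real_normed_vector) \<Rightarrow> real" where
  "L2_norm \<Omega> w = sqrt (LINT x|lebesgue_on \<Omega>. (norm (w x))\<^sup>2)"

definition faces_L2_norm :: "(real^2) set set \<Rightarrow> (real^2 \<Rightarrow> real) \<Rightarrow> real" where
  "faces_L2_norm \<T> \<mu> = sqrt (\<Sum>E\<in>faces \<T>. edge_integral E (\<lambda>x. (\<mu> x)\<^sup>2))"


section \<open>Discrete spaces\<close>

definition poly_fun :: "nat \<Rightarrow> (real^2 \<Rightarrow> real) set" where
  "poly_fun k = {p. \<exists>c :: nat \<Rightarrow> nat \<Rightarrow> real.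
     \<forall>x. p x = (\<Sum>i\<le>k. \<Sum>j\<le>k - i. c i j * (x $ 1) ^ i * (x $ 2) ^ j)}"

definition L2_fun :: "(real^2) set \<Rightarrow> (real^2 \<Rightarrow> real) set" where
  "L2_fun \<Omega> = {w. w \<in> borel_measurable (lebesgue_on \<Omega>) \<and>
                  integrable (lebesgue_on \<Omega>) (\<lambda>x. (w x)\<^sup>2)}"

definition L2_faces :: "(real^2) set set \<Rightarrow> (real^2 \<Rightarrow> real) set" where
  "L2_faces \<T> = {\<mu>. \<forall>E\<in>faces \<T>.
     (\<lambda>s. \<mu> (edge_path E s)) \<in> borel_measurable (lebesgue_on {0..1}) \<and>
     integrable (lebesgue_on {0..1}) (\<lambda>s. (\<mu> (edge_path E s))\<^sup>2)}"

text \<open>Elements of the discrete spaces are representatives of \<open>L\<^sup>2\<close> classes, so membership in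
  \<open>P\<^sub>k\<close> is required almost everywhere.\<close>

definition W_h :: "(real^2) set \<Rightarrow> (real^2) set set \<Rightarrow> nat \<Rightarrow> (real^2 \<Rightarrow> real) set" where
  "W_h \<Omega> \<T> k = {w \<in> L2_fun \<Omega>. \<forall>K\<in>\<T>. \<exists>p\<in>poly_fun k. AE x in lebesgue_on K. w x = p x}"

definition V_h :: "(real^2) set \<Rightarrow> (real^2) set set \<Rightarrow> nat \<Rightarrow> (real^2 \<Rightarrow> real^2) set" where
  "V_h \<Omega> \<T> k = {v. \<forall>i. (\<lambda>x. v x $ i) \<in> W_h \<Omega> \<T> k}"

definition M_h :: "(real^2) set set \<Rightarrow> nat \<Rightarrow> (real^2 \<Rightarrow> real) set" where
  "M_h \<T> k = {\<mu> \<in> L2_faces \<T>. \<forall>E\<in>faces \<T>. \<exists>p\<in>poly_fun k.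
                AE s in lebesgue_on {0..1}. \<mu> (edge_path E s) = p (edge_path E s)}"

text \<open>The polynomial that represents \<open>w\<close> on the element \<open>K\<close>. It is unique, since \<open>K\<close> has positive
  area. It supplies the derivatives of \<open>w\<close> on \<open>K\<close> and the trace of \<open>w\<close> on the boundary of \<open>K\<close>,
  neither of which is determined by the pointwise values of a representative.\<close>

definition elem_poly :: "(real^2) set \<Rightarrow> (real^2 \<Rightarrow> real) \<Rightarrow> real^2 \<Rightarrow> real" where
  "elem_poly K w = (THE p. (\<exists>k. p \<in> poly_fun k) \<and> (AE x in lebesgue_on K. w x = p x))"

definition elem_poly_vec :: "(real^2) set \<Rightarrow> (real^2 \<Rightarrow> real^2) \<Rightarrow> real^2 \<Rightarrow> real^2" where
  "elem_poly_vec K v x = (\<chi> i. elem_poly K (\<lambda>y. v y $ i) x)"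

definition partial_deriv :: "2 \<Rightarrow> (real^2 \<Rightarrow> real) \<Rightarrow> real^2 \<Rightarrow> real" where
  "partial_deriv i g x = frechet_derivative g (at x) (axis i 1)"

definition elem_grad :: "(real^2) set \<Rightarrow> (real^2 \<Rightarrow> real) \<Rightarrow> real^2 \<Rightarrow> real^2" where
  "elem_grad K w x = (\<chi> i. partial_deriv i (elem_poly K w) x)"

definition elem_div :: "(real^2) set \<Rightarrow> (real^2 \<Rightarrow> real^2) \<Rightarrow> real^2 \<Rightarrow> real" where
  "elem_div K v x = (\<Sum>i\<in>UNIV. partial_deriv i (\<lambda>y. elem_poly_vec K v y $ i) x)"


section \<open>The semidiscrete HDG scheme\<close>

definition f_nl :: "real \<Rightarrow> real" where
  "f_nl s = s ^ 3 - s"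

definition F_nl :: "real \<Rightarrow> real" where
  "F_nl s = 1/4 * (1 - s\<^sup>2)\<^sup>2"

definition q_flux ::
    "((real^2) set \<Rightarrow> real) \<Rightarrow> (real^2 \<Rightarrow> real) \<Rightarrow> (real^2 \<Rightarrow> real^2) \<Rightarrow> (real^2 \<Rightarrow> real) \<Rightarrow>
     (real^2) set \<Rightarrow> (real^2) set \<Rightarrow> real^2 \<Rightarrow> real" where
  "q_flux \<tau> u q uhat K E x =
     elem_poly_vec K q x \<bullet> outward_normal K E - \<tau> E * (elem_poly K u x - uhat x)"

text \<open>The equations at a fixed time; \<open>a\<close> is the value of the second time derivative of \<open>u\<close>.\<close>

definition hdg_equations ::
    "(real^2) set \<Rightarrow> (real^2) set set \<Rightarrow> ((real^2) set \<Rightarrow> real) \<Rightarrow> nat \<Rightarrow>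
     (real^2 \<Rightarrow> real) \<Rightarrow> (real^2 \<Rightarrow> real) \<Rightarrow> (real^2 \<Rightarrow> real^2) \<Rightarrow> (real^2 \<Rightarrow> real) \<Rightarrow> bool" where
  "hdg_equations \<Omega> \<T> \<tau> k u a q uhat \<longleftrightarrow>
     (\<forall>v\<in>V_h \<Omega> \<T> k.
        mesh_integral \<T> (\<lambda>x. q x \<bullet> v x)
        + (\<Sum>K\<in>\<T>. LINT x|lebesgue_on K. u x * elem_div K v x)
        - bdry_integral \<T> (\<lambda>K E x. uhat x * (elem_poly_vec K v x \<bullet> outward_normal K E)) = 0) \<and>
     (\<forall>w\<in>W_h \<Omega> \<T> k.
        mesh_integral \<T> (\<lambda>x. a x * w x)
        + (\<Sum>K\<in>\<T>. LINT x|lebesgue_on K. q x \<bullet> elem_grad K w x)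
        - bdry_integral \<T> (\<lambda>K E x. q_flux \<tau> u q uhat K E x * elem_poly K w x)
        + mesh_integral \<T> (\<lambda>x. f_nl (u x) * w x) = 0) \<and>
     (\<forall>\<mu>\<in>M_h \<T> k.
        interior_bdry_integral \<Omega> \<T> (\<lambda>K E x. q_flux \<tau> u q uhat K E x * \<mu> x) = 0) \<and>
     (\<forall>\<mu>\<in>M_h \<T> k.
        (\<Sum>E\<in>boundary_faces \<Omega> \<T>. edge_integral E (\<lambda>x. uhat x * \<mu> x)) = 0)"

text \<open>Derivative and continuity in time of functions on \<open>[0,T]\<close> with values in \<open>L\<^sup>2\<close>; one-sided at
  the end points.\<close>

definition has_time_deriv ::
    "(real^2) set \<Rightarrow> real \<Rightarrow> (real \<Rightarrow> real^2 \<Rightarrow> real) \<Rightarrow> (real^2 \<Rightarrow> real) \<Rightarrow> real \<Rightarrow> bool" where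
  "has_time_deriv \<Omega> T u v t \<longleftrightarrow>
     ((\<lambda>s. L2_norm \<Omega> (\<lambda>x. (u s x - u t x) / (s - t) - v x)) \<longlongrightarrow> 0) (at t within {0..T})"

definition time_continuous ::
    "(real^2) set \<Rightarrow> real \<Rightarrow> (real \<Rightarrow> real^2 \<Rightarrow> 'b::real_normed_vector) \<Rightarrow> bool" where
  "time_continuous \<Omega> T u \<longleftrightarrow>
     (\<forall>t\<in>{0..T}. ((\<lambda>s. L2_norm \<Omega> (\<lambda>x. u s x - u t x)) \<longlongrightarrow> 0) (at t within {0..T}))"

definition time_continuous_faces ::
    "(real^2) set set \<Rightarrow> real \<Rightarrow> (real \<Rightarrow> real^2 \<Rightarrow> real) \<Rightarrow> bool" where
  "time_continuous_faces \<T> T \<mu> \<longleftrightarrow>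
     (\<forall>t\<in>{0..T}. ((\<lambda>s. faces_L2_norm \<T> (\<lambda>x. \<mu> s x - \<mu> t x)) \<longlongrightarrow> 0) (at t within {0..T}))"

text \<open>A solution has \<open>u \<in> C\<^sup>1([0,T]; W\<^sub>h)\<close>, twice differentiable in time on \<open>(0,T]\<close>, with first and
  second derivatives \<open>ut\<close> and \<open>utt\<close>, and \<open>q\<close>, \<open>uhat\<close> continuous in time. Since the scheme holds
  only for \<open>t > 0\<close>, continuity at \<open>t = 0\<close> is what ties the initial values to it. Differentiability
  of \<open>q\<close> and \<open>uhat\<close> is not assumed.\<close>

definition hdg_solution ::
    "(real^2) set \<Rightarrow> (real^2) set set \<Rightarrow> ((real^2) set \<Rightarrow> real) \<Rightarrow> nat \<Rightarrow> real \<Rightarrow>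
     (real^2 \<Rightarrow> real) \<Rightarrow> (real^2 \<Rightarrow> real) \<Rightarrow>
     (real \<Rightarrow> real^2 \<Rightarrow> real) \<Rightarrow> (real \<Rightarrow> real^2 \<Rightarrow> real) \<Rightarrow> (real \<Rightarrow> real^2 \<Rightarrow> real) \<Rightarrow>
     (real \<Rightarrow> real^2 \<Rightarrow> real^2) \<Rightarrow> (real \<Rightarrow> real^2 \<Rightarrow> real) \<Rightarrow> bool" where
  "hdg_solution \<Omega> \<T> \<tau> k T u0 u1 u ut utt q uhat \<longleftrightarrow>
     (\<forall>t\<in>{0..T}. u t \<in> W_h \<Omega> \<T> k \<and> q t \<in> V_h \<Omega> \<T> k \<and> uhat t \<in> M_h \<T> k) \<and>
     (\<forall>t\<in>{0..T}. ut t \<in> W_h \<Omega> \<T> k \<and> has_time_deriv \<Omega> T u (ut t) t) \<and>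
     (\<forall>t\<in>{0<..T}. utt t \<in> W_h \<Omega> \<T> k \<and> has_time_deriv \<Omega> T ut (utt t) t) \<and>
     time_continuous \<Omega> T ut \<and> time_continuous \<Omega> T q \<and> time_continuous_faces \<T> T uhat \<and>
     (\<forall>t\<in>{0<..T}. hdg_equations \<Omega> \<T> \<tau> k (u t) (utt t) (q t) (uhat t)) \<and>
     (AE x in lebesgue_on \<Omega>. u 0 x = u0 x) \<and> (AE x in lebesgue_on \<Omega>. ut 0 x = u1 x)"


section \<open>The discrete energy\<close>

definition plus_norm ::
    "(real^2) set set \<Rightarrow> ((real^2) set \<Rightarrow> real) \<Rightarrow> (real^2 \<Rightarrow> real) \<Rightarrow> (real^2 \<Rightarrow> real) \<Rightarrow> real" where
  "plus_norm \<T> \<tau> u uhat =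
     sqrt (bdry_integral \<T> (\<lambda>K E x. (sqrt (\<tau> E) * (elem_poly K u x - uhat x))\<^sup>2))"

definition hdg_energy ::
    "(real^2) set \<Rightarrow> (real^2) set set \<Rightarrow> ((real^2) set \<Rightarrow> real) \<Rightarrow>
     (real^2 \<Rightarrow> real) \<Rightarrow> (real^2 \<Rightarrow> real) \<Rightarrow> (real^2 \<Rightarrow> real^2) \<Rightarrow> (real^2 \<Rightarrow> real) \<Rightarrow> real" where
  "hdg_energy \<Omega> \<T> \<tau> u ut q uhat =
     1/2 * ((L2_norm \<Omega> ut)\<^sup>2 + (L2_norm \<Omega> q)\<^sup>2 + (plus_norm \<T> \<tau> u uhat)\<^sup>2
            + 2 * mesh_integral \<T> (\<lambda>x. F_nl (u x) * 1))"

end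

theory Submission
  imports Defs
begin

text \<open>For states \<open>X = (u, q, h)\<close>, with \<open>h\<close> in the role of the numerical trace, let
  \[ a(X, Y) = (q_X, q_Y) + \langle \tau (u_X - h_X), u_Y - h_Y \rangle, \qquad
     b(w; Y) = (q_Y, \nabla w) - \langle \widehat q_Y \cdot n, w \rangle . \]
The energy is \<open>1/2 (\<parallel>u\<^sub>t\<parallel>\<^sup>2 + a(X, X)) + (F(u), 1)\<close>, and the second equation of the scheme says
\<open>(u\<^sub>t\<^sub>t, w) + b(w; X) + (f(u), w) = 0\<close>. So the energy is constant once
\<open>d/dt a(X, X) = 2 b(u\<^sub>t; X)\<close>.

The usual derivation differentiates the first equation in time. Here \<open>q\<close> and the trace are only
continuous in time, so the derivative of \<open>a(X, X)\<close> is taken by difference quotients. If \<open>X\<close> satisfies the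
first and the last equation and \<open>Y\<close> the third, then \<open>a(X, Y) = b(u\<^sub>X; Y)\<close>
(\<open>energy_form_eq_residual_form\<close>): test the first equation for \<open>X\<close> with \<open>q\<^sub>Y\<close>, integrate by parts on
each element, and remove the term with \<open>h\<^sub>X\<close> on the faces, which the third equation for \<open>Y\<close> cancels
on the interior faces and the last equation for \<open>X\<close> on the boundary. Since \<open>a\<close> is symmetric,
  \[ a(X_s, X_s) - a(X_t, X_t) = b(u_s - u_t; X_s) + b(u_s - u_t; X_t) \]
(\<open>energy_form_difference\<close>). The right hand side contains only the increment of \<open>u\<close>, which is
differentiable. Division by \<open>s - t\<close> and \<open>s \<rightarrow> t\<close> give the claim, because \<open>b(w; X\<^sub>s)\<close> is continuous in
\<open>s\<close>. At \<open>t = 0\<close>, where the scheme is not imposed, continuity of the energy suffices.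

Three tools support this. Integration by parts rests on the divergence theorem on a triangle
(\<open>divergence_theorem_simplex2\<close>), proved by Fubini on a reference triangle. All limits in time are reduced
to scalar functions: on an element the coefficients of the polynomial that represents \<open>w\<close> are
integrals of \<open>w\<close> against a dual basis (\<open>elem_poly_expansion\<close>), so convergence in \<open>L\<^sup>2\<close> gives
convergence of coefficients, and hence uniform convergence of the polynomials and of their traces.
The same holds on a face. Finally, the increment of \<open>F\<close> factors as
\<open>F(a) - F(b) = (a - b) H(a, b)\<close> with a polynomial \<open>H\<close>, which passes to the limit uniformly.\<close>

section \<open>Functions with a continuous representative, and dual bases\<close>

text \<open>Elements of the discrete spaces are \<open>L\<^sup>2\<close> representatives that agree almost everywhere with a
polynomial on an element or on a face. On a compact set, agreement with a continuous function is all
that integrability and the algebra of integrals require, and unlike agreement with a polynomial of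
bounded degree it is preserved by products.\<close>

definition ae_cont :: "'a::euclidean_space set \<Rightarrow> ('a \<Rightarrow> real) \<Rightarrow> bool" where
  "ae_cont S h \<longleftrightarrow> (\<exists>c. continuous_on S c \<and> (AE x in lebesgue_on S. h x = c x))"

lemma ae_cont_continuous: "continuous_on S h \<Longrightarrow> ae_cont S h"
  by (auto simp: ae_cont_def)

lemma ae_cont_cong:
  assumes "ae_cont S g" "AE x in lebesgue_on S. h x = g x" shows "ae_cont S h"
proof -
  obtain c where c: "continuous_on S c" "AE x in lebesgue_on S. g x = c x"
    using assms by (auto simp: ae_cont_def)
  have "AE x in lebesgue_on S. h x = c x" using assms(2) c(2) by eventually_elim simp
  with c show ?thesis by (auto simp: ae_cont_def)
qed

lemma ae_cont_const: "ae_cont S (\<lambda>x. c)"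
  by (simp add: ae_cont_continuous)

lemma ae_cont_compose2:
  assumes "ae_cont S f" "ae_cont S g" "continuous_on UNIV (\<lambda>z. H (fst z) (snd z))"
  shows "ae_cont S (\<lambda>x. H (f x) (g x))"
proof -
  obtain c d where c: "continuous_on S c" "AE x in lebesgue_on S. f x = c x"
   and d: "continuous_on S d" "AE x in lebesgue_on S. g x = d x"
    using assms by (auto simp: ae_cont_def)
  have "AE x in lebesgue_on S. H (f x) (g x) = H (c x) (d x)"
    using c(2) d(2) by eventually_elim simp
  moreover have "continuous_on S (\<lambda>x. H (c x) (d x))"
    using continuous_on_compose2[OF assms(3) continuous_on_Pair[OF c(1) d(1)]] by simp
  ultimately show ?thesis by (auto simp: ae_cont_def)
qed

lemma ae_cont_add: "ae_cont S f \<Longrightarrow> ae_cont S g \<Longrightarrow> ae_cont S (\<lambda>x. f x + g x)"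
  by (rule ae_cont_compose2) (auto intro!: continuous_intros)
lemma ae_cont_diff: "ae_cont S f \<Longrightarrow> ae_cont S g \<Longrightarrow> ae_cont S (\<lambda>x. f x - g x)"
  by (rule ae_cont_compose2[where H="\<lambda>a b. a - b"]) (auto intro!: continuous_intros)
lemma ae_cont_mult: "ae_cont S f \<Longrightarrow> ae_cont S g \<Longrightarrow> ae_cont S (\<lambda>x. f x * g x)"
  by (rule ae_cont_compose2[where H="\<lambda>a b. a * b"]) (auto intro!: continuous_intros)
lemma ae_cont_divide: "ae_cont S f \<Longrightarrow> ae_cont S (\<lambda>x. f x / c)"
  using ae_cont_mult[of S f "\<lambda>x. inverse c"] by (simp add: divide_inverse ae_cont_const)
lemma ae_cont_sum: "(\<And>i. i \<in> I \<Longrightarrow> ae_cont S (f i)) \<Longrightarrow> ae_cont S (\<lambda>x. \<Sum>i\<in>I. f i x)"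
  by (induction I rule: infinite_finite_induct) (simp_all add: ae_cont_const ae_cont_add)

lemmas ae_cont_intros = ae_cont_const ae_cont_add ae_cont_diff ae_cont_mult ae_cont_divide ae_cont_sum

text \<open>Measurability comes from completeness of Lebesgue measure: no measurability of the representative
itself is known.\<close>

lemma borel_measurable_lebesgue_on_AE_eq:
  fixes h :: "'a::euclidean_space \<Rightarrow> real"
  assumes c: "c \<in> borel_measurable (lebesgue_on S)" and S: "S \<in> sets lebesgue"
    and ae: "AE x in lebesgue_on S. h x = c x"
  shows "h \<in> borel_measurable (lebesgue_on S)"
proof -
  let ?c = "\<lambda>x. if x \<in> S then c x else 0" let ?h = "\<lambda>x. if x \<in> S then h x else 0"
  have ae': "AE x in lebesgue. ?h x = ?c x"
    using ae S by (subst (asm) AE_restrict_space_iff) auto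
  have c': "?c \<in> borel_measurable lebesgue" using c S by (rule borel_measurable_if_I)
  have "?h \<in> borel_measurable lebesgue"
  proof (rule measurableI)
    fix A :: "real set" assume "A \<in> sets borel"
    then have "?c -` A \<inter> space lebesgue \<in> sets lebesgue" using c' by (rule measurable_sets[rotated])
    then show "?h -` A \<inter> space lebesgue \<in> sets lebesgue"
      by (rule completion.in_sets_AE[rotated]) (use ae' in \<open>auto elim!: eventually_mono split: if_splits\<close>)
  qed auto
  then show ?thesis by (rule borel_measurable_if_D)
qed

lemma integrable_ae_cont:
  fixes h :: "'a::euclidean_space \<Rightarrow> real"
  assumes "ae_cont S h" "compact S"
  shows "integrable (lebesgue_on S) h"
proof -
  obtain c where c: "continuous_on S c" "AE x in lebesgue_on S. h x = c x"
    using assms by (auto simp: ae_cont_def)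
  have S: "S \<in> sets lebesgue" "S \<in> lmeasurable" using assms(2) lmeasurable_compact fmeasurableD by blast+
  have cm: "c \<in> borel_measurable (lebesgue_on S)"
    using c(1) S(1) by (rule continuous_imp_measurable_on_sets_lebesgue)
  obtain B where B: "\<And>x. x \<in> S \<Longrightarrow> norm (c x) \<le> B"
    using compact_imp_bounded[OF compact_continuous_image[OF c(1) assms(2)]] by (auto simp: bounded_iff)
  interpret finite_measure "lebesgue_on S" by (rule finite_measure_lebesgue_on[OF S(2)])
  have ci: "integrable (lebesgue_on S) c"
    using B cm S(1) by (intro integrable_const_bound[where B=B] AE_I2) (auto simp: space_restrict_space)
  show ?thesis
    by (rule integrable_cong_AE_imp[OF ci borel_measurable_lebesgue_on_AE_eq[OF cm S(1) c(2)]])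
      (use c(2) in auto)
qed

lemma integral_cong_ae_cont:
  fixes h :: "'a::euclidean_space \<Rightarrow> real"
  assumes "ae_cont S g" "compact S" "AE x in lebesgue_on S. h x = g x"
  shows "(LINT x|lebesgue_on S. h x) = (LINT x|lebesgue_on S. g x)"
proof (rule integral_cong_AE)
  show "g \<in> borel_measurable (lebesgue_on S)"
    using integrable_ae_cont[OF assms(1,2)] by simp
  show "h \<in> borel_measurable (lebesgue_on S)"
    using integrable_ae_cont[OF ae_cont_cong[OF assms(1,3)] assms(2)] by simp
qed (rule assms(3))

lemma integral_square_eq_0:
  fixes h :: "'a::euclidean_space \<Rightarrow> real"
  assumes "ae_cont S h" "compact S" "(LINT x|lebesgue_on S. h x * h x) = 0"
  shows "AE x in lebesgue_on S. h x = 0"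
proof -
  have i: "integrable (lebesgue_on S) (\<lambda>x. h x * h x)"
    using assms by (intro integrable_ae_cont ae_cont_intros)
  have "AE x in lebesgue_on S. h x * h x = 0"
    using integral_nonneg_eq_0_iff_AE[OF i] assms(3) by simp
  then show ?thesis by auto
qed

lemma Cauchy_Schwarz_ae_cont:
  fixes f g :: "'a::euclidean_space \<Rightarrow> real"
  assumes f: "ae_cont S f" and g: "ae_cont S g" and S: "compact S"
  shows "(LINT x|lebesgue_on S. f x * g x)\<^sup>2
     \<le> (LINT x|lebesgue_on S. f x * f x) * (LINT x|lebesgue_on S. g x * g x)"
proof -
  let ?I = "\<lambda>h. LINT x|lebesgue_on S. h x"
  define A B C where "A = ?I (\<lambda>x. f x * f x)" and "B = ?I (\<lambda>x. f x * g x)" and "C = ?I (\<lambda>x. g x * g x)"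
  note int = integrable_ae_cont[OF _ S]
  show ?thesis
  proof (cases "C = 0")
    case True
    then have "AE x in lebesgue_on S. g x = 0"
      using integral_square_eq_0[OF g S] by (simp add: C_def)
    then have "AE x in lebesgue_on S. f x * g x = 0" by eventually_elim simp
    then have "B = ?I (\<lambda>x. 0)" unfolding B_def
      by (intro integral_cong_ae_cont ae_cont_intros S)
    then show ?thesis using True by (simp add: A_def B_def C_def)
  next
    case False
    have "C \<ge> 0" unfolding C_def by (rule Bochner_Integration.integral_nonneg) simp
    then have C: "C > 0" using False by simp
    \<comment> \<open>Minimising \<open>\<parallel>f - r g\<parallel>\<^sup>2\<close> over \<open>r\<close> gives \<open>r = B / C\<close>; multiplied by \<open>C\<close> no division occurs.\<close>
    have "0 \<le> ?I (\<lambda>x. (C * f x - B * g x) * (C * f x - B * g x))"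
      by (rule Bochner_Integration.integral_nonneg) simp
    also have "\<dots> = ?I (\<lambda>x. C\<^sup>2 * (f x * f x) - (2*B*C) * (f x * g x) + B\<^sup>2 * (g x * g x))"
      by (simp add: power2_eq_square algebra_simps)
    also have "\<dots> = C\<^sup>2 * A - 2*B*C * B + B\<^sup>2 * C"
    proof -
      have "?I (\<lambda>x. C\<^sup>2 * (f x * f x) - (2*B*C) * (f x * g x) + B\<^sup>2 * (g x * g x))
        = ?I (\<lambda>x. C\<^sup>2 * (f x * f x) - (2*B*C) * (f x * g x)) + ?I (\<lambda>x. B\<^sup>2 * (g x * g x))"
        using f g by (intro Bochner_Integration.integral_add int ae_cont_intros) auto
      also have "?I (\<lambda>x. C\<^sup>2 * (f x * f x) - (2*B*C) * (f x * g x))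
        = ?I (\<lambda>x. C\<^sup>2 * (f x * f x)) - ?I (\<lambda>x. (2*B*C) * (f x * g x))"
        using f g by (intro Bochner_Integration.integral_diff int ae_cont_intros) auto
      finally show ?thesis by (simp add: A_def B_def C_def)
    qed
    finally have "C * (B\<^sup>2) \<le> C * (A * C)" by (simp add: power2_eq_square algebra_simps)
    with C show ?thesis by (simp add: A_def B_def C_def)
  qed
qed

lemma integral_lincomb:
  fixes f :: "'a::euclidean_space \<Rightarrow> real"
  assumes "compact S" "ae_cont S g" "finite I" "\<And>i. i \<in> I \<Longrightarrow> ae_cont S (b i)"
  shows "(LINT x|lebesgue_on S. (\<Sum>i\<in>I. c i * b i x) * g x)
     = (\<Sum>i\<in>I. c i * (LINT x|lebesgue_on S. b i x * g x))"
proof -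
  have "(LINT x|lebesgue_on S. (\<Sum>i\<in>I. c i * b i x) * g x)
     = (LINT x|lebesgue_on S. (\<Sum>i\<in>I. c i * (b i x * g x)))"
    by (simp add: sum_distrib_right mult.assoc)
  also have "\<dots> = (\<Sum>i\<in>I. (LINT x|lebesgue_on S. c i * (b i x * g x)))"
    using assms by (intro Bochner_Integration.integral_sum integrable_ae_cont ae_cont_intros) auto
  finally show ?thesis by simp
qed

text \<open>Gram--Schmidt without normalisation, by induction on the family: project the new function \<open>b i0\<close> on the
old family, and correct the projection of \<open>g\<close> by a multiple of the remainder \<open>r0\<close>. The family may be
dependent; then \<open>r0\<close> is null and no correction is needed.\<close>

lemma L2_projection:
  fixes b :: "'i \<Rightarrow> 'a::euclidean_space \<Rightarrow> real"
  assumes S: "compact S" and "finite I" and "\<And>i. i \<in> I \<Longrightarrow> ae_cont S (b i)" and "ae_cont S g"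
  shows "\<exists>p. \<forall>j\<in>I. (LINT x|lebesgue_on S. (g x - (\<Sum>i\<in>I. p i * b i x)) * b j x) = 0"
  using assms(2-)
proof (induction I arbitrary: g)
  case empty
  then show ?case by simp
next
  case (insert i0 I)
  let ?I = "\<lambda>h. LINT x|lebesgue_on S. h x"
  note int = integrable_ae_cont[OF _ S]
  have b: "ae_cont S (b i)" if "i \<in> insert i0 I" for i using insert that by auto
  obtain p where p: "\<forall>j\<in>I. ?I (\<lambda>x. (g x - (\<Sum>i\<in>I. p i * b i x)) * b j x) = 0"
    using insert.IH[of g] insert.prems by auto
  obtain p0 where p0: "\<forall>j\<in>I. ?I (\<lambda>x. (b i0 x - (\<Sum>i\<in>I. p0 i * b i x)) * b j x) = 0"
    using insert.IH[of "b i0"] insert.prems by auto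
  define rg where "rg = (\<lambda>x. g x - (\<Sum>i\<in>I. p i * b i x))"
  define r0 where "r0 = (\<lambda>x. b i0 x - (\<Sum>i\<in>I. p0 i * b i x))"
  have rg: "ae_cont S rg" and r0: "ae_cont S r0"
    unfolding rg_def r0_def using b insert.prems by (auto intro!: ae_cont_intros)
  \<comment> \<open>If the denominator vanishes then \<open>l = 0\<close>, which is the right value in that case.\<close>
  define l where "l = ?I (\<lambda>x. rg x * r0 x) / ?I (\<lambda>x. r0 x * r0 x)"
  define p' where "p' = (\<lambda>i. if i = i0 then l else p i - l * p0 i)"
  have eq: "g x - (\<Sum>i\<in>insert i0 I. p' i * b i x) = rg x - l * r0 x" for x
  proof -
    have "(\<Sum>i\<in>I. p' i * b i x) = (\<Sum>i\<in>I. p i * b i x) - l * (\<Sum>i\<in>I. p0 i * b i x)"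
      unfolding sum_distrib_left sum_subtractf[symmetric]
      by (rule sum.cong) (use insert.hyps in \<open>auto simp: p'_def algebra_simps\<close>)
    then show ?thesis using insert.hyps by (simp add: rg_def r0_def p'_def algebra_simps)
  qed
  have orthI: "?I (\<lambda>x. (rg x - l * r0 x) * b j x) = 0" if "j \<in> I" for j
  proof -
    have "?I (\<lambda>x. (rg x - l * r0 x) * b j x) = ?I (\<lambda>x. rg x * b j x - l * (r0 x * b j x))"
      by (simp add: algebra_simps)
    also have "\<dots> = ?I (\<lambda>x. rg x * b j x) - ?I (\<lambda>x. l * (r0 x * b j x))"
      using b[of j] that rg r0 by (intro Bochner_Integration.integral_diff int ae_cont_intros) auto
    also have "\<dots> = 0" using p p0 that by (simp add: rg_def r0_def)
    finally show ?thesis .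
  qed
  have orth0: "?I (\<lambda>x. (rg x - l * r0 x) * r0 x) = 0"
  proof (cases "?I (\<lambda>x. r0 x * r0 x) = 0")
    case True
    have "AE x in lebesgue_on S. r0 x = 0" by (rule integral_square_eq_0[OF r0 S True])
    then have "AE x in lebesgue_on S. (rg x - l * r0 x) * r0 x = 0" by eventually_elim simp
    then have "?I (\<lambda>x. (rg x - l * r0 x) * r0 x) = ?I (\<lambda>x. 0)"
      by (intro integral_cong_ae_cont ae_cont_intros S)
    then show ?thesis by simp
  next
    case False
    have "?I (\<lambda>x. (rg x - l * r0 x) * r0 x) = ?I (\<lambda>x. rg x * r0 x - l * (r0 x * r0 x))"
      by (simp add: algebra_simps)
    also have "\<dots> = ?I (\<lambda>x. rg x * r0 x) - ?I (\<lambda>x. l * (r0 x * r0 x))"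
      using rg r0 by (intro Bochner_Integration.integral_diff int ae_cont_intros) auto
    also have "\<dots> = 0" using False by (simp add: l_def)
    finally show ?thesis .
  qed
  have orthb0: "?I (\<lambda>x. (rg x - l * r0 x) * b i0 x) = 0"
  proof -
    have "?I (\<lambda>x. (rg x - l * r0 x) * b i0 x)
       = ?I (\<lambda>x. (rg x - l * r0 x) * r0 x + (\<Sum>i\<in>I. p0 i * b i x) * (rg x - l * r0 x))"
      by (simp add: r0_def algebra_simps)
    also have "\<dots> = ?I (\<lambda>x. (rg x - l * r0 x) * r0 x) + ?I (\<lambda>x. (\<Sum>i\<in>I. p0 i * b i x) * (rg x - l * r0 x))"
      using b rg r0 by (intro Bochner_Integration.integral_add int ae_cont_intros) auto
    also have "?I (\<lambda>x. (\<Sum>i\<in>I. p0 i * b i x) * (rg x - l * r0 x))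
        = (\<Sum>i\<in>I. p0 i * ?I (\<lambda>x. b i x * (rg x - l * r0 x)))"
      using b rg r0 insert.hyps by (intro integral_lincomb ae_cont_intros S) auto
    also have "\<dots> = 0" using orthI by (auto intro!: sum.neutral simp: mult.commute)
    finally show ?thesis using orth0 by simp
  qed
  show ?case
    by (rule exI[of _ p']) (use eq orthI orthb0 in auto)
qed

definition dual_basis ::
    "'a::euclidean_space set \<Rightarrow> 'i set \<Rightarrow> ('i \<Rightarrow> 'a \<Rightarrow> real) \<Rightarrow> ('i \<Rightarrow> 'a \<Rightarrow> real) \<Rightarrow> bool" where
  "dual_basis S I b r \<longleftrightarrow> (\<forall>i\<in>I. ae_cont S (r i)) \<and>
     (\<forall>i\<in>I. \<forall>j\<in>I. (LINT x|lebesgue_on S. b j x * r i x) = (if i = j then 1 else 0))"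

text \<open>The dual function of \<open>b i\<close> is the remainder of its projection on the other functions, divided by its
squared norm, which linear independence makes nonzero.\<close>

lemma L2_dual_basis:
  fixes b :: "'i \<Rightarrow> 'a::euclidean_space \<Rightarrow> real"
  assumes S: "compact S" and I: "finite I" and b: "\<And>i. i \<in> I \<Longrightarrow> ae_cont S (b i)"
   and indep: "\<And>c. (AE x in lebesgue_on S. (\<Sum>i\<in>I. c i * b i x) = 0) \<Longrightarrow> (\<forall>i\<in>I. c i = 0)"
  shows "\<exists>r. dual_basis S I b r"
proof -
  let ?I = "\<lambda>h. LINT x|lebesgue_on S. h x"
  have "\<exists>r. ae_cont S r \<and> (\<forall>j\<in>I. ?I (\<lambda>x. b j x * r x) = (if i = j then 1 else 0))" if i: "i \<in> I" for i
  proof -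
    obtain p where p: "\<forall>j\<in>I-{i}. ?I (\<lambda>x. (b i x - (\<Sum>l\<in>I-{i}. p l * b l x)) * b j x) = 0"
      using L2_projection[OF S, of "I-{i}" b "b i"] I b i by auto
    define r where "r = (\<lambda>x. b i x - (\<Sum>l\<in>I-{i}. p l * b l x))"
    have r: "ae_cont S r" unfolding r_def using b i by (auto intro!: ae_cont_intros)
    define c where "c = (\<lambda>l. if l = i then 1 else - p l)"
    have rc: "r x = (\<Sum>l\<in>I. c l * b l x)" for x
    proof -
      have "(\<Sum>l\<in>I-{i}. c l * b l x) = - (\<Sum>l\<in>I-{i}. p l * b l x)"
        unfolding sum_negf[symmetric] by (rule sum.cong) (auto simp: c_def)
      then show ?thesis using I i by (subst sum.remove[OF I i]) (simp add: c_def r_def)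
    qed
    define N where "N = ?I (\<lambda>x. r x * r x)"
    have N0: "N \<noteq> 0"
    proof
      assume "N = 0"
      then have "AE x in lebesgue_on S. r x = 0"
        using integral_square_eq_0[OF r S] by (simp add: N_def)
      then have "AE x in lebesgue_on S. (\<Sum>l\<in>I. c l * b l x) = 0" by (simp add: rc)
      from indep[OF this] i show False by (auto simp: c_def)
    qed
    have o: "?I (\<lambda>x. b j x * r x) = 0" if "j \<in> I" "j \<noteq> i" for j
      using p that by (auto simp: r_def mult.commute)
    have "N = ?I (\<lambda>x. (\<Sum>l\<in>I. c l * b l x) * r x)" by (simp add: N_def flip: rc)
    also have "\<dots> = (\<Sum>l\<in>I. c l * ?I (\<lambda>x. b l x * r x))"
      by (rule integral_lincomb[OF S r I b])
    also have "\<dots> = c i * ?I (\<lambda>x. b i x * r x)"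
      by (subst sum.remove[OF I i]) (auto intro!: sum.neutral simp: o)
    finally have N: "?I (\<lambda>x. b i x * r x) = N" by (simp add: c_def)
    show ?thesis
      by (rule exI[of _ "\<lambda>x. r x / N"]) (use r o N N0 in \<open>auto intro!: ae_cont_intros\<close>)
  qed
  then have "\<forall>i\<in>I. \<exists>r. ae_cont S r \<and> (\<forall>j\<in>I. ?I (\<lambda>x. b j x * r x) = (if i = j then 1 else 0))" by blast
  from bchoice[OF this] show ?thesis unfolding dual_basis_def by blast
qed

text \<open>Converts equality almost everywhere into pointwise equality: a nonempty open set is not negligible.\<close>

lemma AE_zero_imp_zero_interior:
  fixes f :: "'a::euclidean_space \<Rightarrow> real"
  assumes ae: "AE x in lebesgue_on S. f x = 0" and S: "S \<in> sets lebesgue" and f: "continuous_on UNIV f"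
    and x: "x \<in> interior S"
  shows "f x = 0"
proof -
  have ae': "AE x in lebesgue. x \<in> S \<longrightarrow> f x = 0"
    using ae S by (subst (asm) AE_restrict_space_iff) auto
  let ?U = "interior S \<inter> {x. f x \<noteq> 0}"
  have "negligible {x. \<not> (x \<in> S \<longrightarrow> f x = 0)}"
    using ae' unfolding completion.AE_iff_null_sets negligible_iff_null_sets by simp
  then have n: "negligible ?U"
    by (rule negligible_subset) (use interior_subset in blast)
  have "open ?U"
    by (intro open_Int open_interior) (use f in \<open>auto intro!: open_Collect_neq continuous_intros\<close>)
  with n have "?U = {}" using open_not_negligible by blast
  then show ?thesis using x by blast
qed

section \<open>Polynomials on elements and on faces\<close>

definition poly_index :: "nat \<Rightarrow> (nat \<times> nat) set" where
  "poly_index k = Sigma {..k} (\<lambda>i. {..k - i})"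

definition monomial2 :: "nat \<times> nat \<Rightarrow> real^2 \<Rightarrow> real" where
  "monomial2 i x = (x $ 1) ^ fst i * (x $ 2) ^ snd i"

lemma finite_poly_index [simp]: "finite (poly_index k)"
  by (simp add: poly_index_def)

lemma poly_index_mono: "k \<le> l \<Longrightarrow> poly_index k \<subseteq> poly_index l"
  by (auto simp: poly_index_def)

lemma poly_fun_iff:
  "p \<in> poly_fun k \<longleftrightarrow> (\<exists>c. p = (\<lambda>x. \<Sum>i\<in>poly_index k. c i * monomial2 i x))"
proof -
  have *: "(\<Sum>i\<le>k. \<Sum>j\<le>k - i. c (i, j) * (x $ 1) ^ i * (x $ 2) ^ j) = (\<Sum>i\<in>poly_index k. c i * monomial2 i x)"
    for c and x :: "real^2"
    unfolding poly_index_def by (subst sum.Sigma) (auto simp: monomial2_def mult.assoc split_def)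
  show ?thesis
  proof
    assume "p \<in> poly_fun k"
    then obtain c where "\<forall>x. p x = (\<Sum>i\<le>k. \<Sum>j\<le>k - i. c i j * (x $ 1) ^ i * (x $ 2) ^ j)"
      by (auto simp: poly_fun_def)
    then show "\<exists>c. p = (\<lambda>x. \<Sum>i\<in>poly_index k. c i * monomial2 i x)"
      using *[of "\<lambda>(i,j). c i j"] by (intro exI[of _ "\<lambda>(i,j). c i j"]) auto
  next
    assume "\<exists>c. p = (\<lambda>x. \<Sum>i\<in>poly_index k. c i * monomial2 i x)"
    then obtain c where c: "p = (\<lambda>x. \<Sum>i\<in>poly_index k. c i * monomial2 i x)" by blast
    show "p \<in> poly_fun k"
      unfolding poly_fun_def mem_Collect_eq c *[symmetric] by (rule exI[of _ "\<lambda>i j. c (i,j)"]) simp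
  qed
qed

lemma poly_fun_mono: assumes "k \<le> l" "p \<in> poly_fun k" shows "p \<in> poly_fun l"
proof -
  obtain c where c: "p = (\<lambda>x. \<Sum>i\<in>poly_index k. c i * monomial2 i x)"
    using assms(2) by (auto simp: poly_fun_iff)
  have "p = (\<lambda>x. \<Sum>i\<in>poly_index l. (if i \<in> poly_index k then c i else 0) * monomial2 i x)"
    unfolding c using poly_index_mono[OF assms(1)]
    by (intro ext sum.mono_neutral_cong_left) auto
  then show ?thesis
    unfolding poly_fun_iff by (rule exI[where x="\<lambda>i. if i \<in> poly_index k then c i else 0"])
qed

lemma continuous_on_monomial2 [continuous_intros]: "continuous_on S (monomial2 i)"
  unfolding monomial2_def by (intro continuous_intros)

text \<open>On a small square inside \<open>U\<close>, for fixed \<open>x\<^sub>2\<close> the expression is a polynomial in \<open>x\<^sub>1\<close> with infinitely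
many zeros, so its coefficients, which are polynomials in \<open>x\<^sub>2\<close>, vanish for infinitely many \<open>x\<^sub>2\<close>.\<close>

lemma monomials_vanish_imp_coeff_0:
  assumes U: "open U" "U \<noteq> {}" and 0: "\<And>x. x \<in> U \<Longrightarrow> (\<Sum>i\<in>poly_index k. c i * monomial2 i x) = 0"
  shows "\<forall>i\<in>poly_index k. c i = 0"
proof -
  obtain z where "z \<in> U" using U by auto
  then obtain e where e: "e > 0" "ball z e \<subseteq> U" using U(1) open_contains_ball by metis
  let ?J = "\<lambda>j. {z$j <..< z$j + e/2}"
  have inU: "vector [x, y] \<in> U" if "x \<in> ?J 1" "y \<in> ?J 2" for x y
  proof -
    have "dist (vector [x, y]) z \<le> \<bar>x - z$1\<bar> + \<bar>y - z$2\<bar>"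
      using norm_le_l1_cart[of "vector [x, y] - z"] by (simp add: dist_norm sum_2)
    also have "\<dots> < e" using that by auto
    finally show ?thesis using e by (auto simp: dist_commute)
  qed
  have inf: "infinite (?J j)" for j using e by (simp add: infinite_Ioo)
  have eq: "(\<Sum>i\<in>poly_index k. c i * monomial2 i (vector [x, y]))
     = (\<Sum>i\<le>k. (\<Sum>j\<le>k-i. c (i,j) * y ^ j) * x ^ i)" for x y
    unfolding poly_index_def sum_distrib_right
    by (subst sum.Sigma) (auto simp: monomial2_def split_def intro!: sum.cong)
  have 1: "\<forall>i\<le>k. (\<Sum>j\<le>k-i. c (i,j) * y ^ j) = 0" if y: "y \<in> ?J 2" for y
  proof (rule ccontr)
    assume "\<not> ?thesis"
    then obtain i where "i \<le> k" "(\<Sum>j\<le>k-i. c (i,j) * y ^ j) \<noteq> 0" by auto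
    then have "finite {x. (\<Sum>i\<le>k. (\<Sum>j\<le>k-i. c (i,j) * y ^ j) * x ^ i) = 0}"
      by (intro polyfun_roots_finite)
    moreover have "?J 1 \<subseteq> {x. (\<Sum>i\<le>k. (\<Sum>j\<le>k-i. c (i,j) * y ^ j) * x ^ i) = 0}"
      using 0[OF inU[OF _ y]] by (auto simp: eq)
    ultimately show False using inf finite_subset by blast
  qed
  show ?thesis
  proof (rule ccontr)
    assume "\<not> ?thesis"
    then obtain i j where ij: "i \<le> k" "j \<le> k - i" "c (i,j) \<noteq> 0" by (auto simp: poly_index_def)
    then have "finite {y. (\<Sum>j\<le>k-i. c (i,j) * y ^ j) = 0}"
      by (intro polyfun_roots_finite)
    moreover have "?J 2 \<subseteq> {y. (\<Sum>j\<le>k-i. c (i,j) * y ^ j) = 0}"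
      using 1 ij by auto
    ultimately show False using inf finite_subset by blast
  qed
qed

lemma monomials_AE_independent:
  assumes K: "compact K" "interior K \<noteq> {}"
    and ae: "AE x in lebesgue_on K. (\<Sum>i\<in>poly_index k. c i * monomial2 i x) = 0"
  shows "\<forall>i\<in>poly_index k. c i = 0"
  using K(2)
  by (rule monomials_vanish_imp_coeff_0[OF open_interior])
     (rule AE_zero_imp_zero_interior[OF ae], use K lmeasurable_compact fmeasurableD in \<open>auto intro!: continuous_intros\<close>)

lemma poly_fun_AE_unique:
  assumes K: "compact K" "interior K \<noteq> {}" and p: "p \<in> poly_fun k" and q: "q \<in> poly_fun l"
    and ae: "AE x in lebesgue_on K. p x = q x"
  shows "p = q"
proof -
  define m where "m = max k l"
  have "p \<in> poly_fun m" "q \<in> poly_fun m" using p q poly_fun_mono m_def by (metis max.cobounded1 max.cobounded2)+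
  then obtain c d where c: "p = (\<lambda>x. \<Sum>i\<in>poly_index m. c i * monomial2 i x)"
    and d: "q = (\<lambda>x. \<Sum>i\<in>poly_index m. d i * monomial2 i x)" by (auto simp: poly_fun_iff)
  have "AE x in lebesgue_on K. (\<Sum>i\<in>poly_index m. (c i - d i) * monomial2 i x) = 0"
    using ae unfolding c d by eventually_elim (simp add: left_diff_distrib sum_subtractf)
  then have "\<forall>i\<in>poly_index m. c i - d i = 0" by (rule monomials_AE_independent[OF K])
  then show ?thesis unfolding c d by (auto intro!: ext sum.cong)
qed

lemma elem_poly_eqI:
  assumes "compact K" "interior K \<noteq> {}" "p \<in> poly_fun k" "AE x in lebesgue_on K. w x = p x"
  shows "elem_poly K w = p"
  unfolding elem_poly_def
proof (rule the_equality)
  show "(\<exists>k. p \<in> poly_fun k) \<and> (AE x in lebesgue_on K. w x = p x)" using assms by blast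
  fix q assume "(\<exists>k. q \<in> poly_fun k) \<and> (AE x in lebesgue_on K. w x = q x)"
  then obtain l where q: "q \<in> poly_fun l" "AE x in lebesgue_on K. w x = q x" by blast
  have "AE x in lebesgue_on K. q x = p x" using q(2) assms(4) by eventually_elim simp
  then show "q = p" by (rule poly_fun_AE_unique[OF assms(1,2) q(1) assms(3)])
qed

definition dual_monomial :: "(real^2) set \<Rightarrow> nat \<Rightarrow> nat \<times> nat \<Rightarrow> real^2 \<Rightarrow> real" where
  "dual_monomial K k = (SOME r. dual_basis K (poly_index k) monomial2 r)"

text \<open>The coefficient is a bounded linear functional of \<open>w\<close> in \<open>L\<^sup>2(K)\<close>. This is how limits in
\<open>L\<^sup>2\<close> reach point values and traces of the representing polynomial.\<close>

definition elem_coeff :: "(real^2) set \<Rightarrow> nat \<Rightarrow> nat \<times> nat \<Rightarrow> (real^2 \<Rightarrow> real) \<Rightarrow> real" where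
  "elem_coeff K k i w = (LINT x|lebesgue_on K. w x * dual_monomial K k i x)"

lemma dual_monomial:
  assumes K: "compact K" "interior K \<noteq> {}" and i: "i \<in> poly_index k"
  shows "ae_cont K (dual_monomial K k i)"
    and "j \<in> poly_index k \<Longrightarrow> (LINT x|lebesgue_on K. monomial2 j x * dual_monomial K k i x) = (if i = j then 1 else 0)"
proof -
  have "\<exists>r. dual_basis K (poly_index k) monomial2 r"
    by (rule L2_dual_basis[OF K(1) finite_poly_index])
      (erule monomials_AE_independent[OF K] | intro ae_cont_continuous continuous_on_monomial2)+
  then have r: "dual_basis K (poly_index k) monomial2 (dual_monomial K k)"
    unfolding dual_monomial_def by (rule someI_ex)
  then show "ae_cont K (dual_monomial K k i)"
    using i by (simp add: dual_basis_def)
  show "(LINT x|lebesgue_on K. monomial2 j x * dual_monomial K k i x) = (if i = j then 1 else 0)"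
    if "j \<in> poly_index k"
    using r i that by (simp add: dual_basis_def)
qed

definition ae_poly :: "(real^2) set \<Rightarrow> nat \<Rightarrow> (real^2 \<Rightarrow> real) \<Rightarrow> bool" where
  "ae_poly K k w \<longleftrightarrow> (\<exists>p\<in>poly_fun k. AE x in lebesgue_on K. w x = p x)"

lemma ae_poly_coeffsE:
  assumes "ae_poly K k w"
  obtains c where "AE x in lebesgue_on K. w x = (\<Sum>i\<in>poly_index k. c i * monomial2 i x)"
proof -
  obtain p where "p \<in> poly_fun k" "AE x in lebesgue_on K. w x = p x"
    using assms by (auto simp: ae_poly_def)
  then show ?thesis using that by (auto simp: poly_fun_iff)
qed

lemma continuous_on_poly_fun: "p \<in> poly_fun k \<Longrightarrow> continuous_on S p"
  by (auto simp: poly_fun_iff intro!: continuous_intros)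

lemma ae_poly_imp_ae_cont: "ae_poly K k w \<Longrightarrow> ae_cont K w"
  by (auto simp: ae_poly_def ae_cont_def intro: continuous_on_poly_fun)

lemma elem_coeff_poly:
  assumes K: "compact K" "interior K \<noteq> {}" and i: "i \<in> poly_index k"
    and ae: "AE x in lebesgue_on K. w x = (\<Sum>i\<in>poly_index k. c i * monomial2 i x)"
  shows "elem_coeff K k i w = c i"
proof -
  have ac: "ae_cont K (\<lambda>x. (\<Sum>i\<in>poly_index k. c i * monomial2 i x) * dual_monomial K k i x)"
    by (intro ae_cont_mult dual_monomial(1)[OF K i] ae_cont_continuous continuous_intros)
  have "elem_coeff K k i w = (LINT x|lebesgue_on K. (\<Sum>i\<in>poly_index k. c i * monomial2 i x) * dual_monomial K k i x)"
    unfolding elem_coeff_def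
    by (rule integral_cong_ae_cont[OF ac K(1)]) (use ae in eventually_elim, simp)
  also have "\<dots> = (\<Sum>j\<in>poly_index k. c j * (LINT x|lebesgue_on K. monomial2 j x * dual_monomial K k i x))"
    by (intro integral_lincomb dual_monomial(1) K i ae_cont_continuous continuous_intros finite_poly_index)
  also have "\<dots> = (\<Sum>j\<in>poly_index k. c j * (if i = j then 1 else 0))"
    by (intro sum.cong refl) (simp add: dual_monomial(2)[OF K i])
  also have "\<dots> = (\<Sum>j\<in>poly_index k. if i = j then c j else 0)"
      by (intro sum.cong refl) simp
    finally show ?thesis using i by simp
qed

lemma elem_poly_expansion:
  assumes K: "compact K" "interior K \<noteq> {}" and w: "ae_poly K k w"
  shows "elem_poly K w = (\<lambda>x. \<Sum>i\<in>poly_index k. elem_coeff K k i w * monomial2 i x)"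
    and "AE x in lebesgue_on K. w x = elem_poly K w x"
    and "elem_poly K w \<in> poly_fun k"
proof -
  obtain c where c: "AE x in lebesgue_on K. w x = (\<Sum>i\<in>poly_index k. c i * monomial2 i x)"
    by (rule ae_poly_coeffsE[OF w])
  have e: "elem_poly K w = (\<lambda>x. \<Sum>i\<in>poly_index k. c i * monomial2 i x)"
    by (rule elem_poly_eqI[OF K _ c]) (auto simp: poly_fun_iff)
  show "elem_poly K w = (\<lambda>x. \<Sum>i\<in>poly_index k. elem_coeff K k i w * monomial2 i x)"
    unfolding e using elem_coeff_poly[OF K _ c] by (intro ext sum.cong) auto
  show "AE x in lebesgue_on K. w x = elem_poly K w x" using c e by simp
  show "elem_poly K w \<in> poly_fun k" unfolding e by (auto simp: poly_fun_iff)
qed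

text \<open>Continuous differentiability, phrased with \<open>partial_deriv\<close>, which is how the discrete gradient and
divergence are defined.\<close>

definition smooth1 :: "(real^2 \<Rightarrow> real) \<Rightarrow> bool" where
  "smooth1 g \<longleftrightarrow> (\<forall>x. g differentiable at x) \<and> (\<forall>i. continuous_on UNIV (partial_deriv i g))"

lemma partial_deriv_eqI:
  assumes "(g has_derivative g') (at x)" shows "partial_deriv i g x = g' (axis i 1)"
  using assms by (simp add: partial_deriv_def frechet_derivative_at[symmetric])

lemma smooth1_monomial2: "smooth1 (monomial2 i)"
proof -
  obtain a b where i: "i = (a, b)" by (cases i)
  have v: "((\<lambda>y::real^2. y $ j) has_derivative (\<lambda>h. h $ j)) (at x)" for j x
    by (rule bounded_linear_imp_has_derivative[OF bounded_linear_vec_nth])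
  have d: "(monomial2 i has_derivative (\<lambda>h. (x$1)^a * (real b * h$2 * (x$2)^(b-1)) + real a * h$1 * (x$1)^(a-1) * (x$2)^b)) (at x)" for x
    using has_derivative_mult[OF has_derivative_power[OF v] has_derivative_power[OF v]]
    by (simp add: monomial2_def[abs_def] i)
  have "partial_deriv j (monomial2 i) = (\<lambda>x. (x$1)^a * (real b * axis j 1 $2 * (x$2)^(b-1)) + real a * axis j 1$1 * (x$1)^(a-1) * (x$2)^b)" for j
    using partial_deriv_eqI[OF d] by (intro ext)
  then show ?thesis using d unfolding smooth1_def differentiable_def
    by (auto intro!: continuous_intros)
qed

lemma smooth1_has_derivative:
  assumes "smooth1 g"
  shows "(g has_derivative (\<lambda>h. partial_deriv 1 g x * h$1 + partial_deriv 2 g x * h$2)) (at x)"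
proof -
  have d: "(g has_derivative frechet_derivative g (at x)) (at x)"
    using assms by (simp add: smooth1_def frechet_derivative_works)
  then have l: "linear (frechet_derivative g (at x))" by (simp add: has_derivative_linear)
  have "frechet_derivative g (at x) = (\<lambda>h. partial_deriv 1 g x * h$1 + partial_deriv 2 g x * h$2)"
  proof
    fix h :: "real^2"
    have "h = h$1 *\<^sub>R axis 1 1 + h$2 *\<^sub>R axis 2 1"
      by (simp add: vec_eq_iff forall_2 axis_def)
    then have "frechet_derivative g (at x) h = frechet_derivative g (at x) (h$1 *\<^sub>R axis 1 1 + h$2 *\<^sub>R axis 2 1)"
      by simp
    also have "\<dots> = h$1 *\<^sub>R frechet_derivative g (at x) (axis 1 1) + h$2 *\<^sub>R frechet_derivative g (at x) (axis 2 1)"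
      by (simp add: linear_add[OF l] linear_cmul[OF l])
    finally show "frechet_derivative g (at x) h = partial_deriv 1 g x * h$1 + partial_deriv 2 g x * h$2"
      by (simp add: partial_deriv_def mult.commute)
  qed
  with d show ?thesis by simp
qed

lemma partial_deriv_sum:
  assumes "\<And>i. i \<in> I \<Longrightarrow> smooth1 (b i)"
  shows "partial_deriv j (\<lambda>x. \<Sum>i\<in>I. c i * b i x) x = (\<Sum>i\<in>I. c i * partial_deriv j (b i) x)"
    and "smooth1 (\<lambda>x. \<Sum>i\<in>I. c i * b i x)"
proof -
  have d: "((\<lambda>x. \<Sum>i\<in>I. c i * b i x) has_derivative (\<lambda>h. \<Sum>i\<in>I. c i * frechet_derivative (b i) (at x) h)) (at x)" for x
    using assms by (intro derivative_intros) (simp add: smooth1_def frechet_derivative_works)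
  have p: "partial_deriv j (\<lambda>x. \<Sum>i\<in>I. c i * b i x) x = (\<Sum>i\<in>I. c i * partial_deriv j (b i) x)" for x j
    using partial_deriv_eqI[OF d] by (simp add: partial_deriv_def)
  then show "partial_deriv j (\<lambda>x. \<Sum>i\<in>I. c i * b i x) x = (\<Sum>i\<in>I. c i * partial_deriv j (b i) x)" .
  have "continuous_on UNIV (partial_deriv j (\<lambda>x. \<Sum>i\<in>I. c i * b i x))" for j
    unfolding p[abs_def] using assms by (intro continuous_intros) (simp add: smooth1_def)
  then show "smooth1 (\<lambda>x. \<Sum>i\<in>I. c i * b i x)"
    using d by (auto simp: smooth1_def differentiable_def)
qed

lemma smooth1_mult:
  assumes "smooth1 f" "smooth1 g"
  shows "partial_deriv j (\<lambda>x. f x * g x) x = f x * partial_deriv j g x + partial_deriv j f x * g x"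
    and "smooth1 (\<lambda>x. f x * g x)"
proof -
  have d: "((\<lambda>x. f x * g x) has_derivative (\<lambda>h. f x * frechet_derivative g (at x) h + frechet_derivative f (at x) h * g x)) (at x)" for x
    using assms by (intro derivative_intros) (simp_all add: smooth1_def frechet_derivative_works)
  have p: "partial_deriv j (\<lambda>x. f x * g x) x = f x * partial_deriv j g x + partial_deriv j f x * g x" for x j
    using partial_deriv_eqI[OF d] by (simp add: partial_deriv_def)
  then show "partial_deriv j (\<lambda>x. f x * g x) x = f x * partial_deriv j g x + partial_deriv j f x * g x" .
  have "continuous_on UNIV f" "continuous_on UNIV g"
    using assms by (auto simp: smooth1_def intro!: differentiable_imp_continuous_on differentiable_at_imp_differentiable_on)
  then have "continuous_on UNIV (partial_deriv j (\<lambda>x. f x * g x))" for j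
    unfolding p[abs_def] using assms by (intro continuous_intros) (simp_all add: smooth1_def)
  then show "smooth1 (\<lambda>x. f x * g x)"
    using d by (auto simp: smooth1_def differentiable_def)
qed

lemma smooth1_poly_fun: "p \<in> poly_fun k \<Longrightarrow> smooth1 p"
  by (auto simp: poly_fun_iff intro!: partial_deriv_sum(2) smooth1_monomial2)

text \<open>A polynomial of total degree at most \<open>k\<close> restricts to a polynomial of degree at most \<open>k\<close> in the
parameter of a segment, so on a face \<open>k + 1\<close> coefficients describe an element of the trace space.\<close>

lemma poly_fun_on_line:
  assumes "p \<in> poly_fun k"
  shows "\<exists>c. \<forall>s. p (linepath a b s) = (\<Sum>i\<le>k. c i * s ^ i)"
proof -
  obtain c where c: "p = (\<lambda>x. \<Sum>i\<in>poly_index k. c i * monomial2 i x)"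
    using assms by (auto simp: poly_fun_iff)
  define l where "l = (\<lambda>j. [:a$j, b$j - a$j:] :: real poly)"
  define P where "P = (\<Sum>i\<in>poly_index k. Polynomial.smult (c i) (l 1 ^ fst i * l 2 ^ snd i))"
  have l: "poly (l j) s = linepath a b s $ j" for j s
    by (simp add: l_def linepath_def algebra_simps)
  have deg: "degree (l j) \<le> 1" for j by (simp add: l_def)
  have "degree P \<le> k" unfolding P_def
  proof (rule degree_sum_le)
    fix i assume i: "i \<in> poly_index k"
    have "degree (l j ^ n) \<le> n" for j n
      using degree_power_le[of "l j" n] deg[of j] mult_le_mono1[of "degree (l j)" 1 n] by linarith
    then have "degree (l 1 ^ fst i * l 2 ^ snd i) \<le> fst i + snd i"
      using degree_mult_le[of "l 1 ^ fst i" "l 2 ^ snd i"] by (rule_tac order_trans[OF _ add_mono])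
    also have "\<dots> \<le> k" using i by (auto simp: poly_index_def)
    finally show "degree (Polynomial.smult (c i) (l 1 ^ fst i * l 2 ^ snd i)) \<le> k"
      using degree_smult_le[of "c i"] by (rule_tac order_trans)
  qed simp
  then have "poly P s = (\<Sum>i\<le>k. coeff P i * s ^ i)" for s
    unfolding poly_altdef by (intro sum.mono_neutral_left) (auto simp: coeff_eq_0)
  moreover have "poly P s = p (linepath a b s)" for s
    unfolding c P_def by (simp add: poly_sum l monomial2_def)
  ultimately show ?thesis by (intro exI[of _ "coeff P"]) simp
qed

definition dual_power :: "nat \<Rightarrow> nat \<Rightarrow> real \<Rightarrow> real" where
  "dual_power k = (SOME r. dual_basis {0..1} {..k} (\<lambda>j s. s ^ j) r)"

lemma dual_power:
  assumes i: "i \<le> k"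
  shows "ae_cont {0..1} (dual_power k i)"
    and "j \<le> k \<Longrightarrow> (LINT s|lebesgue_on {0..1}. s ^ j * dual_power k i s) = (if i = j then 1 else 0)"
proof -
  have "\<exists>r. dual_basis {0..1} {..k} (\<lambda>j s::real. s ^ j) r"
  proof (rule L2_dual_basis)
    fix c :: "nat \<Rightarrow> real" assume ae: "AE s in lebesgue_on {0..1}. (\<Sum>i\<in>{..k}. c i * s ^ i) = 0"
    have z: "(\<Sum>i\<le>k. c i * s ^ i) = 0" if "s \<in> interior {0..1}" for s
      by (rule AE_zero_imp_zero_interior[OF ae _ _ that]) (auto intro!: continuous_intros)
    show "\<forall>i\<in>{..k}. c i = 0"
    proof (rule ccontr)
      assume "\<not> ?thesis"
      then obtain i where "i \<le> k" "c i \<noteq> 0" by auto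
      then have "finite {s. (\<Sum>i\<le>k. c i * s ^ i) = 0}" by (intro polyfun_roots_finite)
      moreover have "{0<..<1} \<subseteq> {s. (\<Sum>i\<le>k. c i * s ^ i) = 0}" using z by auto
      ultimately have "finite {0<..<1::real}" by (rule finite_subset[rotated])
      then show False using infinite_Ioo[of 0 "1::real"] by simp
    qed
  qed (auto intro!: ae_cont_continuous continuous_intros)
  then have r: "dual_basis {0..1} {..k} (\<lambda>j s. s ^ j) (dual_power k)"
    unfolding dual_power_def by (rule someI_ex)
  then show "ae_cont {0..1} (dual_power k i)"
    using i by (simp add: dual_basis_def)
  show "(LINT s|lebesgue_on {0..1}. s ^ j * dual_power k i s) = (if i = j then 1 else 0)"
    if "j \<le> k"
    using r i that by (simp add: dual_basis_def)
qed

definition edge_coeff :: "nat \<Rightarrow> nat \<Rightarrow> (real \<Rightarrow> real) \<Rightarrow> real" where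
  "edge_coeff k i h = (LINT s|lebesgue_on {0..1}. h s * dual_power k i s)"

lemma edge_expansion:
  assumes ae: "AE s in lebesgue_on {0..1}. h s = (\<Sum>i\<le>k. c i * s ^ i)"
  shows "AE s in lebesgue_on {0..1}. h s = (\<Sum>i\<le>k. edge_coeff k i h * s ^ i)"
proof -
  have "edge_coeff k i h = c i" if i: "i \<le> k" for i
  proof -
    have ac: "ae_cont {0..1} (\<lambda>s. (\<Sum>i\<le>k. c i * s ^ i) * dual_power k i s)"
      by (intro ae_cont_mult dual_power(1)[OF i] ae_cont_continuous continuous_intros)
    have "edge_coeff k i h = (LINT s|lebesgue_on {0..1}. (\<Sum>i\<le>k. c i * s ^ i) * dual_power k i s)"
      unfolding edge_coeff_def
      by (rule integral_cong_ae_cont[OF ac]) (simp, use ae in eventually_elim, simp)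
    also have "\<dots> = (\<Sum>j\<le>k. c j * (LINT s|lebesgue_on {0..1}. s ^ j * dual_power k i s))"
      by (intro integral_lincomb dual_power(1) i ae_cont_continuous continuous_intros) auto
    also have "\<dots> = (\<Sum>j\<le>k. c j * (if i = j then 1 else 0))"
      by (intro sum.cong refl) (simp add: dual_power(2)[OF i])
    also have "\<dots> = (\<Sum>j\<le>k. if i = j then c j else 0)"
      by (intro sum.cong refl) simp
    finally show ?thesis using i by simp
  qed
  then show ?thesis using ae by simp
qed

section \<open>The divergence theorem on a triangle\<close>

definition cross2 :: "real^2 \<Rightarrow> real^2 \<Rightarrow> real" where
  "cross2 u v = u$1 * v$2 - u$2 * v$1"

text \<open>Carries Fubini's theorem on \<open>real \<times> real\<close> over to \<open>real^2\<close>.\<close>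

definition pair_to_vec :: "real \<times> real \<Rightarrow> real^2" where
  "pair_to_vec z = fst z *\<^sub>R axis 1 1 + snd z *\<^sub>R axis 2 1"

lemma pair_to_vec_nth [simp]: "pair_to_vec z $ 1 = fst z" "pair_to_vec z $ 2 = snd z"
  by (simp_all add: pair_to_vec_def axis_def)

lemma continuous_on_pair_to_vec: "continuous_on S pair_to_vec"
  unfolding pair_to_vec_def by (intro continuous_intros)

lemma Basis_real2: "Basis = {axis 1 1, axis 2 1 :: real^2}"
  by (auto simp: Basis_vec_def UNIV_2)

text \<open>Lebesgue measure is determined by its values on boxes, and the preimage of a box is a box with the
same sides.\<close>

lemma lborel_real2_eq_distr: "(lborel :: (real^2) measure) = distr lborel borel pair_to_vec"
proof (rule lborel_eqI)
  fix l u :: "real^2" assume lu: "\<And>b. b \<in> Basis \<Longrightarrow> l \<bullet> b \<le> u \<bullet> b"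
  have le: "l$1 \<le> u$1" "l$2 \<le> u$2"
    using lu[of "axis 1 1"] lu[of "axis 2 1"] by (simp_all add: Basis_real2 inner_axis)
  have vim: "pair_to_vec -` box l u = box (l$1, l$2) (u$1, u$2)"
    by (auto simp: mem_box_cart forall_2 mem_box Basis_prod_def)
  have ne: "axis 1 1 \<noteq> (axis 2 1 :: real^2)" by (simp add: axis_eq_axis)
  have "emeasure (distr lborel borel pair_to_vec) (box l u) = emeasure lborel (box (l$1, l$2) (u$1, u$2))"
    by (subst emeasure_distr) (auto intro!: borel_measurable_continuous_onI continuous_on_pair_to_vec simp: vim)
  also have "\<dots> = ennreal ((u$1 - l$1) * (u$2 - l$2))"
    using le by (subst emeasure_lborel_box_eq) (auto simp: Basis_prod_def prod.union_disjoint inner_prod_def)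
  also have "\<dots> = (\<Prod>b\<in>Basis. (u - l) \<bullet> b)"
    using le ne by (simp add: Basis_real2 inner_axis)
  finally show "emeasure (distr lborel borel pair_to_vec) (box l u) = (\<Prod>b\<in>Basis. (u - l) \<bullet> b)" .
qed simp

definition ref_triangle :: "(real^2) set" where
  "ref_triangle = {z. 0 \<le> z$1 \<and> 0 \<le> z$2 \<and> z$1 + z$2 \<le> 1}"

lemma compact_ref_triangle: "compact ref_triangle"
proof -
  have "closed ref_triangle" unfolding ref_triangle_def
    by (intro closed_Collect_conj closed_Collect_le continuous_intros)
  moreover have "ref_triangle \<subseteq> cbox 0 (vec 1)"
    by (auto simp: ref_triangle_def mem_box_cart forall_2)
  ultimately show ?thesis
    using bounded_cbox bounded_subset compact_eq_bounded_closed by blast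
qed

lemma lebesgue_on_integral_eq_lborel:
  fixes h :: "'a::euclidean_space \<Rightarrow> real"
  assumes "compact S" "continuous_on S h"
  shows "(LINT x|lebesgue_on S. h x) = (LINT x|lborel. indicator S x *\<^sub>R h x)"
    and "integrable lborel (\<lambda>x. indicator S x *\<^sub>R h x)"
proof -
  show i: "integrable lborel (\<lambda>x. indicator S x *\<^sub>R h x)"
    by (rule borel_integrable_compact[OF assms])
  have "(LINT x|lebesgue_on S. h x) = (LINT x|lebesgue. indicator S x *\<^sub>R h x)"
    using assms(1) lmeasurable_compact fmeasurableD by (subst integral_restrict_space) auto
  also have "\<dots> = (LINT x|lborel. indicator S x *\<^sub>R h x)"
    using i by (intro integral_completion) simp
  finally show "(LINT x|lebesgue_on S. h x) = (LINT x|lborel. indicator S x *\<^sub>R h x)" .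
qed

lemma smooth1_continuous_on: "smooth1 g \<Longrightarrow> continuous_on S g"
  by (auto simp: smooth1_def intro!: differentiable_imp_continuous_on differentiable_at_imp_differentiable_on)

lemma smooth1_partial_continuous_on: "smooth1 g \<Longrightarrow> continuous_on S (partial_deriv i g)"
  by (auto simp: smooth1_def intro: continuous_on_subset)

text \<open>Fubini, with the fundamental theorem of calculus on the horizontal sections \<open>0 \<le> x \<le> 1 - y\<close>. The end
points of the sections run along the hypotenuse and the vertical side.\<close>

lemma integral_ref_triangle_partial_deriv:
  assumes g: "smooth1 g"
  shows "(LINT z|lebesgue_on ref_triangle. partial_deriv 1 g z)
    = (LINT s|lebesgue_on {0..1}. g (pair_to_vec (1 - s, s)) - g (pair_to_vec (0, s)))"
proof -
  let ?h = "partial_deriv 1 g"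
  let ?R = "{w::real\<times>real. 0 \<le> fst w \<and> 0 \<le> snd w \<and> fst w + snd w \<le> 1}"
  have cont: "continuous_on S ?h" for S by (rule smooth1_partial_continuous_on[OF g])
  have ind: "indicator ref_triangle (pair_to_vec w) = (indicator ?R w :: real)" for w
    by (simp add: ref_triangle_def indicator_def)
  have cR: "compact ?R"
  proof -
    have "closed ?R"
      by (intro closed_Collect_conj closed_Collect_le continuous_intros)
    moreover have "?R \<subseteq> cbox (0,0) (1,1)"
      by (auto simp: cbox_Pair_eq)
    ultimately show ?thesis
      using bounded_cbox bounded_subset compact_eq_bounded_closed by blast
  qed
  have cont2: "continuous_on S (\<lambda>w. ?h (pair_to_vec w))" for S
    by (rule continuous_on_compose2[OF cont continuous_on_pair_to_vec subset_UNIV])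
  have int: "integrable (lborel \<Otimes>\<^sub>M lborel) (\<lambda>w. indicator ?R w *\<^sub>R ?h (pair_to_vec w))"
    unfolding lborel_prod by (rule borel_integrable_compact[OF cR cont2])
  have "(LINT z|lebesgue_on ref_triangle. ?h z) = (LINT z|lborel. indicator ref_triangle z *\<^sub>R ?h z)"
    by (rule lebesgue_on_integral_eq_lborel[OF compact_ref_triangle cont])
  also have "\<dots> = (LINT w|lborel. indicator ?R w *\<^sub>R ?h (pair_to_vec w))"
  proof -
    have m: "(\<lambda>z. indicator ref_triangle z *\<^sub>R ?h z) \<in> borel_measurable borel"
      using borel_measurable_integrable[OF borel_integrable_compact[OF compact_ref_triangle cont]] by simp
    show ?thesis
      by (subst lborel_real2_eq_distr, subst integral_distr)
        (use m in \<open>auto intro!: borel_measurable_continuous_onI continuous_on_pair_to_vec simp: ind\<close>)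
  qed
  also have "\<dots> = (LINT y|lborel. (LINT x|lborel. indicator ?R (x,y) *\<^sub>R ?h (pair_to_vec (x,y))))"
    using lborel_pair.integral_snd[of "\<lambda>x y. indicator ?R (x,y) *\<^sub>R ?h (pair_to_vec (x,y))"] int
    by (simp add: lborel_prod split_def)
  also have "\<dots> = (LINT y|lborel. indicator {0..1} y *\<^sub>R (g (pair_to_vec (1 - y, y)) - g (pair_to_vec (0, y))))"
  proof (rule Bochner_Integration.integral_cong[OF refl])
    fix y :: real
    show "(LINT x|lborel. indicator ?R (x,y) *\<^sub>R ?h (pair_to_vec (x,y)))
       = indicator {0..1} y *\<^sub>R (g (pair_to_vec (1 - y, y)) - g (pair_to_vec (0, y)))"
    proof (cases "y \<in> {0..1}")
      case True
      have "indicator ?R (x,y) = (indicator {0..1-y} x :: real)" for x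
        using True by (auto simp: indicator_def)
      moreover have "(LINT x|lborel. indicator {0..1-y} x *\<^sub>R ?h (pair_to_vec (x,y)))
         = g (pair_to_vec (1 - y, y)) - g (pair_to_vec (0, y))"
      proof (rule integral_FTC_Icc)
        show "0 \<le> 1 - y" using True by simp
        show "continuous_on {0..1-y} (\<lambda>x. ?h (pair_to_vec (x,y)))"
          by (rule continuous_on_compose2[OF cont2[of UNIV]]) (auto intro!: continuous_intros)
        fix x
        have l: "((\<lambda>x. pair_to_vec (x, y)) has_derivative (\<lambda>h. h *\<^sub>R axis 1 1)) (at x within {0..1-y})"
          unfolding pair_to_vec_def fst_conv snd_conv
          by (rule has_derivative_eq_rhs, (rule derivative_intros)+) simp
        have "((\<lambda>x. g (pair_to_vec (x, y))) has_derivative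
          (\<lambda>h. partial_deriv 1 g (pair_to_vec (x,y)) * (h *\<^sub>R axis 1 1 :: real^2)$1
             + partial_deriv 2 g (pair_to_vec (x,y)) * (h *\<^sub>R axis 1 1 :: real^2)$2)) (at x within {0..1-y})"
          by (rule has_derivative_compose[OF l smooth1_has_derivative[OF g]])
        then show "((\<lambda>x. g (pair_to_vec (x, y))) has_vector_derivative ?h (pair_to_vec (x,y))) (at x within {0..1-y})"
          by (simp add: has_vector_derivative_def axis_def mult.commute)
      qed
      ultimately show ?thesis using True by simp
    next
      case False
      then have "indicator ?R (x,y) = (0::real)" for x by (auto simp: indicator_def)
      then show ?thesis using False by simp
    qed
  qed
  also have "\<dots> = (LINT s|lebesgue_on {0..1}. g (pair_to_vec (1 - s, s)) - g (pair_to_vec (0, s)))"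
    by (rule lebesgue_on_integral_eq_lborel(1)[symmetric])
      (auto intro!: continuous_intros continuous_on_compose2[OF smooth1_continuous_on[OF g, of UNIV]]
        continuous_on_compose2[OF continuous_on_pair_to_vec[of UNIV]])
  finally show ?thesis .
qed

definition affine_chart :: "real^2 \<Rightarrow> real^2 \<Rightarrow> real^2 \<Rightarrow> real^2 \<Rightarrow> real^2" where
  "affine_chart a b c z = a + z$1 *\<^sub>R (b - a) + z$2 *\<^sub>R (c - a)"

lemma affine_chart_image: "affine_chart a b c ` ref_triangle = convex hull {a, b, c}"
proof -
  have "convex hull {a,b,c} = {a + u *\<^sub>R (b - a) + v *\<^sub>R (c - a) | u v. 0 \<le> u \<and> 0 \<le> v \<and> u + v \<le> 1}"
    by (rule convex_hull_3_alt)
  also have "\<dots> = affine_chart a b c ` ref_triangle"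
  proof (intro set_eqI iffI)
    fix x assume "x \<in> {a + u *\<^sub>R (b - a) + v *\<^sub>R (c - a) | u v. 0 \<le> u \<and> 0 \<le> v \<and> u + v \<le> 1}"
    then obtain u v where "0 \<le> u" "0 \<le> v" "u + v \<le> 1" "x = a + u *\<^sub>R (b - a) + v *\<^sub>R (c - a)" by blast
    then show "x \<in> affine_chart a b c ` ref_triangle"
      by (intro image_eqI[of _ _ "pair_to_vec (u,v)"]) (auto simp: affine_chart_def ref_triangle_def)
  qed (auto simp: affine_chart_def ref_triangle_def)
  finally show ?thesis by simp
qed

lemma affine_chart_has_derivative:
  "(affine_chart a b c has_derivative (\<lambda>h. h$1 *\<^sub>R (b - a) + h$2 *\<^sub>R (c - a))) (at z within S)"
proof -
  have v: "((\<lambda>y::real^2. y $ j) has_derivative (\<lambda>h. h $ j)) (at z within S)" for j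
    by (rule bounded_linear_imp_has_derivative[OF bounded_linear_vec_nth])
  have "((\<lambda>z. a + z$1 *\<^sub>R (b - a) + z$2 *\<^sub>R (c - a)) has_derivative
      (\<lambda>h. 0 + h$1 *\<^sub>R (b - a) + h$2 *\<^sub>R (c - a))) (at z within S)"
    by (intro has_derivative_add has_derivative_const has_derivative_scaleR_left v)
  then show ?thesis by (simp add: affine_chart_def[abs_def])
qed

lemma inj_affine_chart:
  assumes "cross2 (b - a) (c - a) \<noteq> 0"
  shows "inj_on (affine_chart a b c) S"
proof (rule inj_onI)
  fix z w assume "affine_chart a b c z = affine_chart a b c w"
  then have "(z$1 - w$1) *\<^sub>R (b - a) + (z$2 - w$2) *\<^sub>R (c - a) = 0"
    by (simp add: affine_chart_def algebra_simps)
  from arg_cong[OF this, of "\<lambda>v. v $ j" for j]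
  have e: "(z$1 - w$1) * (b - a)$j + (z$2 - w$2) * (c - a)$j = 0" for j
    by simp
  have "(z$1 - w$1) * cross2 (b - a) (c - a) = 0" "(z$2 - w$2) * cross2 (b - a) (c - a) = 0"
    using e[of 1] e[of 2] unfolding cross2_def by algebra+
  then show "z = w" using assms by (simp add: vec_eq_iff forall_2)
qed

text \<open>The change of variables theorem concerns functions with values in \<open>real^'n\<close>, so it is applied to
\<open>f\<close> times the unit vector of \<open>real^1\<close>.\<close>

lemma integral_triangle_affine_chart:
  assumes D: "cross2 (b - a) (c - a) \<noteq> 0" and f: "continuous_on UNIV f"
  shows "(LINT x|lebesgue_on (convex hull {a,b,c}). f x)
    = \<bar>cross2 (b - a) (c - a)\<bar> * (LINT z|lebesgue_on ref_triangle. f (affine_chart a b c z))"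
proof -
  let ?D = "cross2 (b - a) (c - a)" and ?\<Phi> = "affine_chart a b c" and ?R = ref_triangle
  define L where "L = (\<lambda>h::real^2. h$1 *\<^sub>R (b - a) + h$2 *\<^sub>R (c - a))"
  define F where "F = (\<lambda>x. f x *\<^sub>R (1::real^1))"
  have K: "compact (convex hull {a,b,c})" by (simp add: compact_convex_hull finite_imp_compact)
  have meas: "?R \<in> sets lebesgue" "convex hull {a,b,c} \<in> sets lebesgue"
    using compact_ref_triangle K lmeasurable_compact fmeasurableD by blast+
  have det: "det (matrix L) = ?D"
    by (simp add: L_def det_2 matrix_def cross2_def axis_def)
  have c\<Phi>: "continuous_on ?R (\<lambda>z. f (?\<Phi> z))"
    by (rule continuous_on_compose2[OF f]) (auto simp: affine_chart_def intro!: continuous_intros)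
  have i1: "integrable (lebesgue_on ?R) (\<lambda>z. f (?\<Phi> z))"
    by (intro integrable_ae_cont ae_cont_continuous c\<Phi> compact_ref_triangle)
  have i2: "integrable (lebesgue_on (convex hull {a,b,c})) f"
    by (intro integrable_ae_cont ae_cont_continuous continuous_on_subset[OF f] K) simp
  have abs1: "(\<lambda>z. f (?\<Phi> z)) absolutely_integrable_on ?R"
    using i1 meas by (simp add: integrable_restrict_space set_integrable_def)
  have "(\<lambda>z. \<bar>det (matrix L)\<bar> *\<^sub>R F (?\<Phi> z)) absolutely_integrable_on ?R"
    unfolding F_def
    by (intro absolutely_integrable_scaleR_left absolutely_integrable_scaleR_right abs1)
  then have "integral (?\<Phi> ` ?R) F = integral ?R (\<lambda>z. \<bar>det (matrix L)\<bar> *\<^sub>R F (?\<Phi> z))"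
    using has_absolute_integral_change_of_variables[OF meas(1), of ?\<Phi> "\<lambda>_. L" F]
      affine_chart_has_derivative[of a b c _ ?R] inj_affine_chart[OF D] unfolding L_def by blast
  also have "\<dots> = (\<bar>?D\<bar> * integral ?R (\<lambda>z. f (?\<Phi> z))) *\<^sub>R 1"
  proof -
    have "(\<lambda>z. f (?\<Phi> z)) integrable_on ?R"
      using abs1 by (rule set_lebesgue_integral_eq_integral(1))
    then have "((\<lambda>z. f (?\<Phi> z)) has_integral integral ?R (\<lambda>z. f (?\<Phi> z))) ?R"
      by (rule integrable_integral)
    from has_integral_mult_right[OF this, of "\<bar>?D\<bar>"]
    have "((\<lambda>z. (\<bar>?D\<bar> * f (?\<Phi> z)) *\<^sub>R (1::real^1)) has_integral (\<bar>?D\<bar> * integral ?R (\<lambda>z. f (?\<Phi> z))) *\<^sub>R 1) ?R"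
      by (rule has_integral_scaleR_left)
    then show ?thesis unfolding F_def det by (simp add: integral_unique)
  qed
  finally have "integral (convex hull {a,b,c}) F = (\<bar>?D\<bar> * integral ?R (\<lambda>z. f (?\<Phi> z))) *\<^sub>R 1"
    by (simp add: affine_chart_image)
  moreover have "integral (convex hull {a,b,c}) F = integral (convex hull {a,b,c}) f *\<^sub>R 1"
  proof -
    have "f absolutely_integrable_on (convex hull {a,b,c})"
      using i2 meas by (simp add: integrable_restrict_space set_integrable_def)
    then have "(f has_integral integral (convex hull {a,b,c}) f) (convex hull {a,b,c})"
      by (intro integrable_integral set_lebesgue_integral_eq_integral(1))
    from has_integral_scaleR_left[OF this, of "1::real^1"] show ?thesis
      unfolding F_def by (rule integral_unique)
  qed
  ultimately have "integral (convex hull {a,b,c}) f = \<bar>?D\<bar> * integral ?R (\<lambda>z. f (?\<Phi> z))"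
    by (simp add: vec_eq_iff)
  then show ?thesis
    using lebesgue_integral_eq_integral[OF i1 meas(1)] lebesgue_integral_eq_integral[OF i2 meas(2)] by simp
qed

lemma smooth1_affine_chart:
  assumes g: "smooth1 g"
  shows "smooth1 (\<lambda>z. g (affine_chart a b c z))"
   and "partial_deriv 1 (\<lambda>z. g (affine_chart a b c z)) z
      = partial_deriv 1 g (affine_chart a b c z) * (b - a)$1 + partial_deriv 2 g (affine_chart a b c z) * (b - a)$2"
proof -
  let ?\<Phi> = "affine_chart a b c"
  have d: "((\<lambda>z. g (?\<Phi> z)) has_derivative (\<lambda>h. partial_deriv 1 g (?\<Phi> z) * (h$1 *\<^sub>R (b - a) + h$2 *\<^sub>R (c - a))$1
     + partial_deriv 2 g (?\<Phi> z) * (h$1 *\<^sub>R (b - a) + h$2 *\<^sub>R (c - a))$2)) (at z)" for z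
    by (rule has_derivative_compose[OF affine_chart_has_derivative smooth1_has_derivative[OF g]])
  have c: "continuous_on UNIV (\<lambda>z. partial_deriv i g (?\<Phi> z))" for i
    by (rule continuous_on_compose2[OF smooth1_partial_continuous_on[OF g, of UNIV]])
      (auto simp: affine_chart_def intro!: continuous_intros)
  have "continuous_on UNIV (partial_deriv i (\<lambda>z. g (?\<Phi> z)))" for i
    unfolding partial_deriv_eqI[OF d, abs_def] by (intro continuous_intros c)
  then show "smooth1 (\<lambda>z. g (?\<Phi> z))"
    using d unfolding smooth1_def differentiable_def by blast
  show "partial_deriv 1 (\<lambda>z. g (?\<Phi> z)) z
      = partial_deriv 1 g (?\<Phi> z) * (b - a)$1 + partial_deriv 2 g (?\<Phi> z) * (b - a)$2"
    using partial_deriv_eqI[OF d, of 1] by (simp add: axis_def)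
qed

text \<open>In the chart at the vertex \<open>a\<close>, the derivative in the direction \<open>b - a\<close> is the first partial
derivative, and the two sides of the reference triangle become \<open>[b, c]\<close> and \<open>[a, c]\<close>.\<close>

lemma integral_triangle_directional_derivative:
  assumes D: "cross2 (b - a) (c - a) \<noteq> 0" and g: "smooth1 g"
  shows "(LINT x|lebesgue_on (convex hull {a,b,c}). partial_deriv 1 g x * (b - a)$1 + partial_deriv 2 g x * (b - a)$2)
    = \<bar>cross2 (b - a) (c - a)\<bar> * ((LINT s|lebesgue_on {0..1}. g (linepath b c s)) - (LINT s|lebesgue_on {0..1}. g (linepath a c s)))"
proof -
  let ?\<Phi> = "affine_chart a b c" and ?D = "\<bar>cross2 (b - a) (c - a)\<bar>"
  have p: "?\<Phi> (pair_to_vec (1 - s, s)) = linepath b c s" "?\<Phi> (pair_to_vec (0, s)) = linepath a c s" for s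
    by (simp_all add: affine_chart_def linepath_def algebra_simps)
  have int: "integrable (lebesgue_on {0..1}) (\<lambda>s. g (linepath x y s))" for x y
    by (intro integrable_ae_cont ae_cont_continuous continuous_on_compose2[OF smooth1_continuous_on[OF g, of UNIV]]
       continuous_on_linepath) auto
  have "(LINT x|lebesgue_on (convex hull {a,b,c}). partial_deriv 1 g x * (b - a)$1 + partial_deriv 2 g x * (b - a)$2)
    = ?D * (LINT z|lebesgue_on ref_triangle. partial_deriv 1 g (?\<Phi> z) * (b - a)$1 + partial_deriv 2 g (?\<Phi> z) * (b - a)$2)"
    by (intro integral_triangle_affine_chart D continuous_intros smooth1_partial_continuous_on[OF g])
  also have "\<dots> = ?D * (LINT z|lebesgue_on ref_triangle. partial_deriv 1 (\<lambda>z. g (?\<Phi> z)) z)"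
    by (simp only: smooth1_affine_chart(2)[OF g])
  also have "\<dots> = ?D * (LINT s|lebesgue_on {0..1}. g (linepath b c s) - g (linepath a c s))"
    by (simp only: integral_ref_triangle_partial_deriv[OF smooth1_affine_chart(1)[OF g]] p)
  also have "\<dots> = ?D * ((LINT s|lebesgue_on {0..1}. g (linepath b c s)) - (LINT s|lebesgue_on {0..1}. g (linepath a c s)))"
    by (simp only: Bochner_Integration.integral_diff[OF int int])
  finally show ?thesis .
qed

lemma line_integral_reverse:
  fixes g :: "'a::real_normed_vector \<Rightarrow> real"
  assumes g: "continuous_on UNIV g"
  shows "(LINT s|lebesgue_on {0..1}. g (linepath b a s)) = (LINT s|lebesgue_on {0..1}. g (linepath a b s))"
proof -
  have c: "continuous_on {0..1} (\<lambda>s. g (linepath x y s))" for x y :: 'a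
    by (rule continuous_on_compose2[OF g continuous_on_linepath]) simp
  have "(LINT s|lebesgue_on {0..1}. g (linepath b a s)) = (LINT s|lborel. indicator {0..1} s *\<^sub>R g (linepath b a s))"
    by (rule lebesgue_on_integral_eq_lborel(1)[OF _ c]) simp
  also have "\<dots> = \<bar>-1\<bar> *\<^sub>R (LINT s|lborel. indicator {0..1} (1 + (-1) * s) *\<^sub>R g (linepath b a (1 + (-1) * s)))"
    by (rule lborel_integral_real_affine) simp
  also have "\<dots> = (LINT s|lborel. indicator {0..1} s *\<^sub>R g (linepath a b s))"
  proof -
    have "linepath b a (1 - s) = linepath a b s" "indicator {0..1} (1 - s) = (indicator {0..1} s :: real)" for s
      by (auto simp: linepath_def indicator_def)
    then show ?thesis by simp
  qed
  also have "\<dots> = (LINT s|lebesgue_on {0..1}. g (linepath a b s))"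
    by (rule lebesgue_on_integral_eq_lborel(1)[OF _ c, symmetric]) simp
  finally show ?thesis .
qed

text \<open>The choice in \<open>edge_ends\<close> fixes the end points up to order only.\<close>

lemma edge_ends:
  assumes "E = closed_segment a b"
  shows "E = closed_segment (fst (edge_ends E)) (snd (edge_ends E))"
    and "{fst (edge_ends E), snd (edge_ends E)} = {a, b}"
proof -
  show e: "E = closed_segment (fst (edge_ends E)) (snd (edge_ends E))"
    unfolding edge_ends_def by (rule someI[of _ "(a, b)"]) (simp add: assms)
  then show "{fst (edge_ends E), snd (edge_ends E)} = {a, b}"
    using assms by (metis closed_segment_eq)
qed

lemma edge_integral_segment:
  assumes g: "continuous_on UNIV g"
  shows "edge_integral (closed_segment a b) g = dist a b * (LINT s|lebesgue_on {0..1}. g (linepath a b s))"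
proof -
  let ?e = "edge_ends (closed_segment a b)"
  have "(fst ?e = a \<and> snd ?e = b) \<or> (fst ?e = b \<and> snd ?e = a)"
    using edge_ends(2)[OF refl, of a b] by (auto simp: doubleton_eq_iff)
  then show ?thesis
    using line_integral_reverse[OF g] by (auto simp: edge_integral_def edge_path_def dist_commute)
qed

text \<open>The second equation is twice the area of the triangle, computed as base times height. Together with
orthogonality to the edge it is all that the divergence theorem needs about the normal. The proof
exhibits the normal as the rotated edge direction and shows that the description in
\<open>outward_normal\<close> has no other solution.\<close>

lemma outward_normal_triangle:
  assumes D: "cross2 (b - a) (c - a) \<noteq> 0"
  defines "n \<equiv> outward_normal (convex hull {a,b,c}) (closed_segment b c)"
  shows "n \<bullet> (c - b) = 0" and "dist b c * (n \<bullet> (b - a)) = \<bar>cross2 (b - a) (c - a)\<bar>"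
proof -
  let ?D = "cross2 (b - a) (c - a)"
  define w where "w = c - b"
  have w: "w \<noteq> 0" using D by (auto simp: w_def cross2_def)
  define m where "m = (sgn ?D / norm w) *\<^sub>R pair_to_vec (w$2, - w$1)"
  have inner2: "x \<bullet> y = x$1 * y$1 + x$2 * y$2" for x y :: "real^2"
    by (simp add: inner_vec_def sum_2)
  have nw: "norm w * norm w = w$1 * w$1 + w$2 * w$2"
    using dot_square_norm[of w] by (simp add: inner2 power2_eq_square)
  have mw: "m \<bullet> w = 0" by (simp add: m_def inner2)
  have "m \<bullet> m = (sgn ?D / norm w)\<^sup>2 * (norm w * norm w)"
    unfolding nw by (simp add: m_def inner2 power2_eq_square algebra_simps)
  also have "\<dots> = 1" using D w by (simp add: power2_eq_square sgn_if)
  finally have m1: "norm m = 1" by (simp add: norm_eq_sqrt_inner)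
  have "m \<bullet> (b - a) = sgn ?D / norm w * (w$2 * (b - a)$1 - w$1 * (b - a)$2)"
  proof -
    define r where "r = sgn ?D / norm w"
    have "m $ 1 = r * w$2" "m $ 2 = r * (- w$1)" by (simp_all add: m_def r_def)
    then have "m \<bullet> (b - a) = r * (w$2 * (b - a)$1 - w$1 * (b - a)$2)"
      unfolding inner2 by algebra
    then show ?thesis by (simp add: r_def)
  qed
  also have "w$2 * (b - a)$1 - w$1 * (b - a)$2 = ?D"
    by (simp add: w_def cross2_def algebra_simps)
  finally have mba: "m \<bullet> (b - a) = \<bar>?D\<bar> / norm w" by (simp add: abs_sgn mult.commute)
  then have mpos: "m \<bullet> (b - a) > 0" using D w by simp
  have hull: "\<exists>u v. y - x = (- u) *\<^sub>R (b - a) + v *\<^sub>R w \<and> 0 \<le> u"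
    if x: "x \<in> closed_segment b c" and y: "y \<in> convex hull {a,b,c}" for x y
  proof -
    obtain s where s: "x = (1 - s) *\<^sub>R b + s *\<^sub>R c" using x by (auto simp: closed_segment_def)
    obtain u v t where uvt: "0 \<le> u" "u + v + t = 1" "y = u *\<^sub>R a + v *\<^sub>R b + t *\<^sub>R c"
      using y by (auto simp: convex_hull_3)
    have v: "v = 1 - u - t" using uvt by simp
    have "y - x = (- u) *\<^sub>R (b - a) + (t - s) *\<^sub>R w"
      unfolding s uvt(3) w_def v by (simp add: algebra_simps)
    then show ?thesis using uvt(1) by blast
  qed
  have supp: "norm m = 1 \<and> (\<forall>x\<in>closed_segment b c. \<forall>y\<in>convex hull {a,b,c}. m \<bullet> (y - x) \<le> 0)"
  proof (intro conjI ballI m1)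
    fix x y assume "x \<in> closed_segment b c" "y \<in> convex hull {a,b,c}"
    from hull[OF this] obtain u v where "y - x = (- u) *\<^sub>R (b - a) + v *\<^sub>R w" "0 \<le> u" by blast
    then show "m \<bullet> (y - x) \<le> 0"
      using mpos mw by (simp add: inner_add_right del: scaleR_minus_left)
  qed
  have uniq: "k = m" if k: "norm k = 1 \<and> (\<forall>x\<in>closed_segment b c. \<forall>y\<in>convex hull {a,b,c}. k \<bullet> (y - x) \<le> 0)" for k
  proof -
    have in_hull: "a \<in> convex hull {a,b,c}" "b \<in> convex hull {a,b,c}" "c \<in> convex hull {a,b,c}"
      by (simp_all add: hull_inc)
    have in_seg: "b \<in> closed_segment b c" "c \<in> closed_segment b c" by simp_all
    have "k \<bullet> (c - b) \<le> 0" "k \<bullet> (b - c) \<le> 0" "k \<bullet> (a - b) \<le> 0"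
      using k in_hull in_seg by blast+
    then have kw: "k \<bullet> w = 0" and kba: "k \<bullet> (b - a) \<ge> 0" by (simp_all add: w_def inner_diff_right)
    have k1: "k$1 * w$1 + k$2 * w$2 = 0" using kw by (simp add: inner2)
    define q where "q = (k$1 * w$2 - k$2 * w$1) / (norm w * norm w)"
    have ww: "norm w * norm w \<noteq> 0" using w by simp
    have "k$1 * (norm w * norm w) = (k$1 * w$2 - k$2 * w$1) * w$2"
         "k$2 * (norm w * norm w) = (k$1 * w$2 - k$2 * w$1) * (- w$1)"
      unfolding nw using k1 by algebra+
    then have kq: "k$1 = q * w$2" "k$2 = q * (- w$1)"
      using ww by (simp_all add: q_def field_simps)
    then have "k \<bullet> k = q\<^sup>2 * (norm w * norm w)" unfolding nw inner2 by (simp add: power2_eq_square algebra_simps)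
    moreover have "k \<bullet> k = 1" using k by (simp add: norm_eq_1)
    ultimately have "(q * norm w)\<^sup>2 = 1" by (simp add: power2_eq_square algebra_simps)
    then have q1: "q * norm w = 1 \<or> q * norm w = -1" by (simp add: power2_eq_1_iff)
    have "k \<bullet> (b - a) = q * (w$2 * (b - a)$1 - w$1 * (b - a)$2)"
      by (simp add: inner2 kq algebra_simps)
    also have "w$2 * (b - a)$1 - w$1 * (b - a)$2 = ?D"
      by (simp add: w_def cross2_def algebra_simps)
    finally have "q * ?D \<ge> 0" using kba by simp
    moreover have "norm w > 0" using w by simp
    ultimately have "q * norm w = sgn ?D"
    proof -
      assume q: "q * ?D \<ge> 0" and w: "norm w > 0"
      show ?thesis
      proof (cases "q * norm w = 1")
        case True
        then have "q > 0" using w by (metis mult.commute zero_less_mult_pos zero_less_one)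
        then show ?thesis using q D True by (simp add: zero_le_mult_iff)
      next
        case False
        then have q': "q * norm w = -1" using q1 by simp
        then have "(- q) * norm w > 0" by simp
        then have "q < 0" using w by (simp add: zero_less_mult_iff mult_less_0_iff)
        then show ?thesis using q D q' by (simp add: zero_le_mult_iff)
      qed
    qed
    then have "q = sgn ?D / norm w" using w by (simp add: field_simps)
    then show ?thesis
      by (simp add: vec_eq_iff forall_2 kq m_def)
  qed
  have nm: "n = m" unfolding n_def outward_normal_def by (rule the_equality) (fact supp, rule uniq)
  show "n \<bullet> (c - b) = 0" using mw nm by (simp add: w_def)
  show "dist b c * (n \<bullet> (b - a)) = \<bar>?D\<bar>"
    using mba w nm by (simp add: w_def dist_norm norm_minus_commute)
qed

lemma edges_triangle:
  assumes "\<not> affine_dependent {a,b,c}" "card {a,b,c} = 3"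
  shows "edges (convex hull {a,b,c}) = {closed_segment b c, closed_segment c a, closed_segment a b}"
proof -
  have ne: "a \<noteq> b" "b \<noteq> c" "a \<noteq> c" using assms(2) by (auto simp: card_insert_if split: if_splits)
  have "E \<in> edges (convex hull {a,b,c}) \<longleftrightarrow> (\<exists>d\<subseteq>{a,b,c}. card d = 2 \<and> E = convex hull d)" for E
  proof -
    have "aff_dim (convex hull d) = 1 \<longleftrightarrow> card d = 2" if "d \<subseteq> {a,b,c}" for d
      using aff_dim_affine_independent[OF affine_independent_subset[OF assms(1) that]]
      by (auto simp: aff_dim_convex_hull)
    then show ?thesis
      unfolding edges_def edge_of_def mem_Collect_eq face_of_convex_hull_affine_independent[OF assms(1)] by blast
  qed
  moreover have "(\<exists>d\<subseteq>{a,b,c}. card d = 2 \<and> E = convex hull d)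
      \<longleftrightarrow> E = convex hull {b,c} \<or> E = convex hull {c,a} \<or> E = convex hull {a,b}" for E
  proof
    assume "\<exists>d\<subseteq>{a,b,c}. card d = 2 \<and> E = convex hull d"
    then obtain d where d: "d \<subseteq> {a,b,c}" "card d = 2" "E = convex hull d" by blast
    then obtain x y where xy: "d = {x,y}" "x \<noteq> y" by (auto simp: card_2_iff)
    then have "x = a \<or> x = b \<or> x = c" "y = a \<or> y = b \<or> y = c" using d(1) by blast+
    then have "{x,y} = {b,c} \<or> {x,y} = {c,a} \<or> {x,y} = {a,b}"
      using xy(2) unfolding doubleton_eq_iff by blast
    then show "E = convex hull {b,c} \<or> E = convex hull {c,a} \<or> E = convex hull {a,b}"
      unfolding d(3) xy(1) by (elim disjE) simp_all
  next
    have "{b,c} \<subseteq> {a,b,c} \<and> card {b,c} = 2" "{c,a} \<subseteq> {a,b,c} \<and> card {c,a} = 2"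
      "{a,b} \<subseteq> {a,b,c} \<and> card {a,b} = 2"
      using ne by auto
    moreover assume "E = convex hull {b,c} \<or> E = convex hull {c,a} \<or> E = convex hull {a,b}"
    ultimately show "\<exists>d\<subseteq>{a,b,c}. card d = 2 \<and> E = convex hull d" by blast
  qed
  ultimately have "E \<in> edges (convex hull {a,b,c}) \<longleftrightarrow>
      E = convex hull {b,c} \<or> E = convex hull {c,a} \<or> E = convex hull {a,b}" for E
    by (simp only:)
  then show ?thesis unfolding segment_convex_hull by (intro set_eqI) (simp only: insert_iff empty_iff simp_thms)
qed

lemma simplex2_triangle:
  assumes "2 simplex (K :: (real^2) set)"
  obtains a b c where "K = convex hull {a,b,c}" "\<not> affine_dependent {a,b,c}" "card {a,b,c} = 3"
    "cross2 (b - a) (c - a) \<noteq> 0"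
proof -
  obtain C where C: "\<not> affine_dependent C" "card C = 3" "K = convex hull C"
    using assms by (auto simp: simplex_def)
  then obtain a b c where abc: "C = {a,b,c}" "a \<noteq> b" "b \<noteq> c" "a \<noteq> c" by (auto simp: card_3_iff)
  have "cross2 (b - a) (c - a) \<noteq> 0"
  proof
    assume 0: "cross2 (b - a) (c - a) = 0"
    have "collinear {b, a, c}"
    proof -
      define u v where "u = b - a" and "v = c - a"
      have u0: "u \<noteq> 0" using abc by (simp add: u_def)
      have uv: "u$1 * v$2 = u$2 * v$1" using 0 by (simp add: cross2_def u_def v_def)
      have "\<exists>r. v = r *\<^sub>R u"
      proof (cases "u$1 = 0")
        case True
        then have "u$2 \<noteq> 0" using u0 by (auto simp: vec_eq_iff forall_2)
        with True uv have "v = (v$2 / u$2) *\<^sub>R u" by (simp add: vec_eq_iff forall_2)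
        then show ?thesis by blast
      next
        case False
        with uv have "v = (v$1 / u$1) *\<^sub>R u" by (simp add: vec_eq_iff forall_2 field_simps)
        then show ?thesis by blast
      qed
      then have "collinear {0, u, v}" by (simp add: collinear_lemma)
      then show ?thesis unfolding u_def v_def by (subst collinear_3) auto
    qed
    then show False using C(1) abc by (auto simp: collinear_3_eq_affine_dependent insert_commute)
  qed
  with that C abc show ?thesis by blast
qed

text \<open>Both sides are linear in \<open>v\<close>, so the directions \<open>b - a\<close> and \<open>c - a\<close> suffice. For each of them one
edge is parallel to the direction and drops out, and \<open>integral_triangle_directional_derivative\<close> gives
the difference of the integrals over the other two. The second direction is the first one after
exchanging \<open>b\<close> and \<open>c\<close>.\<close>

lemma divergence_theorem_triangle_direction:
  assumes D: "cross2 (b - a) (c - a) \<noteq> 0" and g: "smooth1 g"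
  defines "K \<equiv> convex hull {a,b,c}"
  shows "(LINT x|lebesgue_on K. partial_deriv 1 g x * v$1 + partial_deriv 2 g x * v$2)
    = edge_integral (closed_segment b c) g * (outward_normal K (closed_segment b c) \<bullet> v)
    + edge_integral (closed_segment c a) g * (outward_normal K (closed_segment c a) \<bullet> v)
    + edge_integral (closed_segment a b) g * (outward_normal K (closed_segment a b) \<bullet> v)"
    (is "?L v = ?R v")
proof -
  let ?D = "cross2 (b - a) (c - a)" and ?J = "\<lambda>p q. LINT s|lebesgue_on {0..1}. g (linepath p q s)"
  let ?n1 = "outward_normal K (closed_segment b c)" and ?n2 = "outward_normal K (closed_segment c a)"
    and ?n3 = "outward_normal K (closed_segment a b)"
  note gc = smooth1_continuous_on[OF g, of UNIV]
  have perm: "convex hull {b,c,a} = K" "convex hull {c,a,b} = K" "convex hull {a,c,b} = K"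
    by (simp_all add: K_def insert_commute)
  have D': "cross2 (c - b) (a - b) = ?D" "cross2 (a - c) (b - c) = ?D" "cross2 (c - a) (b - a) = - ?D"
    by (simp_all add: cross2_def algebra_simps)
  have n1: "?n1 \<bullet> (c - b) = 0" "dist b c * (?n1 \<bullet> (b - a)) = \<bar>?D\<bar>"
    using outward_normal_triangle[OF D] by (simp_all add: K_def)
  have n2: "?n2 \<bullet> (a - c) = 0" "dist c a * (?n2 \<bullet> (c - b)) = \<bar>?D\<bar>"
    using outward_normal_triangle[of c b a] D by (simp_all add: perm D')
  have n3: "?n3 \<bullet> (b - a) = 0" "dist a b * (?n3 \<bullet> (a - c)) = \<bar>?D\<bar>"
    using outward_normal_triangle[of a c b] D by (simp_all add: perm D')
  have n1': "dist b c * (?n1 \<bullet> (c - a)) = \<bar>?D\<bar>"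
  proof -
    have "?n1 \<bullet> (c - a) = ?n1 \<bullet> (b - a)" using n1(1) by (simp add: inner_diff_right)
    then show ?thesis using n1(2) by simp
  qed
  have n2': "?n2 \<bullet> (c - a) = 0" using n2(1) by (simp add: inner_diff_right)
  have n2'': "dist c a * (?n2 \<bullet> (b - a)) = - \<bar>?D\<bar>"
  proof -
    have "?n2 \<bullet> (b - a) = - (?n2 \<bullet> (c - b))" using n2' by (simp add: inner_diff_right)
    then show ?thesis using n2(2) by simp
  qed
  have n3'': "dist a b * (?n3 \<bullet> (c - a)) = - \<bar>?D\<bar>"
  proof -
    have "?n3 \<bullet> (c - a) = - (?n3 \<bullet> (a - c))" by (simp add: inner_diff_right)
    then show ?thesis using n3(2) by simp
  qed
  have R: "?R v = ?J b c * (dist b c * (?n1 \<bullet> v)) + ?J c a * (dist c a * (?n2 \<bullet> v)) + ?J a b * (dist a b * (?n3 \<bullet> v))" for v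
    by (simp add: edge_integral_segment[OF gc] algebra_simps)
  have 1: "?L (b - a) = ?R (b - a)"
  proof -
    have "?L (b - a) = \<bar>?D\<bar> * (?J b c - ?J a c)"
      unfolding K_def by (rule integral_triangle_directional_derivative[OF D g])
    moreover have "?R (b - a) = ?J b c * \<bar>?D\<bar> + ?J c a * (- \<bar>?D\<bar>) + ?J a b * (dist a b * 0)"
      by (rule trans[OF R]) (simp only: n1(2) n2'' n3(1))
    moreover have "?J a c = ?J c a" by (rule line_integral_reverse[OF gc])
    ultimately show ?thesis by (simp only: right_diff_distrib) simp
  qed
  have 2: "?L (c - a) = ?R (c - a)"
  proof -
    have "?L (c - a) = \<bar>cross2 (c - a) (b - a)\<bar> * (?J c b - ?J a b)"
      unfolding perm(3)[symmetric] by (rule integral_triangle_directional_derivative[OF _ g]) (use D D' in simp)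
    moreover have "?R (c - a) = ?J b c * \<bar>?D\<bar> + ?J c a * (dist c a * 0) + ?J a b * (- \<bar>?D\<bar>)"
      by (rule trans[OF R]) (simp only: n1' n2' n3'')
    moreover have "?J c b = ?J b c" by (rule line_integral_reverse[OF gc])
    ultimately show ?thesis by (simp only: right_diff_distrib D') simp
  qed
  have K: "compact K" by (simp add: K_def compact_convex_hull finite_imp_compact)
  have Llin: "?L (p *\<^sub>R v + q *\<^sub>R w) = p * ?L v + q * ?L w" for p q v w
  proof -
    have int: "integrable (lebesgue_on K) (\<lambda>x. r * (partial_deriv 1 g x * v$1 + partial_deriv 2 g x * v$2))" for r v
      by (intro integrable_ae_cont ae_cont_continuous K continuous_intros smooth1_partial_continuous_on[OF g])
    have "?L (p *\<^sub>R v + q *\<^sub>R w) = (LINT x|lebesgue_on K. p * (partial_deriv 1 g x * v$1 + partial_deriv 2 g x * v$2)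
         + q * (partial_deriv 1 g x * w$1 + partial_deriv 2 g x * w$2))"
      by (simp add: algebra_simps)
    also have "\<dots> = p * ?L v + q * ?L w"
      by (subst Bochner_Integration.integral_add[OF int int]) simp
    finally show ?thesis .
  qed
  have Rlin: "?R (p *\<^sub>R v + q *\<^sub>R w) = p * ?R v + q * ?R w" for p q v w
    by (simp add: inner_add_right algebra_simps)
  \<comment> \<open>Cramer's rule in the basis of the two edge vectors at \<open>a\<close>.\<close>
  have "v = (cross2 v (c - a) / ?D) *\<^sub>R (b - a) + (cross2 (b - a) v / ?D) *\<^sub>R (c - a)"
  proof -
    have "?D *\<^sub>R v = cross2 v (c - a) *\<^sub>R (b - a) + cross2 (b - a) v *\<^sub>R (c - a)"
      by (simp add: vec_eq_iff forall_2 cross2_def algebra_simps)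
    moreover have "v = (1 / ?D) *\<^sub>R (?D *\<^sub>R v)" using D by simp
    ultimately have "v = (1 / ?D) *\<^sub>R (cross2 v (c - a) *\<^sub>R (b - a) + cross2 (b - a) v *\<^sub>R (c - a))"
      by simp
    then show ?thesis by (simp add: scaleR_add_right)
  qed
  then obtain p q where v: "v = p *\<^sub>R (b - a) + q *\<^sub>R (c - a)" by blast
  show "?L v = ?R v" unfolding v Llin Rlin 1 2 ..
qed

lemma closed_segment_triangle_neq:
  fixes a b c :: "real^2"
  assumes "card {a,b,c} = 3"
  shows "closed_segment b c \<noteq> closed_segment c a" "closed_segment c a \<noteq> closed_segment a b"
    "closed_segment b c \<noteq> closed_segment a b"
  using assms by (auto simp: doubleton_eq_iff card_insert_if split: if_splits)

lemma edge_integral_mult_right: "edge_integral E (\<lambda>x. g x * r) = edge_integral E g * r"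
  by (simp add: edge_integral_def)

lemma divergence_theorem_simplex2:
  assumes K: "2 simplex K" and g: "smooth1 g"
  shows "(LINT x|lebesgue_on K. partial_deriv i g x)
    = (\<Sum>E\<in>edges K. edge_integral E (\<lambda>x. g x * outward_normal K E $ i))"
proof -
  obtain a b c where abc: "K = convex hull {a,b,c}" "\<not> affine_dependent {a,b,c}" "card {a,b,c} = 3"
    "cross2 (b - a) (c - a) \<noteq> 0"
    by (rule simplex2_triangle[OF K])
  have i: "i = 1 \<or> i = 2" using exhaust_2 by blast
  have "partial_deriv 1 g x * (axis i 1 :: real^2)$1 + partial_deriv 2 g x * (axis i 1 :: real^2)$2 = partial_deriv i g x" for x
    using i by (auto simp: axis_def)
  then have "(LINT x|lebesgue_on K. partial_deriv i g x) =
     (LINT x|lebesgue_on K. partial_deriv 1 g x * (axis i 1 :: real^2)$1 + partial_deriv 2 g x * (axis i 1 :: real^2)$2)"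
    by simp
  also have "\<dots> = edge_integral (closed_segment b c) g * (outward_normal K (closed_segment b c) \<bullet> axis i 1)
    + edge_integral (closed_segment c a) g * (outward_normal K (closed_segment c a) \<bullet> axis i 1)
    + edge_integral (closed_segment a b) g * (outward_normal K (closed_segment a b) \<bullet> axis i 1)"
    unfolding abc(1) by (rule divergence_theorem_triangle_direction[OF abc(4) g])
  also have "\<dots> = (\<Sum>E\<in>edges K. edge_integral E (\<lambda>x. g x * outward_normal K E $ i))"
    unfolding edge_integral_mult_right abc(1) edges_triangle[OF abc(2,3)]
    using closed_segment_triangle_neq[OF abc(3)] by (simp add: inner_axis)
  finally show ?thesis .
qed

section \<open>Integration by parts over the mesh\<close>

lemma simplex2_compact: "2 simplex (K :: (real^2) set) \<Longrightarrow> compact K"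
  by (auto simp: simplex compact_convex_hull finite_imp_compact)

lemma simplex2_interior_nonempty:
  assumes "2 simplex (K :: (real^2) set)" shows "interior K \<noteq> {}"
proof -
  have "aff_dim K = 2" using aff_dim_simplex[OF assms] by simp
  moreover have "convex K" using assms by (auto simp: simplex)
  ultimately show ?thesis
    using rel_interior_interior[of K] rel_interior_eq_empty[of K] aff_dim_eq_full[of K] by auto
qed

lemma ae_cont_vec_inner:
  assumes "\<And>i. ae_cont S (\<lambda>x. v x $ i)" "\<And>i. ae_cont S (\<lambda>x. w x $ i)"
  shows "ae_cont S (\<lambda>x. v x \<bullet> (w x :: real^2))"
  using assms by (auto simp: inner_vec_def intro!: ae_cont_intros)

definition edge_cont :: "(real^2) set \<Rightarrow> (real^2 \<Rightarrow> real) \<Rightarrow> bool" where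
  "edge_cont E g \<longleftrightarrow> ae_cont {0..1} (\<lambda>s. g (edge_path E s))"

lemma edge_cont_continuous: "continuous_on UNIV g \<Longrightarrow> edge_cont E g"
  unfolding edge_cont_def edge_path_def
  by (intro ae_cont_continuous) (erule continuous_on_compose2[OF _ continuous_on_linepath subset_UNIV])

lemma edge_cont_add: "edge_cont E f \<Longrightarrow> edge_cont E g \<Longrightarrow> edge_cont E (\<lambda>x. f x + g x)"
  and edge_cont_diff: "edge_cont E f \<Longrightarrow> edge_cont E g \<Longrightarrow> edge_cont E (\<lambda>x. f x - g x)"
  and edge_cont_mult: "edge_cont E f \<Longrightarrow> edge_cont E g \<Longrightarrow> edge_cont E (\<lambda>x. f x * g x)"
  and edge_cont_const: "edge_cont E (\<lambda>x. c)"
  unfolding edge_cont_def by (intro ae_cont_intros; assumption)+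

lemmas edge_cont_intros = edge_cont_add edge_cont_diff edge_cont_mult edge_cont_const

lemma edge_integral_diff: "edge_cont E f \<Longrightarrow> edge_cont E g \<Longrightarrow>
    edge_integral E (\<lambda>x. f x - g x) = edge_integral E f - edge_integral E g"
  unfolding edge_cont_def edge_integral_def
  by (subst Bochner_Integration.integral_diff) (simp_all add: integrable_ae_cont algebra_simps)

lemma edge_integral_sum: "(\<And>i. i \<in> I \<Longrightarrow> edge_cont E (f i)) \<Longrightarrow>
    edge_integral E (\<lambda>x. \<Sum>i\<in>I. f i x) = (\<Sum>i\<in>I. edge_integral E (f i))"
  unfolding edge_cont_def edge_integral_def
  by (subst Bochner_Integration.integral_sum) (simp_all add: integrable_ae_cont sum_distrib_left)

lemma edge_integral_cmult: "edge_integral E (\<lambda>x. r * g x) = r * edge_integral E g"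
  by (simp add: edge_integral_def)

lemma edge_integral_nonneg: "(\<And>x. 0 \<le> g x) \<Longrightarrow> 0 \<le> edge_integral E g"
  by (simp add: edge_integral_def Bochner_Integration.integral_nonneg)

lemma edge_integral_cong_AE:
  assumes "edge_cont E g" "AE s in lebesgue_on {0..1}. f (edge_path E s) = g (edge_path E s)"
  shows "edge_integral E f = edge_integral E g"
  using integral_cong_ae_cont[OF assms(1)[unfolded edge_cont_def] _ assms(2)] by (simp add: edge_integral_def)

locale triangulated_domain =
  fixes \<Omega> :: "(real^2) set" and \<T> :: "(real^2) set set" and \<sigma> :: real
  assumes domain: "convex_polygonal_domain \<Omega>"
    and mesh: "shape_regular_triangulation \<sigma> \<Omega> \<T>"
begin

lemma finite_mesh: "finite \<T>"
  and simplex_mesh: "K \<in> \<T> \<Longrightarrow> 2 simplex K"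
  and Union_mesh: "\<Union>\<T> = closure \<Omega>"
  and Int_face_of: "K \<in> \<T> \<Longrightarrow> L \<in> \<T> \<Longrightarrow> (K \<inter> L) face_of K"
  using mesh unfolding shape_regular_triangulation_def triangulation_def by blast+

lemma compact_elem: "K \<in> \<T> \<Longrightarrow> compact K"
  and interior_elem: "K \<in> \<T> \<Longrightarrow> interior K \<noteq> {}"
  by (rule simplex2_compact[OF simplex_mesh], assumption,
      rule simplex2_interior_nonempty[OF simplex_mesh], assumption)

text \<open>Two different triangles of the mesh meet in a common face. It is a proper face of one of them, and
proper faces lie in the frontier, which is negligible for a convex set.\<close>

lemma negligible_Int_mesh: "pairwise (\<lambda>K L. negligible (K \<inter> L)) \<T>"
proof (rule pairwiseI)
  have *: "negligible (K \<inter> L)" if KL: "K \<in> \<T>" "L \<in> \<T>" "K \<inter> L \<noteq> K" for K L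
  proof -
    have K: "convex K" using simplex_mesh[OF KL(1)] by (auto simp: simplex)
    have "K \<inter> L \<subseteq> rel_frontier K"
      by (rule face_of_subset_rel_frontier[OF Int_face_of[OF KL(1,2)] KL(3)])
    also have "\<dots> = frontier K"
      using interior_elem[OF KL(1)] by (simp add: rel_frontier_def frontier_def rel_interior_nonempty_interior)
    finally show ?thesis using negligible_convex_frontier[OF K] negligible_subset by blast
  qed
  fix K L assume KL: "K \<in> \<T>" "L \<in> \<T>" "K \<noteq> L"
  show "negligible (K \<inter> L)"
  proof (cases "K \<inter> L = K")
    case False
    then show ?thesis by (rule *[OF KL(1,2)])
  next
    case True
    then have "L \<inter> K \<noteq> L" using KL by blast
    then show ?thesis using *[of L K] KL by (simp add: Int_commute)
  qed
qed

text \<open>The \<open>L\<^sup>2\<close> norm is an integral over the open domain, whereas the mesh covers its closure. The frontier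
of a convex set is negligible.\<close>

lemma integral_domain_eq_mesh_integral:
  assumes g: "\<And>K. K \<in> \<T> \<Longrightarrow> ae_cont K g"
  shows "(LINT x|lebesgue_on \<Omega>. g x) = mesh_integral \<T> g"
proof -
  have meas: "K \<in> sets lebesgue" if "K \<in> \<T>" for K
    using compact_elem[OF that] lmeasurable_compact fmeasurableD by blast
  have int: "integrable (lebesgue_on K) g" if "K \<in> \<T>" for K
    by (rule integrable_ae_cont[OF g[OF that] compact_elem[OF that]])
  have op: "open \<Omega>" and cv: "convex \<Omega>" using domain by (auto simp: convex_polygonal_domain_def)
  have m\<Omega>: "\<Omega> \<in> sets lebesgue" using op by simp
  have "set_integrable lebesgue (\<Union>K\<in>\<T>. K) g"
    by (rule set_integrable_UN[OF finite_mesh])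
      (use int meas in \<open>auto simp: set_integrable_def integrable_restrict_space\<close>)
  then have "set_integrable lebesgue \<Omega> g"
    by (rule set_integrable_subset) (use m\<Omega> Union_mesh closure_subset in auto)
  then have i\<Omega>: "integrable (lebesgue_on \<Omega>) g"
    using m\<Omega> by (simp add: set_integrable_def integrable_restrict_space)
  have "(g has_integral mesh_integral \<T> g) (\<Union>\<T>)"
    unfolding mesh_integral_def
    by (rule has_integral_Union[OF finite_mesh has_integral_integral_lebesgue_on[OF int meas] negligible_Int_mesh])
  moreover have "negligible {x \<in> \<Union>\<T> - \<Omega>. g x \<noteq> 0}" "negligible {x \<in> \<Omega> - \<Union>\<T>. g x \<noteq> 0}"
  proof -
    have "{x \<in> \<Union>\<T> - \<Omega>. g x \<noteq> 0} \<subseteq> frontier \<Omega>"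
      using op by (auto simp: Union_mesh frontier_def interior_open)
    then show "negligible {x \<in> \<Union>\<T> - \<Omega>. g x \<noteq> 0}"
      using negligible_convex_frontier[OF cv] negligible_subset by blast
    have "{x \<in> \<Omega> - \<Union>\<T>. g x \<noteq> 0} = {}" using closure_subset Union_mesh by auto
    then show "negligible {x \<in> \<Omega> - \<Union>\<T>. g x \<noteq> 0}" by (metis negligible_empty)
  qed
  ultimately have "(g has_integral mesh_integral \<T> g) \<Omega>"
    by (simp add: has_integral_spike_set_eq)
  then show ?thesis
    using lebesgue_integral_eq_integral[OF i\<Omega> m\<Omega>] by (simp add: integral_unique)
qed

lemma L2_norm_sq:
  assumes "\<And>K. K \<in> \<T> \<Longrightarrow> ae_cont K w"
  shows "(L2_norm \<Omega> w)\<^sup>2 = mesh_integral \<T> (\<lambda>x. w x * w x)"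
proof -
  have "(L2_norm \<Omega> w)\<^sup>2 = (LINT x|lebesgue_on \<Omega>. (norm (w x))\<^sup>2)"
    unfolding L2_norm_def by (rule real_sqrt_pow2) (rule Bochner_Integration.integral_nonneg, simp)
  also have "\<dots> = (LINT x|lebesgue_on \<Omega>. w x * w x)" by (simp add: power2_eq_square)
  also have "\<dots> = mesh_integral \<T> (\<lambda>x. w x * w x)"
    by (intro integral_domain_eq_mesh_integral ae_cont_intros assms)
  finally show ?thesis .
qed

lemma L2_norm_sq_vec:
  fixes q :: "real^2 \<Rightarrow> real^2"
  assumes "\<And>K i. K \<in> \<T> \<Longrightarrow> ae_cont K (\<lambda>x. q x $ i)"
  shows "(L2_norm \<Omega> q)\<^sup>2 = mesh_integral \<T> (\<lambda>x. q x \<bullet> q x)"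
proof -
  have "(L2_norm \<Omega> q)\<^sup>2 = (LINT x|lebesgue_on \<Omega>. (norm (q x))\<^sup>2)"
    unfolding L2_norm_def by (rule real_sqrt_pow2) (rule Bochner_Integration.integral_nonneg, simp)
  also have "\<dots> = (LINT x|lebesgue_on \<Omega>. q x \<bullet> q x)" by (simp add: power2_norm_eq_inner)
  also have "\<dots> = mesh_integral \<T> (\<lambda>x. q x \<bullet> q x)"
    by (intro integral_domain_eq_mesh_integral ae_cont_vec_inner assms)
  finally show ?thesis .
qed

lemma elem_integral_sq_le:
  assumes w: "\<And>K. K \<in> \<T> \<Longrightarrow> ae_cont K w" and K: "K \<in> \<T>"
  shows "(LINT x|lebesgue_on K. w x * w x) \<le> (L2_norm \<Omega> w)\<^sup>2"
proof -
  have "(LINT x|lebesgue_on K. w x * w x) \<le> mesh_integral \<T> (\<lambda>x. w x * w x)"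
    unfolding mesh_integral_def
    by (rule member_le_sum[OF K _ finite_mesh]) (simp add: Bochner_Integration.integral_nonneg)
  then show ?thesis using L2_norm_sq[OF w] by simp
qed

lemma edge_segment:
  assumes "E \<in> faces \<T>"
  obtains a b where "a \<noteq> b" "E = closed_segment a b"
proof -
  obtain K where K: "K \<in> \<T>" "E \<in> edges K" using assms by (auto simp: faces_def)
  obtain a b c where abc: "K = convex hull {a,b,c}" "\<not> affine_dependent {a,b,c}" "card {a,b,c} = 3"
    "cross2 (b - a) (c - a) \<noteq> 0"
    by (rule simplex2_triangle[OF simplex_mesh[OF K(1)]])
  have "a \<noteq> b" "b \<noteq> c" "c \<noteq> a" using abc(3) by (auto simp: card_insert_if split: if_splits)
  then show ?thesis using K(2) that unfolding abc(1) edges_triangle[OF abc(2,3)] by blast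
qed

lemma edge_length_pos:
  assumes "E \<in> faces \<T>" shows "dist (fst (edge_ends E)) (snd (edge_ends E)) > 0"
proof -
  obtain a b where "a \<noteq> b" "E = closed_segment a b" by (rule edge_segment[OF assms])
  with edge_ends(2)[of E a b] show ?thesis by (auto simp: doubleton_eq_iff)
qed

lemma finite_edges: assumes "K \<in> \<T>" shows "finite (edges K)"
proof -
  obtain a b c where abc: "K = convex hull {a,b,c}" "\<not> affine_dependent {a,b,c}" "card {a,b,c} = 3"
    "cross2 (b - a) (c - a) \<noteq> 0"
    by (rule simplex2_triangle[OF simplex_mesh[OF assms]])
  then show ?thesis by (simp add: edges_triangle)
qed

lemma edges_subset_faces: "K \<in> \<T> \<Longrightarrow> E \<in> edges K \<Longrightarrow> E \<in> faces \<T>"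
  by (auto simp: faces_def)

lemma finite_faces: "finite (faces \<T>)"
  unfolding faces_def by (rule finite_UN_I[OF finite_mesh finite_edges])

lemma W_h_ae_poly: "w \<in> W_h \<Omega> \<T> k \<Longrightarrow> K \<in> \<T> \<Longrightarrow> ae_poly K k w"
  by (simp add: W_h_def ae_poly_def)

lemma V_h_ae_poly: "v \<in> V_h \<Omega> \<T> k \<Longrightarrow> K \<in> \<T> \<Longrightarrow> ae_poly K k (\<lambda>x. v x $ i)"
  by (simp add: V_h_def W_h_ae_poly)

lemma W_h_ae_cont: "w \<in> W_h \<Omega> \<T> k \<Longrightarrow> K \<in> \<T> \<Longrightarrow> ae_cont K w"
  by (rule ae_poly_imp_ae_cont[OF W_h_ae_poly])

lemma V_h_ae_cont: "v \<in> V_h \<Omega> \<T> k \<Longrightarrow> K \<in> \<T> \<Longrightarrow> ae_cont K (\<lambda>x. v x $ i)"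
  by (rule ae_poly_imp_ae_cont[OF V_h_ae_poly])

lemma smooth1_elem_poly: "ae_poly K k w \<Longrightarrow> K \<in> \<T> \<Longrightarrow> smooth1 (elem_poly K w)"
  by (rule smooth1_poly_fun[OF elem_poly_expansion(3)[OF compact_elem interior_elem]])

lemma AE_elem_poly: "ae_poly K k w \<Longrightarrow> K \<in> \<T> \<Longrightarrow> AE x in lebesgue_on K. w x = elem_poly K w x"
  by (rule elem_poly_expansion(2)[OF compact_elem interior_elem])

lemma continuous_elem_poly: "ae_poly K k w \<Longrightarrow> K \<in> \<T> \<Longrightarrow> continuous_on S (elem_poly K w)"
  by (rule smooth1_continuous_on[OF smooth1_elem_poly])

lemma edge_cont_M_h: "\<mu> \<in> M_h \<T> k \<Longrightarrow> E \<in> faces \<T> \<Longrightarrow> edge_cont E \<mu>"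
proof -
  assume "\<mu> \<in> M_h \<T> k" "E \<in> faces \<T>"
  then obtain p where p: "p \<in> poly_fun k" "AE s in lebesgue_on {0..1}. \<mu> (edge_path E s) = p (edge_path E s)"
    unfolding M_h_def by blast
  have "edge_cont E p" by (rule edge_cont_continuous[OF continuous_on_poly_fun[OF p(1)]])
  then show ?thesis unfolding edge_cont_def using p(2) by (rule ae_cont_cong)
qed

text \<open>The divergence theorem for the products \<open>P Q\<^sub>i\<close>, where \<open>P\<close> and \<open>Q\<close> represent \<open>w\<close> and \<open>v\<close> on \<open>K\<close>.\<close>

lemma integration_by_parts_elem:
  assumes K: "K \<in> \<T>" and w: "ae_poly K k w" and v: "\<And>i. ae_poly K k (\<lambda>x. v x $ i)"
  shows "(LINT x|lebesgue_on K. w x * elem_div K v x) + (LINT x|lebesgue_on K. v x \<bullet> elem_grad K w x)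
    = (\<Sum>E\<in>edges K. edge_integral E (\<lambda>x. elem_poly K w x * (elem_poly_vec K v x \<bullet> outward_normal K E)))"
proof -
  define P where "P = elem_poly K w"
  define Q where "Q = (\<lambda>i. elem_poly K (\<lambda>y. v y $ i))"
  have sP: "smooth1 P" and sQ: "smooth1 (Q i)" for i
    unfolding P_def Q_def by (rule smooth1_elem_poly[OF w K], rule smooth1_elem_poly[OF v K])
  have cP: "continuous_on S P" and cQ: "continuous_on S (Q i)" for S i
    by (rule smooth1_continuous_on[OF sP], rule smooth1_continuous_on[OF sQ])
  have cdP: "continuous_on S (partial_deriv j P)" and cdQ: "continuous_on S (partial_deriv j (Q i))" for S i j
    by (rule smooth1_partial_continuous_on[OF sP], rule smooth1_partial_continuous_on[OF sQ])
  have Qv: "elem_poly_vec K v x = (\<chi> i. Q i x)" for x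
    by (simp add: elem_poly_vec_def Q_def)
  have aw: "AE x in lebesgue_on K. w x = P x" unfolding P_def by (rule AE_elem_poly[OF w K])
  have av: "AE x in lebesgue_on K. v x $ i = Q i x" for i unfolding Q_def by (rule AE_elem_poly[OF v K])
  have acl: "ae_cont K (\<lambda>x. \<Sum>i\<in>UNIV. P x * partial_deriv i (Q i) x)"
    "ae_cont K (\<lambda>x. \<Sum>i\<in>UNIV. partial_deriv i P x * Q i x)"
    by (intro ae_cont_continuous continuous_intros cP cQ cdP cdQ)+
  have 1: "(LINT x|lebesgue_on K. w x * elem_div K v x) = (LINT x|lebesgue_on K. (\<Sum>i\<in>UNIV. P x * partial_deriv i (Q i) x))"
    by (rule integral_cong_ae_cont[OF acl(1) compact_elem[OF K]])
      (use aw in eventually_elim, simp add: elem_div_def Qv sum_distrib_left)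
  have avq: "AE x in lebesgue_on K. v x = (\<chi> i. Q i x)"
    using av[of 1] av[of 2] by eventually_elim (simp add: vec_eq_iff forall_2)
  have 2: "(LINT x|lebesgue_on K. v x \<bullet> elem_grad K w x) = (LINT x|lebesgue_on K. (\<Sum>i\<in>UNIV. partial_deriv i P x * Q i x))"
    by (rule integral_cong_ae_cont[OF acl(2) compact_elem[OF K]])
      (use avq in eventually_elim, simp add: elem_grad_def P_def inner_vec_def mult.commute)
  have "(LINT x|lebesgue_on K. w x * elem_div K v x) + (LINT x|lebesgue_on K. v x \<bullet> elem_grad K w x)
    = (LINT x|lebesgue_on K. (\<Sum>i\<in>UNIV. P x * partial_deriv i (Q i) x) + (\<Sum>i\<in>UNIV. partial_deriv i P x * Q i x))"
    unfolding 1 2 by (rule Bochner_Integration.integral_add[symmetric]) (intro integrable_ae_cont acl compact_elem[OF K])+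
  also have "\<dots> = (LINT x|lebesgue_on K. (\<Sum>i\<in>UNIV. partial_deriv i (\<lambda>x. P x * Q i x) x))"
    by (simp add: smooth1_mult(1)[OF sP sQ] sum.distrib)
  also have "\<dots> = (\<Sum>i\<in>UNIV. LINT x|lebesgue_on K. partial_deriv i (\<lambda>x. P x * Q i x) x)"
    by (intro Bochner_Integration.integral_sum integrable_ae_cont ae_cont_continuous compact_elem[OF K]
       smooth1_partial_continuous_on smooth1_mult(2) sP sQ)
  also have "\<dots> = (\<Sum>i\<in>UNIV. \<Sum>E\<in>edges K. edge_integral E (\<lambda>x. P x * Q i x * outward_normal K E $ i))"
    by (intro sum.cong refl divergence_theorem_simplex2 simplex_mesh K smooth1_mult(2) sP sQ)
  also have "\<dots> = (\<Sum>E\<in>edges K. edge_integral E (\<lambda>x. \<Sum>i\<in>UNIV. P x * Q i x * outward_normal K E $ i))"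
    by (subst sum.swap) (intro sum.cong refl edge_integral_sum[symmetric] edge_cont_continuous continuous_intros cP cQ)
  also have "\<dots> = (\<Sum>E\<in>edges K. edge_integral E (\<lambda>x. P x * (elem_poly_vec K v x \<bullet> outward_normal K E)))"
    by (simp add: Qv inner_vec_def sum_distrib_left mult.assoc)
  finally show ?thesis by (simp add: P_def)
qed

section \<open>The energy identity between two states\<close>

text \<open>The bilinear form \<open>a\<close>, whose diagonal is the part of the energy that involves \<open>q\<close> and the jump between
\<open>u\<close> and its numerical trace.\<close>

definition energy_form where
  "energy_form \<tau> u1 q1 h1 u2 q2 h2 = mesh_integral \<T> (\<lambda>x. q1 x \<bullet> q2 x)
     + bdry_integral \<T> (\<lambda>K E x. \<tau> E * ((elem_poly K u1 x - h1 x) * (elem_poly K u2 x - h2 x)))"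

text \<open>The form \<open>b(w; X)\<close>, the spatial part of the second equation tested with \<open>w\<close>.\<close>

definition residual_form where
  "residual_form \<tau> w u q h = (\<Sum>K\<in>\<T>. LINT x|lebesgue_on K. q x \<bullet> elem_grad K w x)
     - bdry_integral \<T> (\<lambda>K E x. q_flux \<tau> u q h K E x * elem_poly K w x)"

lemma energy_form_commute: "energy_form \<tau> u1 q1 h1 u2 q2 h2 = energy_form \<tau> u2 q2 h2 u1 q1 h1"
  unfolding energy_form_def by (simp add: inner_commute mult.commute)

definition bdry_cont where
  "bdry_cont g \<longleftrightarrow> (\<forall>K\<in>\<T>. \<forall>E\<in>edges K. edge_cont E (g K E))"

lemma bdry_integral_diff: "bdry_cont f \<Longrightarrow> bdry_cont g \<Longrightarrow>
   bdry_integral \<T> (\<lambda>K E x. f K E x - g K E x) = bdry_integral \<T> f - bdry_integral \<T> g"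
  unfolding bdry_integral_def bdry_cont_def sum_subtractf[symmetric]
  by (intro sum.cong refl edge_integral_diff) blast+

lemma edge_cont_elem_poly:
  assumes "w \<in> W_h \<Omega> \<T> k" "K \<in> \<T>" shows "edge_cont E (elem_poly K w)"
  by (intro edge_cont_continuous continuous_elem_poly[OF W_h_ae_poly[OF assms] assms(2)])

lemma edge_cont_elem_poly_normal:
  assumes "v \<in> V_h \<Omega> \<T> k" "K \<in> \<T>" shows "edge_cont E (\<lambda>x. elem_poly_vec K v x \<bullet> n)"
proof -
  have c: "continuous_on UNIV (elem_poly K (\<lambda>y. v y $ i))" for i
    by (rule continuous_elem_poly[OF V_h_ae_poly[OF assms] assms(2)])
  have "continuous_on UNIV (\<lambda>x. \<Sum>i\<in>UNIV. elem_poly K (\<lambda>y. v y $ i) x * n $ i)"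
    by (intro continuous_intros c)
  then show ?thesis
    by (intro edge_cont_continuous) (simp add: inner_vec_def elem_poly_vec_def)
qed

lemma edge_cont_q_flux:
  assumes "u \<in> W_h \<Omega> \<T> k" "q \<in> V_h \<Omega> \<T> k" "h \<in> M_h \<T> k" "K \<in> \<T>" "E \<in> edges K"
  shows "edge_cont E (q_flux \<tau> u q h K E)"
  unfolding q_flux_def[abs_def]
  using assms edges_subset_faces
  by (intro edge_cont_intros edge_cont_elem_poly edge_cont_elem_poly_normal edge_cont_M_h) auto

text \<open>Testing the boundary condition with the trace itself shows that it vanishes almost everywhere on
every boundary face, so the faces that the third equation leaves out contribute nothing.\<close>

lemma bdry_flux_trace_eq_0:
  assumes h: "h \<in> M_h \<T> k"
    and g: "\<And>K E. K \<in> \<T> \<Longrightarrow> E \<in> edges K \<Longrightarrow> edge_cont E (g K E)"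
    and inner: "interior_bdry_integral \<Omega> \<T> (\<lambda>K E x. g K E x * h x) = 0"
    and bdry: "(\<Sum>E\<in>boundary_faces \<Omega> \<T>. edge_integral E (\<lambda>x. h x * h x)) = 0"
  shows "bdry_integral \<T> (\<lambda>K E x. g K E x * h x) = 0"
proof -
  let ?B = "boundary_faces \<Omega> \<T>"
  have BF: "?B \<subseteq> faces \<T>" by (auto simp: boundary_faces_def)
  have h0: "AE s in lebesgue_on {0..1}. h (edge_path E s) = 0" if E: "E \<in> ?B" for E
  proof -
    have "edge_integral E (\<lambda>x. h x * h x) = 0"
      using bdry E finite_subset[OF BF finite_faces]
      by (subst (asm) sum_nonneg_eq_0_iff) (auto intro: edge_integral_nonneg)
    then have "(LINT s|lebesgue_on {0..1}. h (edge_path E s) * h (edge_path E s)) = 0"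
      using edge_length_pos[of E] E BF by (auto simp: edge_integral_def)
    then show ?thesis
      using integral_square_eq_0 edge_cont_M_h[OF h, of E] E BF unfolding edge_cont_def by auto
  qed
  have z: "edge_integral E (\<lambda>x. g K E x * h x) = 0" if "E \<in> ?B" for K E
  proof -
    have "edge_integral E (\<lambda>x. g K E x * h x) = edge_integral E (\<lambda>x. 0)"
      by (rule edge_integral_cong_AE[OF edge_cont_const]) (use h0[OF that] in eventually_elim, simp)
    then show ?thesis by (simp add: edge_integral_def)
  qed
  have "bdry_integral \<T> (\<lambda>K E x. g K E x * h x) = interior_bdry_integral \<Omega> \<T> (\<lambda>K E x. g K E x * h x)"
    unfolding bdry_integral_def interior_bdry_integral_def
    by (intro sum.cong refl sum.mono_neutral_right finite_edges) (use z in auto)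
  then show ?thesis using inner by simp
qed

text \<open>The first state enters through the first and last equations only, the second one through the third.
No time derivative occurs, so the two states may belong to different times.\<close>

lemma energy_form_eq_residual_form:
  assumes u1: "u1 \<in> W_h \<Omega> \<T> k" and q1: "q1 \<in> V_h \<Omega> \<T> k" and h1: "h1 \<in> M_h \<T> k"
    and u2: "u2 \<in> W_h \<Omega> \<T> k" and q2: "q2 \<in> V_h \<Omega> \<T> k" and h2: "h2 \<in> M_h \<T> k"
    and eq1: "hdg_equations \<Omega> \<T> \<tau> k u1 a1 q1 h1" and eq2: "hdg_equations \<Omega> \<T> \<tau> k u2 a2 q2 h2"
  shows "energy_form \<tau> u1 q1 h1 u2 q2 h2 = residual_form \<tau> u1 u2 q2 h2"
proof -
  let ?n = "\<lambda>K E x. elem_poly_vec K q2 x \<bullet> outward_normal K E"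
  let ?P1 = "\<lambda>K. elem_poly K u1" and ?P2 = "\<lambda>K. elem_poly K u2"
  let ?fl = "q_flux \<tau> u2 q2 h2"
  have gradient: "mesh_integral \<T> (\<lambda>x. q1 x \<bullet> q2 x) + (\<Sum>K\<in>\<T>. LINT x|lebesgue_on K. u1 x * elem_div K q2 x)
        - bdry_integral \<T> (\<lambda>K E x. h1 x * ?n K E x) = 0"
    using eq1 q2 unfolding hdg_equations_def by blast
  have ibp: "(\<Sum>K\<in>\<T>. LINT x|lebesgue_on K. u1 x * elem_div K q2 x)
      + (\<Sum>K\<in>\<T>. LINT x|lebesgue_on K. q2 x \<bullet> elem_grad K u1 x)
      = bdry_integral \<T> (\<lambda>K E x. ?P1 K x * ?n K E x)"
    unfolding bdry_integral_def sum.distrib[symmetric]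
    by (intro sum.cong refl integration_by_parts_elem) (auto intro: W_h_ae_poly[OF u1] V_h_ae_poly[OF q2])
  have flux0: "bdry_integral \<T> (\<lambda>K E x. ?fl K E x * h1 x) = 0"
  proof (rule bdry_flux_trace_eq_0[OF h1 edge_cont_q_flux[OF u2 q2 h2]])
    show "interior_bdry_integral \<Omega> \<T> (\<lambda>K E x. ?fl K E x * h1 x) = 0"
      using eq2 h1 unfolding hdg_equations_def by blast
    show "(\<Sum>E\<in>boundary_faces \<Omega> \<T>. edge_integral E (\<lambda>x. h1 x * h1 x)) = 0"
      using eq1 h1 unfolding hdg_equations_def by blast
  qed
  have c1: "edge_cont E (?P1 K)" "edge_cont E (?P2 K)" "edge_cont E (?n K E)" "edge_cont E h1" "edge_cont E h2"
    if "K \<in> \<T>" "E \<in> edges K" for K E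
    using that edge_cont_elem_poly[OF u1] edge_cont_elem_poly[OF u2] edge_cont_elem_poly_normal[OF q2]
      edge_cont_M_h[OF h1] edge_cont_M_h[OF h2] edges_subset_faces by auto
  have "bdry_integral \<T> (\<lambda>K E x. ?P1 K x * ?n K E x) - bdry_integral \<T> (\<lambda>K E x. h1 x * ?n K E x)
     = bdry_integral \<T> (\<lambda>K E x. ?P1 K x * ?n K E x - h1 x * ?n K E x)"
    by (rule bdry_integral_diff[symmetric]) (auto simp: bdry_cont_def intro!: edge_cont_mult c1)
  moreover have "bdry_integral \<T> (\<lambda>K E x. ?fl K E x * ?P1 K x) - bdry_integral \<T> (\<lambda>K E x. ?fl K E x * h1 x)
     = bdry_integral \<T> (\<lambda>K E x. ?fl K E x * ?P1 K x - ?fl K E x * h1 x)"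
    by (rule bdry_integral_diff[symmetric])
      (auto simp: bdry_cont_def intro!: edge_cont_mult c1 edge_cont_q_flux[OF u2 q2 h2])
  moreover have "bdry_integral \<T> (\<lambda>K E x. ?P1 K x * ?n K E x - h1 x * ?n K E x)
      - bdry_integral \<T> (\<lambda>K E x. \<tau> E * ((?P1 K x - h1 x) * (?P2 K x - h2 x)))
     = bdry_integral \<T> (\<lambda>K E x. (?P1 K x * ?n K E x - h1 x * ?n K E x) - \<tau> E * ((?P1 K x - h1 x) * (?P2 K x - h2 x)))"
    by (rule bdry_integral_diff[symmetric])
      (auto simp: bdry_cont_def intro!: edge_cont_mult edge_cont_diff edge_cont_const c1)
  moreover have "bdry_integral \<T> (\<lambda>K E x. (?P1 K x * ?n K E x - h1 x * ?n K E x) - \<tau> E * ((?P1 K x - h1 x) * (?P2 K x - h2 x)))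
     = bdry_integral \<T> (\<lambda>K E x. ?fl K E x * ?P1 K x - ?fl K E x * h1 x)"
    by (rule arg_cong[where f="bdry_integral \<T>"]) (simp add: q_flux_def algebra_simps)
  ultimately show ?thesis
    unfolding energy_form_def residual_form_def using gradient ibp flux0 by linarith
qed

text \<open>Symmetry of \<open>a\<close> allows the two mixed terms to be inserted with opposite signs, so that only the
increment \<open>u2 - u1\<close> appears in the first argument of \<open>b\<close>.\<close>

lemma energy_form_difference:
  assumes u1: "u1 \<in> W_h \<Omega> \<T> k" and q1: "q1 \<in> V_h \<Omega> \<T> k" and h1: "h1 \<in> M_h \<T> k"
    and u2: "u2 \<in> W_h \<Omega> \<T> k" and q2: "q2 \<in> V_h \<Omega> \<T> k" and h2: "h2 \<in> M_h \<T> k"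
    and eq1: "hdg_equations \<Omega> \<T> \<tau> k u1 a1 q1 h1" and eq2: "hdg_equations \<Omega> \<T> \<tau> k u2 a2 q2 h2"
  shows "energy_form \<tau> u2 q2 h2 u2 q2 h2 - energy_form \<tau> u1 q1 h1 u1 q1 h1
    = (residual_form \<tau> u2 u2 q2 h2 - residual_form \<tau> u1 u2 q2 h2)
    + (residual_form \<tau> u2 u1 q1 h1 - residual_form \<tau> u1 u1 q1 h1)"
  using energy_form_eq_residual_form[OF u2 q2 h2 u2 q2 h2 eq2 eq2]
    energy_form_eq_residual_form[OF u1 q1 h1 u2 q2 h2 eq1 eq2]
    energy_form_eq_residual_form[OF u2 q2 h2 u1 q1 h1 eq2 eq1]
    energy_form_eq_residual_form[OF u1 q1 h1 u1 q1 h1 eq1 eq1]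
    energy_form_commute[of \<tau> u1 q1 h1 u2 q2 h2] by linarith

text \<open>The value of \<open>b\<close> at a monomial on a single element. By linearity in \<open>w\<close>, the form \<open>b(w; X)\<close> is the sum
of the coefficients of \<open>w\<close> times these numbers, which separates the differentiable factor from the
merely continuous one.\<close>

definition residual_coeff where
  "residual_coeff \<tau> u q h K i = (LINT x|lebesgue_on K. q x \<bullet> (\<chi> j. partial_deriv j (monomial2 i) x))
     - (\<Sum>E\<in>edges K. edge_integral E (\<lambda>x. q_flux \<tau> u q h K E x * monomial2 i x))"

lemma residual_form_expansion:
  assumes u: "u \<in> W_h \<Omega> \<T> k" and q: "q \<in> V_h \<Omega> \<T> k" and h: "h \<in> M_h \<T> k" and w: "w \<in> W_h \<Omega> \<T> k"
  shows "residual_form \<tau> w u q h = (\<Sum>K\<in>\<T>. \<Sum>i\<in>poly_index k. elem_coeff K k i w * residual_coeff \<tau> u q h K i)"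
proof -
  have "(LINT x|lebesgue_on K. q x \<bullet> elem_grad K w x) - (\<Sum>E\<in>edges K. edge_integral E (\<lambda>x. q_flux \<tau> u q h K E x * elem_poly K w x))
     = (\<Sum>i\<in>poly_index k. elem_coeff K k i w * residual_coeff \<tau> u q h K i)" if K: "K \<in> \<T>" for K
  proof -
    let ?c = "\<lambda>i. elem_coeff K k i w"
    have P: "elem_poly K w = (\<lambda>x. \<Sum>i\<in>poly_index k. ?c i * monomial2 i x)"
      by (rule elem_poly_expansion(1)[OF compact_elem[OF K] interior_elem[OF K] W_h_ae_poly[OF w K]])
    have g: "elem_grad K w x = (\<Sum>i\<in>poly_index k. ?c i *\<^sub>R (\<chi> j. partial_deriv j (monomial2 i) x))" for x
      unfolding elem_grad_def P by (simp add: vec_eq_iff partial_deriv_sum(1)[OF smooth1_monomial2])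
    have ac: "ae_cont K (\<lambda>x. q x \<bullet> (\<chi> j. partial_deriv j (monomial2 i) x))" for i
      by (intro ae_cont_vec_inner V_h_ae_cont[OF q K])
        (simp add: ae_cont_continuous smooth1_partial_continuous_on[OF smooth1_monomial2])
    have 1: "(LINT x|lebesgue_on K. q x \<bullet> elem_grad K w x)
      = (\<Sum>i\<in>poly_index k. ?c i * (LINT x|lebesgue_on K. q x \<bullet> (\<chi> j. partial_deriv j (monomial2 i) x)))"
      unfolding g inner_sum_right inner_scaleR_right
      by (subst Bochner_Integration.integral_sum)
        (auto intro!: integrable_ae_cont ac compact_elem[OF K] Bochner_Integration.integrable_mult_right)
    have 2: "edge_integral E (\<lambda>x. q_flux \<tau> u q h K E x * elem_poly K w x)
       = (\<Sum>i\<in>poly_index k. ?c i * edge_integral E (\<lambda>x. q_flux \<tau> u q h K E x * monomial2 i x))" if E: "E \<in> edges K" for E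
    proof -
      have "edge_integral E (\<lambda>x. q_flux \<tau> u q h K E x * elem_poly K w x)
         = edge_integral E (\<lambda>x. \<Sum>i\<in>poly_index k. ?c i * (q_flux \<tau> u q h K E x * monomial2 i x))"
        unfolding P by (simp add: sum_distrib_left mult.left_commute)
      also have "\<dots> = (\<Sum>i\<in>poly_index k. edge_integral E (\<lambda>x. ?c i * (q_flux \<tau> u q h K E x * monomial2 i x)))"
        by (intro edge_integral_sum edge_cont_mult edge_cont_const edge_cont_q_flux[OF u q h K E]
          edge_cont_continuous continuous_on_monomial2)
      finally show ?thesis by (simp only: edge_integral_cmult)
    qed
    have "(\<Sum>E\<in>edges K. edge_integral E (\<lambda>x. q_flux \<tau> u q h K E x * elem_poly K w x))
      = (\<Sum>i\<in>poly_index k. ?c i * (\<Sum>E\<in>edges K. edge_integral E (\<lambda>x. q_flux \<tau> u q h K E x * monomial2 i x)))"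
      by (simp add: 2 sum_distrib_left sum.swap[of _ _ "edges K"])
    then show ?thesis unfolding 1 residual_coeff_def by (simp add: sum_subtractf right_diff_distrib)
  qed
  then show ?thesis unfolding residual_form_def bdry_integral_def sum_subtractf[symmetric]
    by (intro sum.cong refl)
qed

end

section \<open>Uniform limits on compact sets\<close>

text \<open>Uniform convergence of continuous functions on a compact set: closed under products, unlike
convergence in \<open>L\<^sup>2\<close>, and strong enough to pass to the limit under the integral. Continuity is
required only eventually, since the functions of interest are controlled for times in \<open>[0,T]\<close> only.\<close>

definition ulim :: "'t filter \<Rightarrow> 'a::euclidean_space set \<Rightarrow> ('t \<Rightarrow> 'a \<Rightarrow> real) \<Rightarrow> ('a \<Rightarrow> real) \<Rightarrow> bool" where
  "ulim F S g h \<longleftrightarrow> compact S \<and> continuous_on S h \<and> (\<forall>\<^sub>F s in F. continuous_on S (g s)) \<and> uniform_limit S g h F"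

lemma ulim_const: "compact S \<Longrightarrow> continuous_on S f \<Longrightarrow> ulim F S (\<lambda>s. f) f"
  by (simp add: ulim_def uniform_limit_const)

lemma ulim_scalar:
  assumes "compact S" "(a \<longlongrightarrow> l) F" shows "ulim F S (\<lambda>s x. a s) (\<lambda>x. l)"
proof -
  have "uniform_limit S (\<lambda>s x. a s) (\<lambda>x. l) F"
    by (rule uniform_limitI) (use tendstoD[OF assms(2)] in \<open>auto elim: eventually_mono\<close>)
  with assms(1) show ?thesis by (simp add: ulim_def)
qed

lemma ulim_add:
  assumes "ulim F S f f'" "ulim F S g g'" shows "ulim F S (\<lambda>s x. f s x + g s x) (\<lambda>x. f' x + g' x)"
proof -
  have "\<forall>\<^sub>F s in F. continuous_on S (f s)" "\<forall>\<^sub>F s in F. continuous_on S (g s)"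
    using assms by (simp_all add: ulim_def)
  then have "\<forall>\<^sub>F s in F. continuous_on S (\<lambda>x. f s x + g s x)"
    by eventually_elim (intro continuous_intros)
  with assms show ?thesis by (auto simp: ulim_def intro!: continuous_on_add uniform_limit_add)
qed

lemma ulim_diff:
  assumes "ulim F S f f'" "ulim F S g g'" shows "ulim F S (\<lambda>s x. f s x - g s x) (\<lambda>x. f' x - g' x)"
proof -
  have "\<forall>\<^sub>F s in F. continuous_on S (f s)" "\<forall>\<^sub>F s in F. continuous_on S (g s)"
    using assms by (simp_all add: ulim_def)
  then have "\<forall>\<^sub>F s in F. continuous_on S (\<lambda>x. f s x - g s x)"
    by eventually_elim (intro continuous_intros)
  with assms show ?thesis by (auto simp: ulim_def intro!: continuous_on_diff uniform_limit_minus)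
qed

lemma ulim_mult:
  assumes "ulim F S f f'" "ulim F S g g'" shows "ulim F S (\<lambda>s x. f s x * g s x) (\<lambda>x. f' x * g' x)"
proof -
  have "\<forall>\<^sub>F s in F. continuous_on S (f s)" "\<forall>\<^sub>F s in F. continuous_on S (g s)"
    using assms by (simp_all add: ulim_def)
  then have "\<forall>\<^sub>F s in F. continuous_on S (\<lambda>x. f s x * g s x)"
    by eventually_elim (intro continuous_intros)
  moreover have "bounded (f' ` S)" "bounded (g' ` S)"
    using assms unfolding ulim_def by (auto intro!: compact_imp_bounded compact_continuous_image)
  ultimately show ?thesis using assms by (auto simp: ulim_def intro!: continuous_on_mult uniform_lim_mult)
qed

lemma ulim_sum:
  assumes "compact S" "\<And>i. i \<in> I \<Longrightarrow> ulim F S (f i) (f' i)"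
  shows "ulim F S (\<lambda>s x. \<Sum>i\<in>I. f i s x) (\<lambda>x. \<Sum>i\<in>I. f' i x)"
  using assms(2)
proof (induction I rule: infinite_finite_induct)
  case (insert i I)
  then show ?case using ulim_add[of F S "f i" "f' i"] by simp
qed (simp_all add: ulim_const assms(1))

lemma ulim_cong:
  assumes "\<forall>\<^sub>F s in F. f s = g s" "ulim F S g h" shows "ulim F S f h"
proof -
  have "\<forall>\<^sub>F s in F. continuous_on S (g s)" using assms(2) by (simp add: ulim_def)
  then have "\<forall>\<^sub>F s in F. continuous_on S (f s)" using assms(1) by eventually_elim simp
  moreover have "uniform_limit S f h F"
    using assms by (subst uniform_limit_cong[of S f g F h h]) (auto simp: ulim_def elim: eventually_mono)
  ultimately show ?thesis using assms(2) by (simp add: ulim_def)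
qed

lemma ulim_compose:
  assumes "ulim F (\<phi> ` S) g h" "continuous_on S \<phi>" "compact S"
  shows "ulim F S (\<lambda>s x. g s (\<phi> x)) (\<lambda>x. h (\<phi> x))"
proof -
  have "\<forall>\<^sub>F s in F. continuous_on (\<phi> ` S) (g s)" using assms(1) by (simp add: ulim_def)
  then have "\<forall>\<^sub>F s in F. continuous_on S (\<lambda>x. g s (\<phi> x))"
    by eventually_elim (rule continuous_on_compose2[OF _ assms(2)], auto)
  moreover have "continuous_on S (\<lambda>x. h (\<phi> x))"
    by (rule continuous_on_compose2[OF _ assms(2)]) (use assms(1) in \<open>auto simp: ulim_def\<close>)
  moreover have "uniform_limit S (\<lambda>s x. g s (\<phi> x)) (\<lambda>x. h (\<phi> x)) F"
  proof (rule uniform_limitI)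
    fix e :: real assume "e > 0"
    then have "\<forall>\<^sub>F s in F. \<forall>x\<in>\<phi> ` S. dist (g s x) (h x) < e"
      using assms(1) uniform_limitD unfolding ulim_def by blast
    then show "\<forall>\<^sub>F s in F. \<forall>x\<in>S. dist (g s (\<phi> x)) (h (\<phi> x)) < e" by eventually_elim blast
  qed
  ultimately show ?thesis using assms(3) by (simp add: ulim_def)
qed

lemma ulim_integral:
  assumes "ulim F S g h"
  shows "((\<lambda>s. LINT x|lebesgue_on S. g s x) \<longlongrightarrow> (LINT x|lebesgue_on S. h x)) F"
proof (rule tendstoI)
  fix e :: real assume e: "e > 0"
  have S: "compact S" and h: "continuous_on S h" and g: "\<forall>\<^sub>F s in F. continuous_on S (g s)"
    and u: "uniform_limit S g h F" using assms by (auto simp: ulim_def)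
  define m where "m = (LINT x|lebesgue_on S. (1::real))"
  have m: "m \<ge> 0" unfolding m_def by (rule Bochner_Integration.integral_nonneg) simp
  define d where "d = e / (m + 1)"
  have d: "d > 0" "d * m < e" using e m by (auto simp: d_def field_simps)
  have "\<forall>\<^sub>F s in F. \<forall>x\<in>S. dist (g s x) (h x) < d" by (rule uniform_limitD[OF u d(1)])
  with g show "\<forall>\<^sub>F s in F. dist (LINT x|lebesgue_on S. g s x) (LINT x|lebesgue_on S. h x) < e"
  proof eventually_elim
    fix s assume cs: "continuous_on S (g s)" and ds: "\<forall>x\<in>S. dist (g s x) (h x) < d"
    have int: "integrable (lebesgue_on S) (g s)" "integrable (lebesgue_on S) h" "integrable (lebesgue_on S) (\<lambda>x. g s x - h x)"
      "integrable (lebesgue_on S) (\<lambda>x. d :: real)" "integrable (lebesgue_on S) (\<lambda>x. \<bar>g s x - h x\<bar>)"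
      by (intro integrable_ae_cont ae_cont_continuous S cs h continuous_intros)+
    have "\<bar>(LINT x|lebesgue_on S. g s x) - (LINT x|lebesgue_on S. h x)\<bar> = \<bar>LINT x|lebesgue_on S. g s x - h x\<bar>"
      using int by simp
    also have "\<dots> \<le> (LINT x|lebesgue_on S. \<bar>g s x - h x\<bar>)" by (rule integral_abs_bound)
    also have "\<dots> \<le> (LINT x|lebesgue_on S. d)"
      by (rule integral_mono[OF int(5,4)]) (use ds in \<open>auto simp: dist_real_def space_restrict_space less_imp_le\<close>)
    also have "\<dots> = d * m"
      using Bochner_Integration.integral_mult_right_zero[of "lebesgue_on S" d "\<lambda>x. 1"] by (simp only: m_def mult_1_right)
    also have "\<dots> < e" by (rule d(2))
    finally show "dist (LINT x|lebesgue_on S. g s x) (LINT x|lebesgue_on S. h x) < e"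
      by (simp add: dist_real_def)
  qed
qed

text \<open>Differentiation under the integral, with the chain rule replaced by a factorisation of the increment
of \<open>G\<close>. Both the kinetic and the potential energy have such a factorisation with polynomial \<open>H\<close>.\<close>

lemma integral_has_derivative_difference_quotient:
  fixes p :: "real \<Rightarrow> 'a::euclidean_space \<Rightarrow> real"
  assumes dq: "ulim (at t within A) S (\<lambda>s x. (p s x - p t x) / (s - t)) p'"
    and H: "\<And>a b. G a - G b = (a - b) * H a b"
    and Hl: "ulim (at t within A) S (\<lambda>s x. H (p s x) (p t x)) (\<lambda>x. H (p t x) (p t x))"
    and Gc: "\<forall>\<^sub>F s in at t within A. continuous_on S (\<lambda>x. G (p s x))" "continuous_on S (\<lambda>x. G (p t x))"
  shows "((\<lambda>s. LINT x|lebesgue_on S. G (p s x)) has_field_derivative (LINT x|lebesgue_on S. p' x * H (p t x) (p t x))) (at t within A)"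
  unfolding has_field_derivative_iff
proof (rule Lim_transform_eventually[OF ulim_integral[OF ulim_mult[OF dq Hl]]])
  have S: "compact S" using dq by (simp add: ulim_def)
  show "\<forall>\<^sub>F s in at t within A. (LINT x|lebesgue_on S. (p s x - p t x) / (s - t) * H (p s x) (p t x))
     = ((LINT x|lebesgue_on S. G (p s x)) - (LINT x|lebesgue_on S. G (p t x))) / (s - t)"
    using Gc(1)
  proof eventually_elim
    fix s assume c: "continuous_on S (\<lambda>x. G (p s x))"
    have "((LINT x|lebesgue_on S. G (p s x)) - (LINT x|lebesgue_on S. G (p t x))) / (s - t)
       = (LINT x|lebesgue_on S. (G (p s x) - G (p t x)) / (s - t))"
      using integrable_ae_cont[OF ae_cont_continuous[OF c] S] integrable_ae_cont[OF ae_cont_continuous[OF Gc(2)] S] by simp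
    moreover have "(p s x - p t x) / (s - t) * H (p s x) (p t x) = (G (p s x) - G (p t x)) / (s - t)" for x
      by (simp add: H)
    ultimately show "(LINT x|lebesgue_on S. (p s x - p t x) / (s - t) * H (p s x) (p t x))
     = ((LINT x|lebesgue_on S. G (p s x)) - (LINT x|lebesgue_on S. G (p t x))) / (s - t)"
      by (simp only:)
  qed
qed

section \<open>Convergence of polynomial coefficients\<close>

lemma elem_coeff_tendsto_0:
  assumes K: "compact K" "interior K \<noteq> {}" and i: "i \<in> poly_index k"
    and w: "\<forall>\<^sub>F s in F. ae_cont K (w s)"
    and lim: "((\<lambda>s. LINT x|lebesgue_on K. w s x * w s x) \<longlongrightarrow> 0) F"
  shows "((\<lambda>s. elem_coeff K k i (w s)) \<longlongrightarrow> 0) F"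
proof -
  let ?r = "dual_monomial K k i"
  define N where "N = (LINT x|lebesgue_on K. ?r x * ?r x)"
  have "((\<lambda>s. (LINT x|lebesgue_on K. w s x * w s x) * N) \<longlongrightarrow> 0) F"
    using tendsto_mult_right[OF lim, of N] by simp
  moreover have "\<forall>\<^sub>F s in F. norm ((elem_coeff K k i (w s))\<^sup>2) \<le> (LINT x|lebesgue_on K. w s x * w s x) * N"
    using w by eventually_elim
      (simp add: elem_coeff_def N_def Cauchy_Schwarz_ae_cont dual_monomial(1)[OF K i] K(1))
  ultimately have "((\<lambda>s. (elem_coeff K k i (w s))\<^sup>2) \<longlongrightarrow> 0) F"
    by (rule Lim_null_comparison[rotated])
  from tendsto_real_sqrt[OF this] show ?thesis by (simp add: tendsto_rabs_zero_iff)
qed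

lemma edge_coeff_tendsto_0:
  assumes i: "i \<le> k" and w: "\<forall>\<^sub>F s in F. ae_cont {0..1} (w s)"
    and lim: "((\<lambda>s. LINT x|lebesgue_on {0..1}. w s x * w s x) \<longlongrightarrow> 0) F"
  shows "((\<lambda>s. edge_coeff k i (w s)) \<longlongrightarrow> 0) F"
proof -
  let ?r = "dual_power k i"
  define N where "N = (LINT x|lebesgue_on {0..1}. ?r x * ?r x)"
  have "((\<lambda>s. (LINT x|lebesgue_on {0..1}. w s x * w s x) * N) \<longlongrightarrow> 0) F"
    using tendsto_mult_right[OF lim, of N] by simp
  moreover have "\<forall>\<^sub>F s in F. norm ((edge_coeff k i (w s))\<^sup>2) \<le> (LINT x|lebesgue_on {0..1}. w s x * w s x) * N"
    using w by eventually_elim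
      (simp add: edge_coeff_def N_def Cauchy_Schwarz_ae_cont dual_power(1)[OF i])
  ultimately have "((\<lambda>s. (edge_coeff k i (w s))\<^sup>2) \<longlongrightarrow> 0) F"
    by (rule Lim_null_comparison[rotated])
  from tendsto_real_sqrt[OF this] show ?thesis by (simp add: tendsto_rabs_zero_iff)
qed

lemma elem_coeff_diff:
  assumes K: "compact K" "interior K \<noteq> {}" and i: "i \<in> poly_index k" and v: "ae_cont K v" and w: "ae_cont K w"
  shows "elem_coeff K k i (\<lambda>x. v x - w x) = elem_coeff K k i v - elem_coeff K k i w"
  unfolding elem_coeff_def left_diff_distrib
  by (intro Bochner_Integration.integral_diff integrable_ae_cont ae_cont_mult v w dual_monomial(1) K i)

lemma elem_coeff_divide: "elem_coeff K k i (\<lambda>x. v x / c) = elem_coeff K k i v / c"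
  by (simp add: elem_coeff_def)

lemma edge_coeff_diff:
  assumes i: "i \<le> k" and v: "ae_cont {0..1} v" and w: "ae_cont {0..1} w"
  shows "edge_coeff k i (\<lambda>x. v x - w x) = edge_coeff k i v - edge_coeff k i w"
  unfolding edge_coeff_def left_diff_distrib
  by (intro Bochner_Integration.integral_diff integrable_ae_cont ae_cont_mult v w dual_power(1) i) auto

context triangulated_domain
begin

lemma L2_null_imp_elem_null:
  assumes K: "K \<in> \<T>" and w: "\<forall>\<^sub>F s in F. \<forall>L\<in>\<T>. ae_cont L (w s)"
    and lim: "((\<lambda>s. L2_norm \<Omega> (w s)) \<longlongrightarrow> 0) F"
  shows "((\<lambda>s. LINT x|lebesgue_on K. w s x * w s x) \<longlongrightarrow> 0) F"
proof (rule Lim_null_comparison)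
  show "((\<lambda>s. (L2_norm \<Omega> (w s))\<^sup>2) \<longlongrightarrow> 0) F" using tendsto_power[OF lim, of 2] by simp
  show "\<forall>\<^sub>F s in F. norm (LINT x|lebesgue_on K. w s x * w s x) \<le> (L2_norm \<Omega> (w s))\<^sup>2"
    using w by eventually_elim (simp add: elem_integral_sq_le[OF _ K] Bochner_Integration.integral_nonneg)
qed

lemma L2_null_imp_elem_null_vec:
  assumes K: "K \<in> \<T>" and w: "\<forall>\<^sub>F s in F. \<forall>L\<in>\<T>. \<forall>i. ae_cont L (\<lambda>x. w s x $ i)"
    and lim: "((\<lambda>s. L2_norm \<Omega> (w s :: real^2 \<Rightarrow> real^2)) \<longlongrightarrow> 0) F"
  shows "((\<lambda>s. LINT x|lebesgue_on K. w s x $ j * w s x $ j) \<longlongrightarrow> 0) F"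
proof (rule Lim_null_comparison)
  show "((\<lambda>s. (L2_norm \<Omega> (w s))\<^sup>2) \<longlongrightarrow> 0) F" using tendsto_power[OF lim, of 2] by simp
  show "\<forall>\<^sub>F s in F. norm (LINT x|lebesgue_on K. w s x $ j * w s x $ j) \<le> (L2_norm \<Omega> (w s))\<^sup>2"
    using w
  proof eventually_elim
    fix s assume "\<forall>L\<in>\<T>. \<forall>i. ae_cont L (\<lambda>x. w s x $ i)"
    then have c: "ae_cont L (\<lambda>x. w s x $ i)" if "L \<in> \<T>" for L i using that by blast
    have "(LINT x|lebesgue_on K. w s x $ j * w s x $ j) \<le> (LINT x|lebesgue_on K. w s x \<bullet> w s x)"
    proof (rule integral_mono)
      show "integrable (lebesgue_on K) (\<lambda>x. w s x $ j * w s x $ j)"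
        by (intro integrable_ae_cont ae_cont_mult c K compact_elem)
      show "integrable (lebesgue_on K) (\<lambda>x. w s x \<bullet> w s x)"
        by (intro integrable_ae_cont ae_cont_vec_inner c K compact_elem)
      show "w s x $ j * w s x $ j \<le> w s x \<bullet> w s x" for x
        unfolding inner_vec_def inner_real_def by (rule member_le_sum) auto
    qed
    also have "\<dots> \<le> mesh_integral \<T> (\<lambda>x. w s x \<bullet> w s x)"
      unfolding mesh_integral_def
      by (rule member_le_sum[OF K _ finite_mesh]) (simp add: Bochner_Integration.integral_nonneg)
    also have "\<dots> = (L2_norm \<Omega> (w s))\<^sup>2" by (rule L2_norm_sq_vec[symmetric]) (rule c)
    finally show "norm (LINT x|lebesgue_on K. w s x $ j * w s x $ j) \<le> (L2_norm \<Omega> (w s))\<^sup>2"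
      by (simp add: Bochner_Integration.integral_nonneg)
  qed
qed

lemma faces_null_imp_edge_null:
  assumes E: "E \<in> faces \<T>"
    and lim: "((\<lambda>s. faces_L2_norm \<T> (w s)) \<longlongrightarrow> 0) F"
  shows "((\<lambda>s. LINT x|lebesgue_on {0..1}. w s (edge_path E x) * w s (edge_path E x)) \<longlongrightarrow> 0) F"
proof (rule Lim_null_comparison)
  let ?l = "dist (fst (edge_ends E)) (snd (edge_ends E))"
  show "((\<lambda>s. (faces_L2_norm \<T> (w s))\<^sup>2 / ?l) \<longlongrightarrow> 0) F"
    using tendsto_divide[OF tendsto_power[OF lim, of 2] tendsto_const[of ?l]] edge_length_pos[OF E] by simp
  have "norm (LINT x|lebesgue_on {0..1}. w s (edge_path E x) * w s (edge_path E x)) \<le> (faces_L2_norm \<T> (w s))\<^sup>2 / ?l" for s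
  proof -
    have "(faces_L2_norm \<T> (w s))\<^sup>2 = (\<Sum>E\<in>faces \<T>. edge_integral E (\<lambda>x. (w s x)\<^sup>2))"
      unfolding faces_L2_norm_def by (intro real_sqrt_pow2 sum_nonneg edge_integral_nonneg) simp
    moreover have "edge_integral E (\<lambda>x. (w s x)\<^sup>2) \<le> (\<Sum>E\<in>faces \<T>. edge_integral E (\<lambda>x. (w s x)\<^sup>2))"
      by (rule member_le_sum[OF E _ finite_faces]) (simp add: edge_integral_nonneg)
    ultimately show ?thesis using edge_length_pos[OF E]
      by (simp add: edge_integral_def power2_eq_square field_simps Bochner_Integration.integral_nonneg)
  qed
  then show "\<forall>\<^sub>F s in F. norm (LINT x|lebesgue_on {0..1}. w s (edge_path E x) * w s (edge_path E x)) \<le> (faces_L2_norm \<T> (w s))\<^sup>2 / ?l"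
    by simp
qed

lemma ulim_elem_poly:
  assumes K: "K \<in> \<T>" and S: "compact S"
    and w: "\<forall>\<^sub>F s in F. ae_poly K k (w s)" and w': "ae_poly K k w'"
    and lim: "\<And>i. i \<in> poly_index k \<Longrightarrow> ((\<lambda>s. elem_coeff K k i (w s)) \<longlongrightarrow> elem_coeff K k i w') F"
  shows "ulim F S (\<lambda>s. elem_poly K (w s)) (elem_poly K w')"
proof (rule ulim_cong)
  note e = elem_poly_expansion(1)[OF compact_elem[OF K] interior_elem[OF K]]
  show "\<forall>\<^sub>F s in F. elem_poly K (w s) = (\<lambda>x. \<Sum>i\<in>poly_index k. elem_coeff K k i (w s) * monomial2 i x)"
    using w by eventually_elim (rule e)
  show "ulim F S (\<lambda>s x. \<Sum>i\<in>poly_index k. elem_coeff K k i (w s) * monomial2 i x) (elem_poly K w')"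
    unfolding e[OF w'] by (intro ulim_sum ulim_mult ulim_scalar ulim_const S lim continuous_on_monomial2)
qed

end

section \<open>Solutions of the scheme in time\<close>

locale hdg_trajectory = triangulated_domain +
  fixes \<tau> :: "(real^2) set \<Rightarrow> real" and T :: real and k :: nat
    and u0 u1 :: "real^2 \<Rightarrow> real"
    and u ut utt uhat :: "real \<Rightarrow> real^2 \<Rightarrow> real" and q :: "real \<Rightarrow> real^2 \<Rightarrow> real^2"
  assumes tau_pos: "\<forall>E\<in>faces \<T>. \<tau> E > 0"
    and sol: "hdg_solution \<Omega> \<T> \<tau> k T u0 u1 u ut utt q uhat"
begin

lemma u_W: "t \<in> {0..T} \<Longrightarrow> u t \<in> W_h \<Omega> \<T> k"
  and q_V: "t \<in> {0..T} \<Longrightarrow> q t \<in> V_h \<Omega> \<T> k"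
  and uhat_M: "t \<in> {0..T} \<Longrightarrow> uhat t \<in> M_h \<T> k"
  and ut_W: "t \<in> {0..T} \<Longrightarrow> ut t \<in> W_h \<Omega> \<T> k"
  and utt_W: "t \<in> {0<..T} \<Longrightarrow> utt t \<in> W_h \<Omega> \<T> k"
  and u_deriv: "t \<in> {0..T} \<Longrightarrow> has_time_deriv \<Omega> T u (ut t) t"
  and ut_deriv: "t \<in> {0<..T} \<Longrightarrow> has_time_deriv \<Omega> T ut (utt t) t"
  and ut_cont: "time_continuous \<Omega> T ut"
  and q_cont: "time_continuous \<Omega> T q"
  and uhat_cont: "time_continuous_faces \<T> T uhat"
  and scheme: "t \<in> {0<..T} \<Longrightarrow> hdg_equations \<Omega> \<T> \<tau> k (u t) (utt t) (q t) (uhat t)"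
  using sol unfolding hdg_solution_def by blast+

lemma eventually_time: "\<forall>\<^sub>F s in at t within {0..T}. s \<in> {0..T}"
  by (simp add: eventually_at_filter)

text \<open>Differentiability in time with values in \<open>L\<^sup>2\<close> becomes differentiability of scalar functions, since
each coefficient is a bounded linear functional.\<close>

lemma elem_coeff_has_derivative:
  assumes w: "\<And>s. s \<in> {0..T} \<Longrightarrow> w s \<in> W_h \<Omega> \<T> k" and v: "v \<in> W_h \<Omega> \<T> k" and t: "t \<in> {0..T}"
    and d: "has_time_deriv \<Omega> T w v t" and K: "K \<in> \<T>" and i: "i \<in> poly_index k"
  shows "((\<lambda>s. elem_coeff K k i (w s)) has_field_derivative elem_coeff K k i v) (at t within {0..T})"
proof -
  let ?F = "at t within {0..T}" and ?d = "\<lambda>s x. (w s x - w t x) / (s - t) - v x"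
  note Kc = compact_elem[OF K] interior_elem[OF K]
  have ac: "ae_cont L (?d s)" if "s \<in> {0..T}" "L \<in> \<T>" for s L
    by (intro ae_cont_diff ae_cont_divide W_h_ae_cont[OF w] W_h_ae_cont[OF v] that t)
  have ev: "\<forall>\<^sub>F s in ?F. \<forall>L\<in>\<T>. ae_cont L (?d s)"
    using eventually_time by eventually_elim (simp add: ac)
  have "((\<lambda>s. elem_coeff K k i (?d s)) \<longlongrightarrow> 0) ?F"
  proof (rule elem_coeff_tendsto_0[OF Kc i])
    show "\<forall>\<^sub>F s in ?F. ae_cont K (?d s)" using ev by eventually_elim (use K in blast)
    show "((\<lambda>s. LINT x|lebesgue_on K. ?d s x * ?d s x) \<longlongrightarrow> 0) ?F"
      by (rule L2_null_imp_elem_null[OF K ev]) (use d in \<open>simp add: has_time_deriv_def\<close>)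
  qed
  moreover have "\<forall>\<^sub>F s in ?F. elem_coeff K k i (?d s)
      = (elem_coeff K k i (w s) - elem_coeff K k i (w t)) / (s - t) - elem_coeff K k i v"
    using eventually_time
  proof eventually_elim
    fix s assume s: "s \<in> {0..T}"
    have a: "ae_cont K (w s)" "ae_cont K (w t)" "ae_cont K v"
      by (intro W_h_ae_cont[OF w] W_h_ae_cont[OF v] s t K)+
    have "elem_coeff K k i (?d s) = elem_coeff K k i (\<lambda>x. (w s x - w t x) / (s - t)) - elem_coeff K k i v"
      by (intro elem_coeff_diff Kc i ae_cont_divide ae_cont_diff a)
    also have "elem_coeff K k i (\<lambda>x. (w s x - w t x) / (s - t)) = elem_coeff K k i (\<lambda>x. w s x - w t x) / (s - t)"
      by (rule elem_coeff_divide)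
    also have "elem_coeff K k i (\<lambda>x. w s x - w t x) = elem_coeff K k i (w s) - elem_coeff K k i (w t)"
      by (intro elem_coeff_diff Kc i a)
    finally show "elem_coeff K k i (?d s)
      = (elem_coeff K k i (w s) - elem_coeff K k i (w t)) / (s - t) - elem_coeff K k i v" .
  qed
  ultimately have "((\<lambda>s. (elem_coeff K k i (w s) - elem_coeff K k i (w t)) / (s - t) - elem_coeff K k i v) \<longlongrightarrow> 0) ?F"
    by (rule Lim_transform_eventually)
  then show ?thesis unfolding has_field_derivative_iff by (rule LIM_zero_cancel)
qed

lemma elem_coeff_has_derivative_imp_tendsto:
  "((\<lambda>s. elem_coeff K k i (w s)) has_field_derivative D) (at t within {0..T}) \<Longrightarrow>
   ((\<lambda>s. elem_coeff K k i (w s)) \<longlongrightarrow> elem_coeff K k i (w t)) (at t within {0..T})"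
  using has_field_derivative_imp_has_derivative has_derivative_continuous continuous_within by blast

lemma u_coeff_deriv:
  "t \<in> {0..T} \<Longrightarrow> K \<in> \<T> \<Longrightarrow> i \<in> poly_index k \<Longrightarrow>
    ((\<lambda>s. elem_coeff K k i (u s)) has_field_derivative elem_coeff K k i (ut t)) (at t within {0..T})"
  by (rule elem_coeff_has_derivative[OF u_W ut_W _ u_deriv])

lemma ut_coeff_deriv:
  "t \<in> {0<..T} \<Longrightarrow> K \<in> \<T> \<Longrightarrow> i \<in> poly_index k \<Longrightarrow>
    ((\<lambda>s. elem_coeff K k i (ut s)) has_field_derivative elem_coeff K k i (utt t)) (at t within {0..T})"
  by (rule elem_coeff_has_derivative[OF ut_W utt_W _ ut_deriv]) auto

lemma tendsto_elem_coeffI: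
  assumes K: "K \<in> \<T>" and i: "i \<in> poly_index k" and t: "t \<in> {0..T}"
    and w: "\<And>s. s \<in> {0..T} \<Longrightarrow> ae_cont K (w s)"
    and lim: "((\<lambda>s. LINT x|lebesgue_on K. (w s x - w t x) * (w s x - w t x)) \<longlongrightarrow> 0) (at t within {0..T})"
  shows "((\<lambda>s. elem_coeff K k i (w s)) \<longlongrightarrow> elem_coeff K k i (w t)) (at t within {0..T})"
proof -
  let ?F = "at t within {0..T}"
  note Kc = compact_elem[OF K] interior_elem[OF K]
  have "((\<lambda>s. elem_coeff K k i (\<lambda>x. w s x - w t x)) \<longlongrightarrow> 0) ?F"
    by (rule elem_coeff_tendsto_0[OF Kc i _ lim])
      (use eventually_time in eventually_elim, intro ae_cont_diff w t)
  moreover have "\<forall>\<^sub>F s in ?F. elem_coeff K k i (\<lambda>x. w s x - w t x) = elem_coeff K k i (w s) - elem_coeff K k i (w t)"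
    using eventually_time by eventually_elim (intro elem_coeff_diff Kc i w t)
  ultimately have "((\<lambda>s. elem_coeff K k i (w s) - elem_coeff K k i (w t)) \<longlongrightarrow> 0) ?F"
    by (rule Lim_transform_eventually)
  then show ?thesis by (rule LIM_zero_cancel)
qed

lemma ut_coeff_tendsto:
  assumes t: "t \<in> {0..T}" and K: "K \<in> \<T>" and i: "i \<in> poly_index k"
  shows "((\<lambda>s. elem_coeff K k i (ut s)) \<longlongrightarrow> elem_coeff K k i (ut t)) (at t within {0..T})"
proof (rule tendsto_elem_coeffI[OF K i t])
  show "ae_cont K (ut s)" if "s \<in> {0..T}" for s by (rule W_h_ae_cont[OF ut_W[OF that] K])
  show "((\<lambda>s. LINT x|lebesgue_on K. (ut s x - ut t x) * (ut s x - ut t x)) \<longlongrightarrow> 0) (at t within {0..T})"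
  proof (rule L2_null_imp_elem_null[OF K])
    show "\<forall>\<^sub>F s in at t within {0..T}. \<forall>L\<in>\<T>. ae_cont L (\<lambda>x. ut s x - ut t x)"
      using eventually_time by eventually_elim (intro ballI ae_cont_diff W_h_ae_cont[OF ut_W] t)
    show "((\<lambda>s. L2_norm \<Omega> (\<lambda>x. ut s x - ut t x)) \<longlongrightarrow> 0) (at t within {0..T})"
      using ut_cont t unfolding time_continuous_def by blast
  qed
qed

lemma q_coeff_tendsto:
  assumes t: "t \<in> {0..T}" and K: "K \<in> \<T>" and i: "i \<in> poly_index k"
  shows "((\<lambda>s. elem_coeff K k i (\<lambda>x. q s x $ j)) \<longlongrightarrow> elem_coeff K k i (\<lambda>x. q t x $ j)) (at t within {0..T})"
proof (rule tendsto_elem_coeffI[OF K i t])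
  show "ae_cont K (\<lambda>x. q s x $ j)" if "s \<in> {0..T}" for s by (rule V_h_ae_cont[OF q_V[OF that] K])
  have "((\<lambda>s. LINT x|lebesgue_on K. (q s x - q t x) $ j * (q s x - q t x) $ j) \<longlongrightarrow> 0) (at t within {0..T})"
  proof (rule L2_null_imp_elem_null_vec[OF K])
    show "\<forall>\<^sub>F s in at t within {0..T}. \<forall>L\<in>\<T>. \<forall>i. ae_cont L (\<lambda>x. (q s x - q t x) $ i)"
      unfolding vector_minus_component
      using eventually_time by eventually_elim (intro ballI allI ae_cont_diff V_h_ae_cont[OF q_V] t)
    show "((\<lambda>s. L2_norm \<Omega> (\<lambda>x. q s x - q t x)) \<longlongrightarrow> 0) (at t within {0..T})"
      using q_cont t unfolding time_continuous_def by blast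
  qed
  then show "((\<lambda>s. LINT x|lebesgue_on K. (q s x $ j - q t x $ j) * (q s x $ j - q t x $ j)) \<longlongrightarrow> 0) (at t within {0..T})"
    by simp
qed

text \<open>A representative of the numerical trace on a face that is polynomial everywhere, as a function of the
parameter of the face. Its coefficients are bounded linear functionals of the trace.\<close>

definition trace_rep where
  "trace_rep E s = (\<lambda>x. \<Sum>i\<le>k. edge_coeff k i (\<lambda>r. uhat s (edge_path E r)) * x ^ i)"

lemma AE_trace_rep:
  assumes s: "s \<in> {0..T}" and E: "E \<in> faces \<T>"
  shows "AE r in lebesgue_on {0..1}. uhat s (edge_path E r) = trace_rep E s r"
proof -
  obtain p where p: "p \<in> poly_fun k" "AE r in lebesgue_on {0..1}. uhat s (edge_path E r) = p (edge_path E r)"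
    using uhat_M[OF s] E unfolding M_h_def by blast
  obtain c where c: "\<forall>r. p (edge_path E r) = (\<Sum>i\<le>k. c i * r ^ i)"
    using poly_fun_on_line[OF p(1)] unfolding edge_path_def by blast
  show ?thesis unfolding trace_rep_def
    by (rule edge_expansion[where c=c]) (use p(2) c in simp)
qed

lemma continuous_trace_rep: "continuous_on S (trace_rep E s)"
  unfolding trace_rep_def by (intro continuous_intros)

lemma ulim_trace_rep:
  assumes t: "t \<in> {0..T}" and E: "E \<in> faces \<T>"
  shows "ulim (at t within {0..T}) {0..1} (trace_rep E) (trace_rep E t)"
proof -
  let ?F = "at t within {0..T}" and ?h = "\<lambda>s r. uhat s (edge_path E r)"
  have ac: "ae_cont {0..1} (?h s)" if "s \<in> {0..T}" for s
    using edge_cont_M_h[OF uhat_M[OF that] E] by (simp add: edge_cont_def)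
  have "((\<lambda>s. edge_coeff k i (?h s)) \<longlongrightarrow> edge_coeff k i (?h t)) ?F" if i: "i \<le> k" for i
  proof -
    have "((\<lambda>s. edge_coeff k i (\<lambda>r. ?h s r - ?h t r)) \<longlongrightarrow> 0) ?F"
    proof (rule edge_coeff_tendsto_0[OF i])
      show "\<forall>\<^sub>F s in ?F. ae_cont {0..1} (\<lambda>r. ?h s r - ?h t r)"
        using eventually_time by eventually_elim (intro ae_cont_diff ac t)
      show "((\<lambda>s. LINT r|lebesgue_on {0..1}. (?h s r - ?h t r) * (?h s r - ?h t r)) \<longlongrightarrow> 0) ?F"
        by (rule faces_null_imp_edge_null[OF E, where w="\<lambda>s x. uhat s x - uhat t x"])
          (use uhat_cont t in \<open>simp add: time_continuous_faces_def\<close>)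
    qed
    moreover have "\<forall>\<^sub>F s in ?F. edge_coeff k i (\<lambda>r. ?h s r - ?h t r) = edge_coeff k i (?h s) - edge_coeff k i (?h t)"
      using eventually_time by eventually_elim (intro edge_coeff_diff i ac t)
    ultimately have "((\<lambda>s. edge_coeff k i (?h s) - edge_coeff k i (?h t)) \<longlongrightarrow> 0) ?F"
      by (rule Lim_transform_eventually)
    then show ?thesis by (rule LIM_zero_cancel)
  qed
  then show ?thesis unfolding trace_rep_def
    by (intro ulim_sum ulim_mult ulim_scalar ulim_const continuous_intros) auto
qed

lemma ulim_u:
  assumes t: "t \<in> {0..T}" and K: "K \<in> \<T>" and S: "compact S"
  shows "ulim (at t within {0..T}) S (\<lambda>s. elem_poly K (u s)) (elem_poly K (u t))"
  by (rule ulim_elem_poly[OF K S _ W_h_ae_poly[OF u_W[OF t] K]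
        elem_coeff_has_derivative_imp_tendsto[OF u_coeff_deriv[OF t K]]])
    (use eventually_time in eventually_elim, rule W_h_ae_poly[OF u_W K])

lemma ulim_ut:
  assumes t: "t \<in> {0..T}" and K: "K \<in> \<T>" and S: "compact S"
  shows "ulim (at t within {0..T}) S (\<lambda>s. elem_poly K (ut s)) (elem_poly K (ut t))"
  by (rule ulim_elem_poly[OF K S _ W_h_ae_poly[OF ut_W[OF t] K] ut_coeff_tendsto[OF t K]])
    (use eventually_time in eventually_elim, rule W_h_ae_poly[OF ut_W K])

lemma ulim_q:
  assumes t: "t \<in> {0..T}" and K: "K \<in> \<T>" and S: "compact S"
  shows "ulim (at t within {0..T}) S (\<lambda>s. elem_poly K (\<lambda>x. q s x $ j)) (elem_poly K (\<lambda>x. q t x $ j))"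
  by (rule ulim_elem_poly[OF K S _ V_h_ae_poly[OF q_V[OF t] K] q_coeff_tendsto[OF t K]])
    (use eventually_time in eventually_elim, rule V_h_ae_poly[OF q_V K])

lemma continuous_u: "s \<in> {0..T} \<Longrightarrow> K \<in> \<T> \<Longrightarrow> continuous_on S (elem_poly K (u s))"
  by (rule continuous_elem_poly[OF W_h_ae_poly[OF u_W]])

lemma continuous_ut: "s \<in> {0..T} \<Longrightarrow> K \<in> \<T> \<Longrightarrow> continuous_on S (elem_poly K (ut s))"
  by (rule continuous_elem_poly[OF W_h_ae_poly[OF ut_W]])

lemma continuous_utt: "s \<in> {0<..T} \<Longrightarrow> K \<in> \<T> \<Longrightarrow> continuous_on S (elem_poly K (utt s))"
  by (rule continuous_elem_poly[OF W_h_ae_poly[OF utt_W]])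

lemma continuous_q: "s \<in> {0..T} \<Longrightarrow> K \<in> \<T> \<Longrightarrow> continuous_on S (elem_poly K (\<lambda>x. q s x $ j))"
  by (rule continuous_elem_poly[OF V_h_ae_poly[OF q_V]])

lemma ulim_difference_quotient:
  assumes w: "\<And>s. s \<in> {0..T} \<Longrightarrow> w s \<in> W_h \<Omega> \<T> k" and v: "v \<in> W_h \<Omega> \<T> k" and t: "t \<in> {0..T}" and K: "K \<in> \<T>"
    and d: "\<And>i. i \<in> poly_index k \<Longrightarrow> ((\<lambda>s. elem_coeff K k i (w s)) has_field_derivative elem_coeff K k i v) (at t within {0..T})"
  shows "ulim (at t within {0..T}) K (\<lambda>s x. (elem_poly K (w s) x - elem_poly K (w t) x) / (s - t)) (elem_poly K v)"
proof (rule ulim_cong)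
  let ?c = "\<lambda>i s. (elem_coeff K k i (w s) - elem_coeff K k i (w t)) / (s - t)"
  note e = elem_poly_expansion(1)[OF compact_elem[OF K] interior_elem[OF K] W_h_ae_poly[OF _ K]]
  show "ulim (at t within {0..T}) K (\<lambda>s x. \<Sum>i\<in>poly_index k. ?c i s * monomial2 i x) (elem_poly K v)"
    unfolding e[OF v]
    by (intro ulim_sum ulim_mult ulim_scalar ulim_const compact_elem K continuous_on_monomial2)
      (use d in \<open>simp add: has_field_derivative_iff\<close>)
  show "\<forall>\<^sub>F s in at t within {0..T}. (\<lambda>x. (elem_poly K (w s) x - elem_poly K (w t) x) / (s - t))
     = (\<lambda>x. \<Sum>i\<in>poly_index k. ?c i s * monomial2 i x)"
    using eventually_time
    by eventually_elim (simp add: e[OF w] e[OF w[OF t]] sum_divide_distrib flip: sum_subtractf left_diff_distrib)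
qed

lemma compact_edge_path: "compact (edge_path E ` {0..1})"
  and continuous_edge_path: "continuous_on S (edge_path E)"
  unfolding edge_path_def by (auto intro!: compact_continuous_image continuous_on_linepath)

lemma ulim_elem_on_edge:
  assumes "\<And>S. compact S \<Longrightarrow> ulim F S g h"
  shows "ulim F {0..1} (\<lambda>s r. g s (edge_path E r)) (\<lambda>r. h (edge_path E r))"
  by (rule ulim_compose[OF assms[OF compact_edge_path] continuous_edge_path]) simp

lemma ae_cont_q_inner: "s \<in> {0..T} \<Longrightarrow> K \<in> \<T> \<Longrightarrow> (\<And>j. continuous_on K (g j)) \<Longrightarrow>
    ae_cont K (\<lambda>x. \<Sum>j\<in>UNIV. elem_poly K (\<lambda>x. q s x $ j) x * g j x)"
  by (intro ae_cont_sum ae_cont_mult ae_cont_continuous continuous_q)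

lemma AE_q_elem_poly:
  assumes "s \<in> {0..T}" "K \<in> \<T>"
  shows "AE x in lebesgue_on K. q s x = (\<chi> j. elem_poly K (\<lambda>x. q s x $ j) x)"
proof -
  have "AE x in lebesgue_on K. q s x $ j = elem_poly K (\<lambda>x. q s x $ j) x" for j
    by (rule AE_elem_poly[OF V_h_ae_poly[OF q_V[OF assms(1)] assms(2)] assms(2)])
  from this[of 1] this[of 2] show ?thesis
    by eventually_elim (simp add: vec_eq_iff forall_2)
qed

lemma integral_q_inner_tendsto:
  assumes t: "t \<in> {0..T}" and K: "K \<in> \<T>" and g: "\<And>j. continuous_on K (g j)"
  shows "((\<lambda>s. LINT x|lebesgue_on K. q s x \<bullet> (\<chi> j. g j x)) \<longlongrightarrow> (LINT x|lebesgue_on K. q t x \<bullet> (\<chi> j. g j x))) (at t within {0..T})"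
proof -
  let ?Q = "\<lambda>s j. elem_poly K (\<lambda>x. q s x $ j)"
  have e: "(LINT x|lebesgue_on K. q s x \<bullet> (\<chi> j. g j x)) = (LINT x|lebesgue_on K. (\<Sum>j\<in>UNIV. ?Q s j x * g j x))"
    if "s \<in> {0..T}" for s
    by (rule integral_cong_ae_cont[OF ae_cont_q_inner[OF that K g] compact_elem[OF K]])
      (use AE_q_elem_poly[OF that K] in eventually_elim, simp add: inner_vec_def)
  have "((\<lambda>s. LINT x|lebesgue_on K. (\<Sum>j\<in>UNIV. ?Q s j x * g j x)) \<longlongrightarrow> (LINT x|lebesgue_on K. (\<Sum>j\<in>UNIV. ?Q t j x * g j x))) (at t within {0..T})"
    by (intro ulim_integral ulim_sum ulim_mult ulim_const ulim_q g t K compact_elem)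
  then show ?thesis unfolding e[OF t]
    by (rule Lim_transform_eventually) (use eventually_time in eventually_elim, simp add: e)
qed

text \<open>Continuity of \<open>q\<close> and of the trace in time is used here and in \<open>stored_energy_tendsto\<close>; the traces of
\<open>u\<close> and \<open>q\<close> on the faces converge because the representing polynomials converge uniformly.\<close>

lemma residual_coeff_tendsto:
  assumes t: "t \<in> {0..T}" and K: "K \<in> \<T>"
  shows "((\<lambda>s. residual_coeff \<tau> (u s) (q s) (uhat s) K i) \<longlongrightarrow> residual_coeff \<tau> (u t) (q t) (uhat t) K i) (at t within {0..T})"
proof -
  let ?F = "at t within {0..T}"
  have "((\<lambda>s. edge_integral E (\<lambda>x. q_flux \<tau> (u s) (q s) (uhat s) K E x * monomial2 i x))
      \<longlongrightarrow> edge_integral E (\<lambda>x. q_flux \<tau> (u t) (q t) (uhat t) K E x * monomial2 i x)) ?F"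
    if E: "E \<in> edges K" for E
  proof -
    note EF = edges_subset_faces[OF K E]
    let ?n = "outward_normal K E"
    define G where "G = (\<lambda>s r. ((\<Sum>j\<in>UNIV. elem_poly K (\<lambda>x. q s x $ j) (edge_path E r) * ?n $ j)
        - \<tau> E * (elem_poly K (u s) (edge_path E r) - trace_rep E s r)) * monomial2 i (edge_path E r))"
    have ul: "ulim ?F {0..1} G (G t)"
      unfolding G_def
      by (intro ulim_mult ulim_diff ulim_sum ulim_scalar tendsto_const ulim_trace_rep[OF t EF]
          ulim_const[of _ "\<lambda>r. monomial2 i (edge_path E r)"]
          ulim_elem_on_edge[OF ulim_u[OF t K]] ulim_elem_on_edge[OF ulim_q[OF t K]]
          compact_Icc continuous_on_compose2[OF continuous_on_monomial2 continuous_edge_path subset_UNIV])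
    have Gc: "continuous_on {0..1} (G s)" if "s \<in> {0..T}" for s
      unfolding G_def
      by (intro continuous_intros continuous_trace_rep
          continuous_on_compose2[OF continuous_on_monomial2 continuous_edge_path subset_UNIV]
          continuous_on_compose2[OF continuous_u[OF that K] continuous_edge_path subset_UNIV]
          continuous_on_compose2[OF continuous_q[OF that K] continuous_edge_path subset_UNIV])
    have e: "(LINT r|lebesgue_on {0..1}. q_flux \<tau> (u s) (q s) (uhat s) K E (edge_path E r) * monomial2 i (edge_path E r))
        = (LINT r|lebesgue_on {0..1}. G s r)" if "s \<in> {0..T}" for s
      by (rule integral_cong_ae_cont[OF ae_cont_continuous[OF Gc[OF that]]])
        (simp, use AE_trace_rep[OF that EF] in eventually_elim,
         simp add: G_def q_flux_def elem_poly_vec_def inner_vec_def)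
    have "((\<lambda>s. LINT r|lebesgue_on {0..1}. q_flux \<tau> (u s) (q s) (uhat s) K E (edge_path E r) * monomial2 i (edge_path E r))
      \<longlongrightarrow> (LINT r|lebesgue_on {0..1}. q_flux \<tau> (u t) (q t) (uhat t) K E (edge_path E r) * monomial2 i (edge_path E r))) ?F"
      unfolding e[OF t]
      by (rule Lim_transform_eventually[OF ulim_integral[OF ul]])
        (use eventually_time in eventually_elim, simp add: e)
    then show ?thesis unfolding edge_integral_def by (rule tendsto_mult_left)
  qed
  then show ?thesis unfolding residual_coeff_def
    by (intro tendsto_diff tendsto_sum integral_q_inner_tendsto[OF t K]
      smooth1_partial_continuous_on[OF smooth1_monomial2])
qed

section \<open>Conservation of energy\<close>

definition stored_energy where
  "stored_energy s = energy_form \<tau> (u s) (q s) (uhat s) (u s) (q s) (uhat s)"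

lemma stored_energy_tendsto:
  assumes t: "t \<in> {0..T}"
  shows "(stored_energy \<longlongrightarrow> stored_energy t) (at t within {0..T})"
proof -
  let ?F = "at t within {0..T}"
  have 1: "((\<lambda>s. LINT x|lebesgue_on K. q s x \<bullet> q s x) \<longlongrightarrow> (LINT x|lebesgue_on K. q t x \<bullet> q t x)) ?F" if K: "K \<in> \<T>" for K
  proof -
    let ?Q = "\<lambda>s j. elem_poly K (\<lambda>x. q s x $ j)"
    have e: "(LINT x|lebesgue_on K. q s x \<bullet> q s x) = (LINT x|lebesgue_on K. (\<Sum>j\<in>UNIV. ?Q s j x * ?Q s j x))"
      if s: "s \<in> {0..T}" for s
      by (rule integral_cong_ae_cont[OF ae_cont_q_inner[OF s K continuous_q[OF s K]] compact_elem[OF K]])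
        (use AE_q_elem_poly[OF s K] in eventually_elim, simp add: inner_vec_def)
    have "((\<lambda>s. LINT x|lebesgue_on K. (\<Sum>j\<in>UNIV. ?Q s j x * ?Q s j x)) \<longlongrightarrow> (LINT x|lebesgue_on K. (\<Sum>j\<in>UNIV. ?Q t j x * ?Q t j x))) ?F"
      by (intro ulim_integral ulim_sum ulim_mult ulim_q t K compact_elem)
    then show ?thesis unfolding e[OF t]
      by (rule Lim_transform_eventually) (use eventually_time in eventually_elim, simp add: e)
  qed
  have 2: "((\<lambda>s. edge_integral E (\<lambda>x. \<tau> E * ((elem_poly K (u s) x - uhat s x) * (elem_poly K (u s) x - uhat s x))))
      \<longlongrightarrow> edge_integral E (\<lambda>x. \<tau> E * ((elem_poly K (u t) x - uhat t x) * (elem_poly K (u t) x - uhat t x)))) ?F"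
    if K: "K \<in> \<T>" and E: "E \<in> edges K" for K E
  proof -
    note EF = edges_subset_faces[OF K E]
    define J where "J = (\<lambda>s r. elem_poly K (u s) (edge_path E r) - trace_rep E s r)"
    have ul: "ulim ?F {0..1} J (J t)"
      unfolding J_def by (intro ulim_diff ulim_trace_rep[OF t EF] ulim_elem_on_edge[OF ulim_u[OF t K]])
    have Jc: "continuous_on {0..1} (J s)" if "s \<in> {0..T}" for s
      unfolding J_def
      by (intro continuous_intros continuous_trace_rep
          continuous_on_compose2[OF continuous_u[OF that K] continuous_edge_path subset_UNIV])
    have e: "(LINT r|lebesgue_on {0..1}. \<tau> E * ((elem_poly K (u s) (edge_path E r) - uhat s (edge_path E r)) * (elem_poly K (u s) (edge_path E r) - uhat s (edge_path E r))))
        = (LINT r|lebesgue_on {0..1}. \<tau> E * (J s r * J s r))" if "s \<in> {0..T}" for s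
      by (rule integral_cong_ae_cont)
        (intro ae_cont_continuous continuous_intros Jc that, simp,
         use AE_trace_rep[OF that EF] in eventually_elim, simp add: J_def)
    have "((\<lambda>s. LINT r|lebesgue_on {0..1}. \<tau> E * (J s r * J s r)) \<longlongrightarrow> (LINT r|lebesgue_on {0..1}. \<tau> E * (J t r * J t r))) ?F"
      by (intro ulim_integral ulim_mult ulim_scalar tendsto_const ul compact_Icc)
    then have "((\<lambda>s. LINT r|lebesgue_on {0..1}. \<tau> E * ((elem_poly K (u s) (edge_path E r) - uhat s (edge_path E r)) * (elem_poly K (u s) (edge_path E r) - uhat s (edge_path E r))))
      \<longlongrightarrow> (LINT r|lebesgue_on {0..1}. \<tau> E * ((elem_poly K (u t) (edge_path E r) - uhat t (edge_path E r)) * (elem_poly K (u t) (edge_path E r) - uhat t (edge_path E r))))) ?F"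
      unfolding e[OF t]
      by (rule Lim_transform_eventually) (use eventually_time in eventually_elim, simp only: e)
    then show ?thesis unfolding edge_integral_def by (rule tendsto_mult_left)
  qed
  show ?thesis
    unfolding stored_energy_def energy_form_def mesh_integral_def bdry_integral_def
    by (intro tendsto_add tendsto_sum 1 2)
qed

text \<open>In \<open>energy_form_difference\<close> each coefficient of the increment of \<open>u\<close>, divided by \<open>s - t\<close>, converges to
the coefficient of \<open>u\<^sub>t\<close>, and the two values of \<open>b\<close> at a monomial have the same limit. This gives the
factor \<open>2\<close>.\<close>

lemma stored_energy_has_derivative:
  assumes t: "t \<in> {0<..T}"
  shows "(stored_energy has_field_derivative 2 * residual_form \<tau> (ut t) (u t) (q t) (uhat t)) (at t within {0..T})"
proof -
  let ?F = "at t within {0..T}"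
  let ?c = "\<lambda>s K i. elem_coeff K k i (u s)" and ?R = "\<lambda>s K i. residual_coeff \<tau> (u s) (q s) (uhat s) K i"
  have t': "t \<in> {0..T}" using t by simp
  have exp: "residual_form \<tau> w (u r) (q r) (uhat r) = (\<Sum>K\<in>\<T>. \<Sum>i\<in>poly_index k. elem_coeff K k i w * ?R r K i)"
    if "r \<in> {0..T}" "w \<in> W_h \<Omega> \<T> k" for r w
    by (rule residual_form_expansion[OF u_W[OF that(1)] q_V[OF that(1)] uhat_M[OF that(1)] that(2)])
  have quot: "(stored_energy s - stored_energy t) / (s - t)
      = (\<Sum>K\<in>\<T>. \<Sum>i\<in>poly_index k. (?c s K i - ?c t K i) / (s - t) * (?R s K i + ?R t K i))"
    if s: "s \<in> {0<..T}" for s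
  proof -
    have s': "s \<in> {0..T}" using s by simp
    have "stored_energy s - stored_energy t =
        (residual_form \<tau> (u s) (u s) (q s) (uhat s) - residual_form \<tau> (u t) (u s) (q s) (uhat s))
      + (residual_form \<tau> (u s) (u t) (q t) (uhat t) - residual_form \<tau> (u t) (u t) (q t) (uhat t))"
      unfolding stored_energy_def
      by (rule energy_form_difference[OF u_W[OF t'] q_V[OF t'] uhat_M[OF t'] u_W[OF s'] q_V[OF s'] uhat_M[OF s']
          scheme[OF t] scheme[OF s]])
    also have "\<dots> = (\<Sum>K\<in>\<T>. \<Sum>i\<in>poly_index k. (?c s K i - ?c t K i) * (?R s K i + ?R t K i))"
      unfolding exp[OF s' u_W[OF s']] exp[OF s' u_W[OF t']] exp[OF t' u_W[OF s']] exp[OF t' u_W[OF t']]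
        sum_subtractf[symmetric] sum.distrib[symmetric]
      by (intro sum.cong refl) (simp add: algebra_simps)
    finally show ?thesis by (simp add: sum_divide_distrib)
  qed
  have "((\<lambda>s. \<Sum>K\<in>\<T>. \<Sum>i\<in>poly_index k. (?c s K i - ?c t K i) / (s - t) * (?R s K i + ?R t K i))
     \<longlongrightarrow> (\<Sum>K\<in>\<T>. \<Sum>i\<in>poly_index k. elem_coeff K k i (ut t) * (?R t K i + ?R t K i))) ?F"
    by (intro tendsto_sum tendsto_mult tendsto_add residual_coeff_tendsto[OF t'] tendsto_const
        u_coeff_deriv[OF t', unfolded has_field_derivative_iff])
  also have "(\<Sum>K\<in>\<T>. \<Sum>i\<in>poly_index k. elem_coeff K k i (ut t) * (?R t K i + ?R t K i))
      = 2 * residual_form \<tau> (ut t) (u t) (q t) (uhat t)"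
    unfolding exp[OF t' ut_W[OF t']] sum_distrib_left by (intro sum.cong refl) simp
  finally have lim: "((\<lambda>s. \<Sum>K\<in>\<T>. \<Sum>i\<in>poly_index k. (?c s K i - ?c t K i) / (s - t) * (?R s K i + ?R t K i))
     \<longlongrightarrow> 2 * residual_form \<tau> (ut t) (u t) (q t) (uhat t)) ?F" .
  \<comment> \<open>The identity between the two states needs the scheme at both times, hence \<open>s > 0\<close>.\<close>
  have "\<forall>\<^sub>F s in ?F. s \<in> {0<..T}"
  proof -
    have "\<forall>\<^sub>F s in at t. s > 0"
      using t order_tendstoD(1)[OF tendsto_ident_at, of 0 t UNIV] by simp
    then have "\<forall>\<^sub>F s in ?F. s > 0" by (rule filter_leD[OF at_le, rotated]) simp
    with eventually_time show ?thesis by eventually_elim simp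
  qed
  then have "\<forall>\<^sub>F s in ?F. (\<Sum>K\<in>\<T>. \<Sum>i\<in>poly_index k. (?c s K i - ?c t K i) / (s - t) * (?R s K i + ?R t K i))
      = (stored_energy s - stored_energy t) / (s - t)"
    by eventually_elim (simp only: quot)
  with lim show ?thesis unfolding has_field_derivative_iff by (rule Lim_transform_eventually)
qed

definition kinetic where
  "kinetic s = (\<Sum>K\<in>\<T>. LINT x|lebesgue_on K. (elem_poly K (ut s) x)\<^sup>2)"

definition potential where
  "potential s = (\<Sum>K\<in>\<T>. LINT x|lebesgue_on K. F_nl (elem_poly K (u s) x))"

text \<open>The divided difference of \<open>F_nl\<close>. It extends continuously to the diagonal, where it is \<open>f_nl\<close>.\<close>

definition F_slope :: "real \<Rightarrow> real \<Rightarrow> real" where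
  "F_slope a b = (a + b) * (a * a + b * b - 2) * (1/4)"

lemma F_slope: "F_nl a - F_nl b = (a - b) * F_slope a b"
proof -
  have "(1 - a\<^sup>2)\<^sup>2 - (1 - b\<^sup>2)\<^sup>2 = (a - b) * ((a + b) * (a * a + b * b - 2))" by algebra
  then show ?thesis by (simp add: F_nl_def F_slope_def flip: right_diff_distrib)
qed

lemma F_slope_same: "F_slope a a = f_nl a"
  by (simp add: F_slope_def f_nl_def power3_eq_cube algebra_simps)

lemma kinetic_has_derivative:
  assumes t: "t \<in> {0<..T}"
  shows "(kinetic has_field_derivative 2 * mesh_integral \<T> (\<lambda>x. utt t x * ut t x)) (at t within {0..T})"
proof -
  let ?F = "at t within {0..T}"
  have t': "t \<in> {0..T}" using t by simp
  have "((\<lambda>s. LINT x|lebesgue_on K. (elem_poly K (ut s) x)\<^sup>2) has_field_derivative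
      (LINT x|lebesgue_on K. elem_poly K (utt t) x * (elem_poly K (ut t) x + elem_poly K (ut t) x))) ?F"
    if K: "K \<in> \<T>" for K
  proof (rule integral_has_derivative_difference_quotient[where p="\<lambda>s. elem_poly K (ut s)" and G="\<lambda>a. a\<^sup>2" and H="(+)"])
    show "ulim ?F K (\<lambda>s x. (elem_poly K (ut s) x - elem_poly K (ut t) x) / (s - t)) (elem_poly K (utt t))"
      by (rule ulim_difference_quotient[OF ut_W utt_W[OF t] t' K ut_coeff_deriv[OF t K]])
    show "a\<^sup>2 - b\<^sup>2 = (a - b) * (a + b)" for a b :: real by (simp add: power2_eq_square algebra_simps)
    show "ulim ?F K (\<lambda>s x. elem_poly K (ut s) x + elem_poly K (ut t) x) (\<lambda>x. elem_poly K (ut t) x + elem_poly K (ut t) x)"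
      by (intro ulim_add ulim_ut[OF t' K] ulim_const compact_elem K continuous_ut[OF t' K])
    show "\<forall>\<^sub>F s in ?F. continuous_on K (\<lambda>x. (elem_poly K (ut s) x)\<^sup>2)"
      using eventually_time
      by eventually_elim (intro continuous_intros continuous_ut K)
    show "continuous_on K (\<lambda>x. (elem_poly K (ut t) x)\<^sup>2)"
      by (intro continuous_intros continuous_ut[OF t' K])
  qed
  then have "(kinetic has_field_derivative (\<Sum>K\<in>\<T>. LINT x|lebesgue_on K. elem_poly K (utt t) x * (elem_poly K (ut t) x + elem_poly K (ut t) x))) ?F"
    unfolding kinetic_def[abs_def] by (rule DERIV_sum)
  also have "(\<Sum>K\<in>\<T>. LINT x|lebesgue_on K. elem_poly K (utt t) x * (elem_poly K (ut t) x + elem_poly K (ut t) x))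
      = 2 * mesh_integral \<T> (\<lambda>x. utt t x * ut t x)"
    unfolding mesh_integral_def sum_distrib_left
  proof (rule sum.cong[OF refl])
    fix K assume K: "K \<in> \<T>"
    have "(LINT x|lebesgue_on K. utt t x * ut t x) = (LINT x|lebesgue_on K. elem_poly K (utt t) x * elem_poly K (ut t) x)"
      by (rule integral_cong_ae_cont[OF _ compact_elem[OF K]])
        (intro ae_cont_mult ae_cont_continuous continuous_ut continuous_utt t t' K,
         use AE_elem_poly[OF W_h_ae_poly[OF ut_W[OF t'] K] K] AE_elem_poly[OF W_h_ae_poly[OF utt_W[OF t] K] K] in eventually_elim, simp)
    then show "(LINT x|lebesgue_on K. elem_poly K (utt t) x * (elem_poly K (ut t) x + elem_poly K (ut t) x))
      = 2 * (LINT x|lebesgue_on K. utt t x * ut t x)"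
      by (simp add: mult.left_commute flip: mult_2)
  qed
  finally show ?thesis .
qed

lemma potential_has_derivative:
  assumes t: "t \<in> {0..T}"
  shows "(potential has_field_derivative mesh_integral \<T> (\<lambda>x. f_nl (u t x) * ut t x)) (at t within {0..T})"
proof -
  let ?F = "at t within {0..T}"
  have "((\<lambda>s. LINT x|lebesgue_on K. F_nl (elem_poly K (u s) x)) has_field_derivative
      (LINT x|lebesgue_on K. elem_poly K (ut t) x * F_slope (elem_poly K (u t) x) (elem_poly K (u t) x))) ?F"
    if K: "K \<in> \<T>" for K
  proof (rule integral_has_derivative_difference_quotient[where p="\<lambda>s. elem_poly K (u s)" and G=F_nl and H=F_slope])
    show "ulim ?F K (\<lambda>s x. (elem_poly K (u s) x - elem_poly K (u t) x) / (s - t)) (elem_poly K (ut t))"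
      by (rule ulim_difference_quotient[OF u_W ut_W[OF t] t K u_coeff_deriv[OF t K]])
    show "F_nl a - F_nl b = (a - b) * F_slope a b" for a b by (rule F_slope)
    show "ulim ?F K (\<lambda>s x. F_slope (elem_poly K (u s) x) (elem_poly K (u t) x)) (\<lambda>x. F_slope (elem_poly K (u t) x) (elem_poly K (u t) x))"
      unfolding F_slope_def
      by (intro ulim_add ulim_mult ulim_diff ulim_u[OF t K] ulim_const[OF compact_elem[OF K]] continuous_on_const
        compact_elem K continuous_u[OF t K])
    show "\<forall>\<^sub>F s in ?F. continuous_on K (\<lambda>x. F_nl (elem_poly K (u s) x))"
      using eventually_time unfolding F_nl_def
      by eventually_elim (intro continuous_intros continuous_u K)
    show "continuous_on K (\<lambda>x. F_nl (elem_poly K (u t) x))"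
      unfolding F_nl_def by (intro continuous_intros continuous_u K t)
  qed
  then have "(potential has_field_derivative (\<Sum>K\<in>\<T>. LINT x|lebesgue_on K. elem_poly K (ut t) x * F_slope (elem_poly K (u t) x) (elem_poly K (u t) x))) ?F"
    unfolding potential_def[abs_def] by (rule DERIV_sum)
  also have "(\<Sum>K\<in>\<T>. LINT x|lebesgue_on K. elem_poly K (ut t) x * F_slope (elem_poly K (u t) x) (elem_poly K (u t) x))
      = mesh_integral \<T> (\<lambda>x. f_nl (u t x) * ut t x)"
    unfolding mesh_integral_def
  proof (rule sum.cong[OF refl], rule sym)
    fix K assume K: "K \<in> \<T>"
    have "ae_cont K (\<lambda>x. elem_poly K (ut t) x * f_nl (elem_poly K (u t) x))"
      unfolding f_nl_def
      by (intro ae_cont_continuous continuous_intros continuous_u t K continuous_ut)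
    then show "(LINT x|lebesgue_on K. f_nl (u t x) * ut t x)
      = (LINT x|lebesgue_on K. elem_poly K (ut t) x * F_slope (elem_poly K (u t) x) (elem_poly K (u t) x))"
      unfolding F_slope_same
      by (rule integral_cong_ae_cont[OF _ compact_elem[OF K]])
        (use AE_elem_poly[OF W_h_ae_poly[OF ut_W[OF t] K] K] AE_elem_poly[OF W_h_ae_poly[OF u_W[OF t] K] K] in eventually_elim, simp)
  qed
  finally show ?thesis .
qed

lemma kinetic_tendsto:
  assumes t: "t \<in> {0..T}" shows "(kinetic \<longlongrightarrow> kinetic t) (at t within {0..T})"
  unfolding kinetic_def power2_eq_square
  by (intro tendsto_sum ulim_integral ulim_mult ulim_ut t compact_elem)

lemma potential_tendsto:
  assumes t: "t \<in> {0..T}" shows "(potential \<longlongrightarrow> potential t) (at t within {0..T})"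
  using DERIV_continuous[OF potential_has_derivative[OF t]] by (simp add: continuous_within)

definition energy where
  "energy s = 1/2 * (kinetic s + stored_energy s) + potential s"

lemma hdg_energy_eq:
  assumes s: "s \<in> {0..T}"
  shows "hdg_energy \<Omega> \<T> \<tau> (u s) (ut s) (q s) (uhat s) = energy s"
proof -
  have 1: "(L2_norm \<Omega> (ut s))\<^sup>2 = kinetic s"
  proof -
    have "(L2_norm \<Omega> (ut s))\<^sup>2 = mesh_integral \<T> (\<lambda>x. ut s x * ut s x)"
      by (rule L2_norm_sq[OF W_h_ae_cont[OF ut_W[OF s]]])
    also have "\<dots> = kinetic s"
      unfolding mesh_integral_def kinetic_def power2_eq_square
    proof (rule sum.cong[OF refl])
      fix K assume K: "K \<in> \<T>"
      show "(LINT x|lebesgue_on K. ut s x * ut s x) = (LINT x|lebesgue_on K. elem_poly K (ut s) x * elem_poly K (ut s) x)"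
        by (rule integral_cong_ae_cont[OF _ compact_elem[OF K]])
          (intro ae_cont_mult ae_cont_continuous continuous_ut s K,
           use AE_elem_poly[OF W_h_ae_poly[OF ut_W[OF s] K] K] in eventually_elim, simp)
    qed
    finally show ?thesis .
  qed
  have 2: "(L2_norm \<Omega> (q s))\<^sup>2 = mesh_integral \<T> (\<lambda>x. q s x \<bullet> q s x)"
    by (rule L2_norm_sq_vec[OF V_h_ae_cont[OF q_V[OF s]]])
  have 3: "(plus_norm \<T> \<tau> (u s) (uhat s))\<^sup>2
      = bdry_integral \<T> (\<lambda>K E x. \<tau> E * ((elem_poly K (u s) x - uhat s x) * (elem_poly K (u s) x - uhat s x)))"
  proof -
    have "(plus_norm \<T> \<tau> (u s) (uhat s))\<^sup>2 = bdry_integral \<T> (\<lambda>K E x. (sqrt (\<tau> E) * (elem_poly K (u s) x - uhat s x))\<^sup>2)"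
      unfolding plus_norm_def bdry_integral_def by (intro real_sqrt_pow2 sum_nonneg edge_integral_nonneg) simp
    also have "\<dots> = bdry_integral \<T> (\<lambda>K E x. \<tau> E * ((elem_poly K (u s) x - uhat s x) * (elem_poly K (u s) x - uhat s x)))"
      unfolding bdry_integral_def
    proof (intro sum.cong refl)
      fix K E assume "K \<in> \<T>" "E \<in> edges K"
      then have "\<tau> E > 0" using tau_pos edges_subset_faces by blast
      then show "edge_integral E (\<lambda>x. (sqrt (\<tau> E) * (elem_poly K (u s) x - uhat s x))\<^sup>2)
        = edge_integral E (\<lambda>x. \<tau> E * ((elem_poly K (u s) x - uhat s x) * (elem_poly K (u s) x - uhat s x)))"
        unfolding power_mult_distrib by (simp add: power2_eq_square)
    qed
    finally show ?thesis .
  qed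
  have 4: "mesh_integral \<T> (\<lambda>x. F_nl (u s x) * 1) = potential s"
    unfolding mesh_integral_def potential_def
  proof (rule sum.cong[OF refl])
    fix K assume K: "K \<in> \<T>"
    have "ae_cont K (\<lambda>x. F_nl (elem_poly K (u s) x))"
      unfolding F_nl_def
      by (intro ae_cont_continuous continuous_intros continuous_u[OF s K])
    then show "(LINT x|lebesgue_on K. F_nl (u s x) * 1) = (LINT x|lebesgue_on K. F_nl (elem_poly K (u s) x))"
      by (rule integral_cong_ae_cont[OF _ compact_elem[OF K]])
        (use AE_elem_poly[OF W_h_ae_poly[OF u_W[OF s] K] K] in eventually_elim, simp)
  qed
  show ?thesis
    unfolding hdg_energy_def 1 2 3 4 energy_def stored_energy_def energy_form_def by (simp add: algebra_simps)
qed

text \<open>The three derivatives add up to the second equation of the scheme tested with \<open>u\<^sub>t\<close>.\<close>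

lemma energy_has_derivative_0:
  assumes t: "t \<in> {0<..T}"
  shows "(energy has_field_derivative 0) (at t within {0..T})"
proof -
  have t': "t \<in> {0..T}" using t by simp
  have "(energy has_field_derivative (1/2 * (2 * mesh_integral \<T> (\<lambda>x. utt t x * ut t x) + 2 * residual_form \<tau> (ut t) (u t) (q t) (uhat t))
      + mesh_integral \<T> (\<lambda>x. f_nl (u t x) * ut t x))) (at t within {0..T})"
    unfolding energy_def[abs_def]
    by (intro DERIV_add DERIV_cmult kinetic_has_derivative[OF t] stored_energy_has_derivative[OF t] potential_has_derivative[OF t'])
  moreover have "mesh_integral \<T> (\<lambda>x. utt t x * ut t x) + residual_form \<tau> (ut t) (u t) (q t) (uhat t)
      + mesh_integral \<T> (\<lambda>x. f_nl (u t x) * ut t x) = 0"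
    using scheme[OF t] ut_W[OF t'] unfolding hdg_equations_def residual_form_def by auto
  ultimately show ?thesis by (simp add: algebra_simps)
qed

text \<open>The derivative is known for positive times only; the single point \<open>0\<close> is covered by continuity.\<close>

lemma energy_constant:
  assumes t: "t \<in> {0..T}" shows "energy t = energy 0"
proof (rule has_derivative_zero_unique_strong_interval[where f=energy and x=t and y="energy 0" and k="{0}" and a=0 and b=T])
  show "continuous_on {0..T} energy"
    unfolding continuous_on_def energy_def
    by (intro ballI tendsto_add tendsto_mult tendsto_const kinetic_tendsto stored_energy_tendsto
      potential_tendsto)
  show "(energy has_derivative (\<lambda>h. 0)) (at s within {0..T})" if "s \<in> {0..T} - {0}" for s
    using energy_has_derivative_0[of s] that by (auto simp: has_field_derivative_def lambda_zero)
qed (use t in auto)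

end

theorem theorem2p1:
  fixes \<Omega> :: "(real^2) set" and \<T> :: "(real^2) set set" and \<tau> :: "(real^2) set \<Rightarrow> real"
    and \<sigma> T :: real and k :: nat
    and u0 u1 :: "real^2 \<Rightarrow> real"
    and u ut utt uhat :: "real \<Rightarrow> real^2 \<Rightarrow> real" and q :: "real \<Rightarrow> real^2 \<Rightarrow> real^2"
  assumes "convex_polygonal_domain \<Omega>"
    and "shape_regular_triangulation \<sigma> \<Omega> \<T>"
    and "\<forall>E\<in>faces \<T>. \<tau> E > 0"
    and "T > 0"
    and "u0 \<in> W_h \<Omega> \<T> k" and "u1 \<in> W_h \<Omega> \<T> k"
    and "hdg_solution \<Omega> \<T> \<tau> k T u0 u1 u ut utt q uhat"
  shows "\<forall>t\<in>{0..T}. hdg_energy \<Omega> \<T> \<tau> (u t) (ut t) (q t) (uhat t)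
                   = hdg_energy \<Omega> \<T> \<tau> (u 0) (ut 0) (q 0) (uhat 0)"
proof
  fix t assume t: "t \<in> {0..T}"
  interpret hdg_trajectory \<Omega> \<T> \<sigma> \<tau> T k u0 u1 u ut utt uhat q
    by unfold_locales (use assms in auto)
  have "0 \<in> {0..T}" using assms(4) by simp
  then show "hdg_energy \<Omega> \<T> \<tau> (u t) (ut t) (q t) (uhat t) = hdg_energy \<Omega> \<T> \<tau> (u 0) (ut 0) (q 0) (uhat 0)"
    using hdg_energy_eq t energy_constant[OF t] by simp
qed

end
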